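(* Consider a finite two-player zero-sum stochastic game with state set $K=\{1,\dots,n\}$, finite state-dependent action sets, stage payoff function $g$ and transition function $q$. For $\lambda\in(0,1]$ let $v_\lambda=(v^1_\lambda,\dots,v^n_\lambda)$ be the vector of $\lambda$-discounted values, and let $\dot\Delta^0$ be the reduced auxiliary matrix obtained from a Shapley-Snow kernel of each of the local games at $v_\lambda$, as constructed in the context. For any fixed $1\le k\le n$, with $V^k\subset\mathbb R$ the finite set defined in the context, one has: (i) Any accumulation point of $(v^k_\lambda)$, as $\lambda$ vanishes, belongs to the finite set $V^k$. As a consequence, the values converge and the limit $v^k_0:=\lim_{\lambda\to0}v^k_\lambda$ belongs to $V^k$. (ii) If the stage payoffs and the transition probabilities are rational, then $v^k_0$ is algebraic of order (that is, of degree over $\mathbb Q$) at most $\mathrm{rank}(\dot\Delta^0)$.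
   Context: **Matrix games.** A real matrix $A$ is identified with the zero-sum game in which Player 1 (maximizer) chooses rows and Player 2 (minimizer) chooses columns; mixed strategies $x,y$ are column probability vectors, the expected payoff is ${}^{t}xAy$ and $\mathrm{val}(A)=\max_x\min_y{}^{t}xAy=\min_y\max_x{}^{t}xAy$. **Cofactors.** For a square matrix $M$, $\mathrm{co}(M)$ is its cofactor matrix, with $(i,j)$ entry $(-1)^{i+j}$ times the determinant of $M$ with row $i$ and column $j$ deleted ($\mathrm{co}(M)=1$ for $1\times1$ matrices); $S(M)$ is the sum of the entries of $M$; $\mathbf 1$ is a column vector of ones and $U$ a matrix of ones, of the appropriate dimensions. **Shapley-Snow kernel.** Let $G$ be a matrix game. A basic solution is an extreme point $(x,y)$ of the set of pairs of optimal strategies. A Shapley-Snow kernel of $G$ is a square sub-matrix $\dot G$ of $G$ such that, for some basic solution $(x,y)$, with $\dot x,\dot y$ the restrictions of $x,y$ to the row and column indices of $\dot G$: (1) $S(\mathrm{co}(\dot G))\ne0$; (2) $\dot x=\frac{\mathrm{co}(\dot G)}{S(\mathrm{co}(\dot G))}\mathbf 1$ and $\dot y=\frac{{}^{t}\mathrm{co}(\dot G)}{S(\mathrm{co}(\dot G))}\mathbf 1$; (3) $\mathrm{val}(G)=\mathrm{val}(\dot G)=\frac{\det\dot G}{S(\mathrm{co}(\dot G))}$; (4) ${}^{t}\dot x\dot G=\mathrm{val}(G)\,{}^{t}\mathbf 1$ and $\dot G\dot y=\mathrm{val}(G)\mathbf 1$. (By Shapley and Snow (1950), every matrix game has one, and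 (1)-(2) imply (3)-(4).) **Stochastic game.** $I^k$ and $J^k$ are the finite nonempty action sets of Players 1 and 2 in state $k$; for $(i,j)\in I^k\times J^k$, $g(k,i,j)\in\mathbb R$ is the stage payoff and $q(\cdot|k,i,j)$ is a probability on $K$. At each stage $m\ge1$ the players, knowing the current state $k_m$, simultaneously choose $i_m\in I^{k_m}$, $j_m\in J^{k_m}$; the next state is drawn from $q(\cdot|k_m,i_m,j_m)$. From initial state $k$, Player 1 maximizes and Player 2 minimizes the expectation of $\sum_{m\ge1}\lambda(1-\lambda)^{m-1}g(k_m,i_m,j_m)$. This game has a value $v^k_\lambda$. For $z\in\mathbb R^n$, the local game $\mathcal G^k(\lambda,z)$ is the $I^k\times J^k$ matrix with entries $\lambda g(k,i,j)+(1-\lambda)\sum_{\ell=1}^n q(\ell|k,i,j)z^\ell$. By Shapley (1953), $v_\lambda$ is the unique $z\in\mathbb R^n$ with $z^k=\mathrm{val}(\mathcal G^k(\lambda,z))$ for all $k$. **Data array.** For $1\le k\le n$, $0\le\ell\le n$ define $I^k\times J^k$ matrices $M^k_\ell$ by $M^k_0=\lambda(g(k,i,j))_{i,j}$, $M^k_k=(1-\lambda)(q(k|k,i,j))_{i,j}-U$, and $M^k_\ell=(1-\lambda)(q(\ell|k,i,j))_{i,j}$ for $\ell\ge1$, $\ell\neq k$. Then $D(\lambda)$ is the $n\times(n+1)$ array of matrices $(M^k_\ell)$, $1\le k\le n$, $0\le\ell\le n$. **Kronecker determinant and auxiliary matrices.** For an $n\times n$ array $(A^k_\ell)$ of matrices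 in which matrices on the same row $k$ have the same size, $\det_\otimes(A^k_\ell)=\sum_{\sigma}\epsilon(\sigma)A^1_{\sigma(1)}\otimes\cdots\otimes A^n_{\sigma(n)}$, the sum being over permutations $\sigma$ of $\{1,\dots,n\}$, with $\epsilon(\sigma)$ the signature and $\otimes$ the Kronecker product. The auxiliary matrices of an $n\times(n+1)$ array with columns indexed $0,\dots,n$ are $\Delta^\ell=(-1)^\ell\det_\otimes D^{(\ell)}$, $0\le\ell\le n$, where $D^{(\ell)}$ is the array with the column indexed $\ell$ removed. $\Delta^0,\dots,\Delta^n$ denote the auxiliary matrices of $D(\lambda)$; their entries are polynomials in $\lambda$. **Reduced array.** For each $1\le k\le n$, take a Shapley-Snow kernel of the local game $\mathcal G^k(\lambda,v_\lambda)$, with row and column sets $\dot I^k\subset I^k$, $\dot J^k\subset J^k$, $|\dot I^k|=|\dot J^k|$. The reduced array $\dot D(\lambda)=(\dot M^k_\ell)$ consists of the $\dot I^k\times\dot J^k$ sub-matrices of the $M^k_\ell$, and $\dot\Delta^0,\dots,\dot\Delta^n$ are its auxiliary matrices; they are square, of equal size $\prod_{k}|\dot I^k|$, and are sub-matrices of $\Delta^0,\dots,\Delta^n$ respectively. The dependence of $\dot\Delta^0,\dots,\dot\Delta^n$ on $\lambda$ and on the choice of the sets $(\dot I^k,\dot J^k)$ is omitted from the notation. **The sets $E^k$ and $V^k$.** $E^k$ is the finite set of polynomials, among the determinants of all square sub-matrices of $\Delta^k-w\Delta^0$, which are nonzero and of degree in $w$ at most $\mathrm{rank}(\dot\Delta^0)$.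 Since $\Delta^k-w\Delta^0$ depends polynomially on $\lambda$, the elements of $E^k$ are seen as bivariate polynomials $P(\lambda,w)$. Writing $P(\lambda,w)=\sum_{\ell\ge0}P_\ell(w)\lambda^\ell$, let $\varphi(P):=P_s$, where $s$ is the smallest index with $P_s\not\equiv0$. With $g^-$ and $g^+$ the minimum and maximum of $g(\ell,i,j)$ over all states $\ell$ and $(i,j)\in I^\ell\times J^\ell$, $V^k$ is the set of all roots of $\varphi(P)$ lying in $[g^-,g^+]$, as $P$ ranges over $E^k$. *)

theory Defs
  imports
    "HOL-Probability.Probability"
    "HOL-Combinatorics.Permutations"
    "Jordan_Normal_Form.Determinant"
    "Jordan_Normal_Form.DL_Rank"
    "Jordan_Normal_Form.DL_Submatrix"
begin

no_notation vec_nth (infixl "$" 90)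
no_notation inner (infixl "\<bullet>" 70)
hide_const (open) Determinants.det Cartesian_Space.rank

section \<open>Matrix games\<close>

text \<open>The actions of a matrix game are the row and column indices, counted from 0.\<close>

definition mixed_strategies :: "nat \<Rightarrow> real vec set" where
  "mixed_strategies m = {x \<in> carrier_vec m. (\<forall>i<m. 0 \<le> x $ i) \<and> (\<Sum>i<m. x $ i) = 1}"

definition game_payoff :: "real mat \<Rightarrow> real vec \<Rightarrow> real vec \<Rightarrow> real" where
  "game_payoff A x y = x \<bullet> (A *\<^sub>v y)"

definition game_val :: "real mat \<Rightarrow> real" where
  "game_val A = (SUP x\<in>mixed_strategies (dim_row A).
                   INF y\<in>mixed_strategies (dim_col A). game_payoff A x y)"

definition optimal_row :: "real mat \<Rightarrow> real vec set" where
  "optimal_row A = {x \<in> mixed_strategies (dim_row A).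
     \<forall>y\<in>mixed_strategies (dim_col A). game_val A \<le> game_payoff A x y}"

definition optimal_col :: "real mat \<Rightarrow> real vec set" where
  "optimal_col A = {y \<in> mixed_strategies (dim_col A).
     \<forall>x\<in>mixed_strategies (dim_row A). game_payoff A x y \<le> game_val A}"

text \<open>Extreme points of the set of pairs of optimal strategies. The type \<^typ>\<open>real vec\<close> is not
  an instance of \<^class>\<open>real_vector\<close>, so the library's extreme points are not applicable.\<close>

definition basic_solution :: "real mat \<Rightarrow> real vec \<Rightarrow> real vec \<Rightarrow> bool" where
  "basic_solution A x y \<longleftrightarrow>
     (x, y) \<in> optimal_row A \<times> optimal_col A \<and>
     \<not> (\<exists>(x1, y1) \<in> optimal_row A \<times> optimal_col A.
        \<exists>(x2, y2) \<in> optimal_row A \<times> optimal_col A.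
        \<exists>t. 0 < t \<and> t < 1 \<and> (x1, y1) \<noteq> (x2, y2) \<and>
            x = (1 - t) \<cdot>\<^sub>v x1 + t \<cdot>\<^sub>v x2 \<and> y = (1 - t) \<cdot>\<^sub>v y1 + t \<cdot>\<^sub>v y2)"

definition cofactor_mat :: "real mat \<Rightarrow> real mat" where
  "cofactor_mat A = mat (dim_row A) (dim_col A) (\<lambda>(i, j). cofactor A i j)"

definition entry_sum :: "real mat \<Rightarrow> real" where
  "entry_sum A = (\<Sum>i<dim_row A. \<Sum>j<dim_col A. A $$ (i, j))"

definition ones_vec :: "nat \<Rightarrow> real vec" where
  "ones_vec m = vec m (\<lambda>_. 1)"

definition restrict_vec :: "real vec \<Rightarrow> nat set \<Rightarrow> real vec" where
  "restrict_vec x R = vec (card R) (\<lambda>i. x $ pick R i)"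

definition shapley_snow_kernel :: "real mat \<Rightarrow> nat set \<Rightarrow> nat set \<Rightarrow> bool" where
  "shapley_snow_kernel G R C \<longleftrightarrow>
     R \<noteq> {} \<and> R \<subseteq> {..<dim_row G} \<and> C \<subseteq> {..<dim_col G} \<and> card R = card C \<and>
     (\<exists>x y. basic_solution G x y \<and>
       (let G' = submatrix G R C; x' = restrict_vec x R; y' = restrict_vec y C;
            co = cofactor_mat G'; S = entry_sum co; e = ones_vec (card R)
        in S \<noteq> 0 \<and>
           x' = (1 / S) \<cdot>\<^sub>v (co *\<^sub>v e) \<and>
           y' = (1 / S) \<cdot>\<^sub>v (transpose_mat co *\<^sub>v e) \<and>
           game_val G = game_val G' \<and> game_val G' = det G' / S \<and>
           transpose_mat G' *\<^sub>v x' = game_val G \<cdot>\<^sub>v e \<and>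
           G' *\<^sub>v y' = game_val G \<cdot>\<^sub>v e))"

section \<open>Stochastic games\<close>

text \<open>The states are \<open>{1..n_states \<Gamma>}\<close>; the action sets in state \<open>k\<close> are \<open>{..<acts1 \<Gamma> k}\<close> and
  \<open>{..<acts2 \<Gamma> k}\<close>. Payoffs and transitions outside these ranges are irrelevant.\<close>

record stoch_game =
  n_states :: nat
  acts1 :: "nat \<Rightarrow> nat"
  acts2 :: "nat \<Rightarrow> nat"
  payoff :: "nat \<Rightarrow> nat \<Rightarrow> nat \<Rightarrow> real"
  trans :: "nat \<Rightarrow> nat \<Rightarrow> nat \<Rightarrow> nat pmf"

definition stochastic_game :: "stoch_game \<Rightarrow> bool" where
  "stochastic_game \<Gamma> \<longleftrightarrow> 1 \<le> n_states \<Gamma> \<and>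
     (\<forall>k\<in>{1..n_states \<Gamma>}. 0 < acts1 \<Gamma> k \<and> 0 < acts2 \<Gamma> k \<and>
        (\<forall>i<acts1 \<Gamma> k. \<forall>j<acts2 \<Gamma> k. set_pmf (trans \<Gamma> k i j) \<subseteq> {1..n_states \<Gamma>}))"

definition rational_data :: "stoch_game \<Rightarrow> bool" where
  "rational_data \<Gamma> \<longleftrightarrow>
     (\<forall>k\<in>{1..n_states \<Gamma>}. \<forall>i<acts1 \<Gamma> k. \<forall>j<acts2 \<Gamma> k.
        payoff \<Gamma> k i j \<in> \<rat> \<and> (\<forall>l\<in>{1..n_states \<Gamma>}. pmf (trans \<Gamma> k i j) l \<in> \<rat>))"

definition stage_payoffs :: "stoch_game \<Rightarrow> real set" where
  "stage_payoffs \<Gamma> =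
     {payoff \<Gamma> l i j | l i j. l \<in> {1..n_states \<Gamma>} \<and> i < acts1 \<Gamma> l \<and> j < acts2 \<Gamma> l}"

text \<open>A stage is a triple (current state, action of Player 1, action of Player 2). A behaviour
  strategy maps the list of all past stages and the current state to a mixed action.\<close>

type_synonym stage = "nat \<times> nat \<times> nat"
type_synonym strategy = "stage list \<Rightarrow> nat \<Rightarrow> nat pmf"

definition strategies :: "nat \<Rightarrow> (nat \<Rightarrow> nat) \<Rightarrow> strategy set" where
  "strategies n acts = {s. \<forall>h. \<forall>k\<in>{1..n}. set_pmf (s h k) \<subseteq> {..<acts k}}"

definition next_state :: "stoch_game \<Rightarrow> nat \<Rightarrow> stage list \<Rightarrow> nat pmf" where
  "next_state \<Gamma> k0 h =
     (if h = [] then return_pmf k0 else (case last h of (k, i, j) \<Rightarrow> trans \<Gamma> k i j))"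

definition stage_law ::
    "stoch_game \<Rightarrow> nat \<Rightarrow> strategy \<Rightarrow> strategy \<Rightarrow> stage list \<Rightarrow> stage pmf" where
  "stage_law \<Gamma> k0 \<sigma> \<tau> h =
     bind_pmf (next_state \<Gamma> k0 h) (\<lambda>k. map_pmf (Pair k) (pair_pmf (\<sigma> h k) (\<tau> h k)))"

text \<open>The law of the infinite play, with stages counted from 0, by the Ionescu-Tulcea extension
  theorem.\<close>

definition play_kernel ::
    "stoch_game \<Rightarrow> nat \<Rightarrow> strategy \<Rightarrow> strategy \<Rightarrow> nat \<Rightarrow> (nat \<Rightarrow> stage) \<Rightarrow> stage measure" where
  "play_kernel \<Gamma> k0 \<sigma> \<tau> m \<omega> = measure_pmf (stage_law \<Gamma> k0 \<sigma> \<tau> (map \<omega> [0..<m]))"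

abbreviation stage_space :: "nat \<Rightarrow> stage measure" where
  "stage_space \<equiv> \<lambda>_. count_space UNIV"

lemma measurable_history:
  "l \<le> m \<Longrightarrow> (\<lambda>\<omega>. map \<omega> [0..<l]) \<in> PiM {0..<m} stage_space \<rightarrow>\<^sub>M (count_space UNIV :: stage list measure)"
proof (induction l)
  case (Suc l)
  have 1: "(\<lambda>\<omega>. map \<omega> [0..<l]) \<in> PiM {0..<m} stage_space \<rightarrow>\<^sub>M (count_space UNIV :: stage list measure)"
    using Suc by simp
  have 2: "(\<lambda>\<omega>. \<omega> l) \<in> PiM {0..<m} stage_space \<rightarrow>\<^sub>M (count_space UNIV :: stage measure)"
    using Suc.prems by (intro measurable_component_singleton) auto
  have "(\<lambda>\<omega>. (\<lambda>h \<omega>. h @ [\<omega> l]) (map \<omega> [0..<l]) \<omega>) \<in> PiM {0..<m} stage_space \<rightarrow>\<^sub>M (count_space UNIV :: stage list measure)"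
    by (rule measurable_compose_countable[OF _ 1]) (rule measurable_compose[OF 2], simp)
  then show ?case by simp
qed simp

lemma Ionescu_Tulcea_play_kernel: "Ionescu_Tulcea (play_kernel \<Gamma> k0 \<sigma> \<tau>) stage_space"
proof (rule Ionescu_Tulcea.intro)
  fix m
  have "(\<lambda>h. measure_pmf (stage_law \<Gamma> k0 \<sigma> \<tau> h)) \<in>
      (count_space UNIV :: stage list measure) \<rightarrow>\<^sub>M subprob_algebra (count_space UNIV)"
    by (simp add: measure_pmf_in_subprob_algebra)
  from measurable_compose[OF measurable_history[OF order_refl] this]
  show "play_kernel \<Gamma> k0 \<sigma> \<tau> m \<in> PiM {0..<m} stage_space \<rightarrow>\<^sub>M subprob_algebra (stage_space m)"
    unfolding play_kernel_def[abs_def] .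
qed (simp add: play_kernel_def prob_space_measure_pmf)

definition play_measure ::
    "stoch_game \<Rightarrow> nat \<Rightarrow> strategy \<Rightarrow> strategy \<Rightarrow> (nat \<Rightarrow> stage) measure" where
  "play_measure \<Gamma> k0 \<sigma> \<tau> =
     projective_family.lim UNIV (Ionescu_Tulcea.CI (play_kernel \<Gamma> k0 \<sigma> \<tau>) stage_space) stage_space"

definition discounted_payoff ::
    "stoch_game \<Rightarrow> real \<Rightarrow> nat \<Rightarrow> strategy \<Rightarrow> strategy \<Rightarrow> real" where
  "discounted_payoff \<Gamma> lam k0 \<sigma> \<tau> =
     (\<integral>\<omega>. (\<Sum>m. lam * (1 - lam) ^ m * (case \<omega> m of (k, i, j) \<Rightarrow> payoff \<Gamma> k i j))
        \<partial>play_measure \<Gamma> k0 \<sigma> \<tau>)"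

definition discounted_value :: "stoch_game \<Rightarrow> real \<Rightarrow> nat \<Rightarrow> real" where
  "discounted_value \<Gamma> lam k =
     (SUP \<sigma>\<in>strategies (n_states \<Gamma>) (acts1 \<Gamma>).
        INF \<tau>\<in>strategies (n_states \<Gamma>) (acts2 \<Gamma>). discounted_payoff \<Gamma> lam k \<sigma> \<tau>)"

definition local_game :: "stoch_game \<Rightarrow> real \<Rightarrow> (nat \<Rightarrow> real) \<Rightarrow> nat \<Rightarrow> real mat" where
  "local_game \<Gamma> lam z k = mat (acts1 \<Gamma> k) (acts2 \<Gamma> k)
     (\<lambda>(i, j). lam * payoff \<Gamma> k i j
        + (1 - lam) * (\<Sum>l = 1..n_states \<Gamma>. pmf (trans \<Gamma> k i j) l * z l))"

section \<open>Arrays of matrices\<close>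

text \<open>An array is a function of the row index \<open>k\<close> and the column index \<open>l\<close>. The data array is
  written over any ring containing the reals by \<open>c\<close> and an element \<open>t\<close> standing for the discount
  rate (\<open>lam\<close> throughout), so that the same formula gives the array at a real number and as a matrix of polynomials.\<close>

definition data_array ::
    "stoch_game \<Rightarrow> (real \<Rightarrow> 'a::comm_ring_1) \<Rightarrow> 'a \<Rightarrow> nat \<Rightarrow> nat \<Rightarrow> 'a mat" where
  "data_array \<Gamma> c t k l = mat (acts1 \<Gamma> k) (acts2 \<Gamma> k)
     (\<lambda>(i, j). if l = 0 then t * c (payoff \<Gamma> k i j)
               else if l = k then (1 - t) * c (pmf (trans \<Gamma> k i j) k) - 1
               else (1 - t) * c (pmf (trans \<Gamma> k i j) l))"

definition kronecker :: "'a::comm_ring_1 mat \<Rightarrow> 'a mat \<Rightarrow> 'a mat" where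
  "kronecker A B = mat (dim_row A * dim_row B) (dim_col A * dim_col B)
     (\<lambda>(i, j). A $$ (i div dim_row B, j div dim_col B) * B $$ (i mod dim_row B, j mod dim_col B))"

definition kronecker_list :: "'a::comm_ring_1 mat list \<Rightarrow> 'a mat" where
  "kronecker_list As = foldr kronecker As (1\<^sub>m 1)"

definition kronecker_det :: "nat \<Rightarrow> (nat \<Rightarrow> nat \<Rightarrow> 'a::comm_ring_1 mat) \<Rightarrow> 'a mat" where
  "kronecker_det n A = mat (\<Prod>k = 1..n. dim_row (A k 1)) (\<Prod>k = 1..n. dim_col (A k 1))
     (\<lambda>ij. \<Sum>p | p permutes {1..n}.
        of_int (sign p) * kronecker_list (map (\<lambda>k. A k (p k)) [1..<Suc n]) $$ ij)"

text \<open>The columns \<open>0..n\<close> other than \<open>l\<close>, renumbered \<open>1..n\<close> in order.\<close>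

definition delete_column :: "nat \<Rightarrow> (nat \<Rightarrow> nat \<Rightarrow> 'a mat) \<Rightarrow> nat \<Rightarrow> nat \<Rightarrow> 'a mat" where
  "delete_column l A k j = A k (if j \<le> l then j - 1 else j)"

definition aux_mat :: "nat \<Rightarrow> (nat \<Rightarrow> nat \<Rightarrow> 'a::comm_ring_1 mat) \<Rightarrow> nat \<Rightarrow> 'a mat" where
  "aux_mat n A l = ((- 1) ^ l) \<cdot>\<^sub>m kronecker_det n (delete_column l A)"

definition reduced_array ::
    "(nat \<Rightarrow> nat \<Rightarrow> 'a mat) \<Rightarrow> (nat \<Rightarrow> nat set) \<Rightarrow> (nat \<Rightarrow> nat set) \<Rightarrow> nat \<Rightarrow> nat \<Rightarrow> 'a mat" where
  "reduced_array A R C k l = submatrix (A k l) (R k) (C k)"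

definition mat_rank :: "real mat \<Rightarrow> nat" where
  "mat_rank A = vec_space.rank (dim_row A) A"

definition reduced_rank ::
    "stoch_game \<Rightarrow> real \<Rightarrow> (nat \<Rightarrow> nat set) \<Rightarrow> (nat \<Rightarrow> nat set) \<Rightarrow> nat" where
  "reduced_rank \<Gamma> lam R C =
     mat_rank (aux_mat (n_states \<Gamma>) (reduced_array (data_array \<Gamma> id lam) R C) 0)"

section \<open>The sets E and V\<close>

text \<open>A polynomial in \<open>lam\<close> and \<open>w\<close> is a polynomial in \<open>lam\<close> whose coefficients are polynomials
  in \<open>w\<close>: \<open>lam\<close> is \<open>[:0, 1:]\<close> and \<open>w\<close> is \<open>[:[:0, 1:]:]\<close>.\<close>

definition aux_poly :: "stoch_game \<Rightarrow> nat \<Rightarrow> real poly poly mat" where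
  "aux_poly \<Gamma> l = aux_mat (n_states \<Gamma>) (data_array \<Gamma> (\<lambda>a. [:[:a:]:]) [:0, 1:]) l"

definition minors :: "'a::comm_ring_1 mat \<Rightarrow> 'a set" where
  "minors A = {det (submatrix A R C) | R C. R \<noteq> {} \<and> R \<subseteq> {..<dim_row A} \<and>
                 C \<subseteq> {..<dim_col A} \<and> card R = card C}"

text \<open>The bound \<open>r\<close> on the degree in \<open>w\<close> is to be the rank of the reduced matrix at index 0
  (\<open>reduced_rank\<close>), which depends on the discount rate and on the chosen kernels.\<close>

definition E_set :: "stoch_game \<Rightarrow> nat \<Rightarrow> nat \<Rightarrow> real poly poly set" where
  "E_set \<Gamma> r k =
     {P \<in> minors (aux_poly \<Gamma> k - [:[:0, 1:]:] \<cdot>\<^sub>m aux_poly \<Gamma> 0).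
        P \<noteq> 0 \<and> (\<forall>s. degree (coeff P s) \<le> r)}"

definition lowest_coeff :: "real poly poly \<Rightarrow> real poly" where
  "lowest_coeff P = coeff P (LEAST s. coeff P s \<noteq> 0)"

definition V_set :: "stoch_game \<Rightarrow> nat \<Rightarrow> nat \<Rightarrow> real set" where
  "V_set \<Gamma> r k =
     {w \<in> {Min (stage_payoffs \<Gamma>)..Max (stage_payoffs \<Gamma>)}.
        \<exists>P\<in>E_set \<Gamma> r k. poly (lowest_coeff P) w = 0}"

section \<open>Accumulation points and algebraic degree\<close>

definition accumulation_point :: "('a \<Rightarrow> 'b::topological_space) \<Rightarrow> 'a filter \<Rightarrow> 'b \<Rightarrow> bool" where
  "accumulation_point f F w \<longleftrightarrow> (\<forall>U. open U \<longrightarrow> w \<in> U \<longrightarrow> (\<exists>\<^sub>F x in F. f x \<in> U))"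

definition algebraic_degree :: "real \<Rightarrow> nat" where
  "algebraic_degree x =
     (LEAST d. \<exists>p. p \<noteq> 0 \<and> (\<forall>i. coeff p i \<in> \<rat>) \<and> degree p = d \<and> poly p x = 0)"

end

theory Submission
  imports Defs "Jordan_Normal_Form.DL_Rank_Submatrix"
begin

text \<open>At every small discount rate the value of a state is a root of one of finitely many bivariate
  polynomials, the minors of a matrix pencil built from the data. This determines the possible limits.

  By Shapley's equation the vector \<open>v\<close> of discounted values consists of the values of its own local games
  (\<open>discounted_value_fixed_point\<close>). In the kernels of these games both players have equalizing
  strategies \<open>x\<close> and \<open>y\<close>, so \<open>(1, v)\<close> solves the linear systems that arise from the rows of the reduced data
  array by playing \<open>x\<close> or \<open>y\<close>. The entries of the auxiliary matrices are the maximal minors of the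
  arrays of numbers selected by the digits of their indices (\<open>aux_mat_index\<close>), and Cramer's rule
  (\<open>signed_minor_kernel\<close>) turns the linear systems into the statement that the Kronecker products of the
  \<open>y\<close> and of the \<open>x\<close> are a right and a left eigenvector of the pencil \<open>\<Delta>\<^sup>k - w \<Delta>\<^sup>0\<close> of reduced matrices
  at the eigenvalue \<open>w = v\<^sup>k\<close>. They are not orthogonal for \<open>\<Delta>\<^sup>0\<close>, because the bilinear form is the
  determinant of a strictly diagonally dominant matrix, that of the Markov chain under \<open>x\<close> and \<open>y\<close>
  (\<open>bilinear_nonzero\<close>).

  For a possibly singular pencil this forces the rank to drop at \<open>v\<^sup>k\<close>: a nonzero minor of maximal size
  vanishes there (\<open>pencil_minor_vanishes\<close>). Its degree in \<open>w\<close> is at most the rank of the reduced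
  \<open>\<Delta>\<^sup>0\<close> (\<open>degree_pencil_minor\<close>), and it is up to sign the value at the discount rate of a bivariate minor of
  the full matrices (\<open>minor_with_root\<close>), which for small discount rates belongs to the set \<open>E\<close> since its
  leading coefficients in \<open>w\<close> do not vanish there.

  There are finitely many minors. If \<open>\<phi>(P)\<close> does not vanish at a cluster point of the values, then
  \<open>P\<close> does not vanish nearby (\<open>eventually_nonzero_near_nonroot\<close>); so every cluster point is a root of one
  of finitely many polynomials. The values are continuous in the discount rate, hence have a single cluster
  point (\<open>tendsto_of_finite_cluster_points\<close>). Rational data give the polynomials rational coefficients.\<close>


section \<open>Values of matrix games\<close>

lemma game_payoff_sum:
  assumes "x \<in> mixed_strategies (dim_row A)" "y \<in> mixed_strategies (dim_col A)"
  shows "game_payoff A x y = (\<Sum>i<dim_row A. \<Sum>j<dim_col A. x $ i * y $ j * A $$ (i, j))"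
  using assms
  by (auto simp: game_payoff_def mixed_strategies_def scalar_prod_def lessThan_atLeast0
      sum_distrib_left mult_ac intro!: sum.cong)

lemma mixed_product_sum:
  assumes "x \<in> mixed_strategies m" "y \<in> mixed_strategies n"
  shows "(\<Sum>i<m. \<Sum>j<n. x $ i * y $ j * c) = c"
proof -
  have "(\<Sum>i<m. \<Sum>j<n. x $ i * y $ j * c) = (\<Sum>i<m. x $ i) * (\<Sum>j<n. y $ j) * c"
    by (simp add: sum_product sum_distrib_right[symmetric])
  then show ?thesis using assms by (simp add: mixed_strategies_def)
qed

lemma game_payoff_le_add:
  assumes x: "x \<in> mixed_strategies (dim_row A)" and y: "y \<in> mixed_strategies (dim_col A)"
    and dims: "dim_row B = dim_row A" "dim_col B = dim_col A"
    and le: "\<And>i j. i < dim_row A \<Longrightarrow> j < dim_col A \<Longrightarrow> A $$ (i, j) \<le> B $$ (i, j) + c"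
  shows "game_payoff A x y \<le> game_payoff B x y + c"
proof -
  have "game_payoff A x y = (\<Sum>i<dim_row A. \<Sum>j<dim_col A. x $ i * y $ j * A $$ (i, j))"
    by (rule game_payoff_sum[OF x y])
  also have "\<dots> \<le> (\<Sum>i<dim_row A. \<Sum>j<dim_col A. x $ i * y $ j * (B $$ (i, j) + c))"
    using x y by (intro sum_mono mult_left_mono le) (auto simp: mixed_strategies_def)
  also have "\<dots> = (\<Sum>i<dim_row A. \<Sum>j<dim_col A. x $ i * y $ j * B $$ (i, j))
      + (\<Sum>i<dim_row A. \<Sum>j<dim_col A. x $ i * y $ j * c)"
    by (simp add: algebra_simps sum.distrib)
  also have "\<dots> = game_payoff B x y + c"
    using x y dims by (simp add: mixed_product_sum game_payoff_sum)
  finally show ?thesis .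
qed

lemma mixed_strategies_nonempty: "0 < m \<Longrightarrow> mixed_strategies m \<noteq> {}"
proof -
  assume m: "0 < m"
  then have "unit_vec m 0 \<in> mixed_strategies m"
    by (auto simp: mixed_strategies_def unit_vec_def if_distrib cong: if_cong)
  then show ?thesis by blast
qed

lemma game_payoff_bounded:
  obtains c where "\<And>x y. x \<in> mixed_strategies (dim_row A) \<Longrightarrow> y \<in> mixed_strategies (dim_col A) \<Longrightarrow>
    \<bar>game_payoff A x y\<bar> \<le> c"
proof -
  define c where "c = (\<Sum>i<dim_row A. \<Sum>j<dim_col A. \<bar>A $$ (i, j)\<bar>)"
  have c: "\<bar>A $$ (i, j)\<bar> \<le> c" if "i < dim_row A" "j < dim_col A" for i j
  proof -
    have "\<bar>A $$ (i, j)\<bar> \<le> (\<Sum>j<dim_col A. \<bar>A $$ (i, j)\<bar>)"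
      using that by (intro member_le_sum) auto
    also have "\<dots> \<le> c" unfolding c_def
      using that by (intro member_le_sum[where f = "\<lambda>i. \<Sum>j<dim_col A. \<bar>A $$ (i, j)\<bar>"]) (auto intro: sum_nonneg)
    finally show ?thesis .
  qed
  define Z :: "real mat" where "Z = 0\<^sub>m (dim_row A) (dim_col A)"
  have "\<bar>game_payoff A x y\<bar> \<le> c"
    if xy: "x \<in> mixed_strategies (dim_row A)" "y \<in> mixed_strategies (dim_col A)" for x y
  proof -
    have 0: "game_payoff Z x y = 0"
      using xy by (subst game_payoff_sum) (auto simp: Z_def)
    have "game_payoff A x y \<le> game_payoff Z x y + c"
      using c by (intro game_payoff_le_add xy) (fastforce simp: Z_def abs_le_iff)+
    moreover have "game_payoff Z x y \<le> game_payoff A x y + c"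
      using c xy by (intro game_payoff_le_add) (fastforce simp: Z_def abs_le_iff)+
    ultimately show ?thesis using 0 by auto
  qed
  then show ?thesis using that by blast
qed

lemma game_payoff_bdd_below:
  "x \<in> mixed_strategies (dim_row A) \<Longrightarrow> bdd_below (game_payoff A x ` mixed_strategies (dim_col A))"
proof -
  assume x: "x \<in> mixed_strategies (dim_row A)"
  obtain c where c: "\<And>x y. x \<in> mixed_strategies (dim_row A) \<Longrightarrow> y \<in> mixed_strategies (dim_col A) \<Longrightarrow>
    \<bar>game_payoff A x y\<bar> \<le> c" using game_payoff_bounded by blast
  show ?thesis using c[OF x] by (intro bdd_belowI2[of _ "- c"]) (fastforce simp: abs_le_iff)
qed

lemma game_guarantee_bdd_above:
  assumes "0 < dim_col A"
  shows "bdd_above ((\<lambda>x. INF y\<in>mixed_strategies (dim_col A). game_payoff A x y) ` mixed_strategies (dim_row A))"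
proof -
  obtain c where c: "\<And>x y. x \<in> mixed_strategies (dim_row A) \<Longrightarrow> y \<in> mixed_strategies (dim_col A) \<Longrightarrow>
    \<bar>game_payoff A x y\<bar> \<le> c" using game_payoff_bounded by blast
  obtain y where y: "y \<in> mixed_strategies (dim_col A)" using mixed_strategies_nonempty[OF assms] by blast
  show ?thesis
  proof (rule bdd_aboveI2[of _ _ c])
    fix x assume x: "x \<in> mixed_strategies (dim_row A)"
    have "(INF y\<in>mixed_strategies (dim_col A). game_payoff A x y) \<le> game_payoff A x y"
      by (rule cINF_lower[OF game_payoff_bdd_below[OF x] y])
    also have "\<dots> \<le> c" using c[OF x y] by simp
    finally show "(INF y\<in>mixed_strategies (dim_col A). game_payoff A x y) \<le> c" .
  qed
qed

lemma game_val_near_optimal_row: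
  assumes pos: "0 < dim_row A" "0 < dim_col A" and e: "0 < e"
  obtains x where "x \<in> mixed_strategies (dim_row A)"
    "\<And>y. y \<in> mixed_strategies (dim_col A) \<Longrightarrow> game_val A - e \<le> game_payoff A x y"
proof -
  have "\<exists>x\<in>mixed_strategies (dim_row A). game_val A - e < (INF y\<in>mixed_strategies (dim_col A). game_payoff A x y)"
    using less_cSUP_iff[OF mixed_strategies_nonempty[OF pos(1)] game_guarantee_bdd_above[OF pos(2)], of "game_val A - e"] e
    by (simp add: game_val_def)
  then obtain x where x: "x \<in> mixed_strategies (dim_row A)"
    "game_val A - e < (INF y\<in>mixed_strategies (dim_col A). game_payoff A x y)" by blast
  show ?thesis
  proof (rule that[OF x(1)])
    fix y assume "y \<in> mixed_strategies (dim_col A)"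
    then show "game_val A - e \<le> game_payoff A x y"
      using cINF_lower[OF game_payoff_bdd_below[OF x(1)]] x(2) by force
  qed
qed

lemma game_val_near_best_reply:
  assumes pos: "0 < dim_row A" "0 < dim_col A" and e: "0 < e"
    and x: "x \<in> mixed_strategies (dim_row A)"
  obtains y where "y \<in> mixed_strategies (dim_col A)" "game_payoff A x y \<le> game_val A + e"
proof -
  have "(INF y\<in>mixed_strategies (dim_col A). game_payoff A x y) \<le> game_val A"
    unfolding game_val_def by (rule cSUP_upper[OF x game_guarantee_bdd_above[OF pos(2)]])
  then have "(INF y\<in>mixed_strategies (dim_col A). game_payoff A x y) < game_val A + e" using e by simp
  then show ?thesis
    using cINF_less_iff[OF mixed_strategies_nonempty[OF pos(2)] game_payoff_bdd_below[OF x], of "game_val A + e"] that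
    by force
qed

text \<open>A near-optimal row strategy of \<open>A\<close> secures almost \<open>game_val A - c\<close> in \<open>B\<close>. In particular the
  value is nonexpansive for the maximum norm of the entries.\<close>

lemma game_val_le_add:
  assumes pos: "0 < dim_row A" "0 < dim_col A"
    and dims: "dim_row B = dim_row A" "dim_col B = dim_col A"
    and le: "\<And>i j. i < dim_row A \<Longrightarrow> j < dim_col A \<Longrightarrow> A $$ (i, j) \<le> B $$ (i, j) + c"
  shows "game_val A \<le> game_val B + c"
proof (rule field_le_epsilon)
  fix e :: real assume e: "0 < e"
  obtain x where x: "x \<in> mixed_strategies (dim_row A)"
    "\<And>y. y \<in> mixed_strategies (dim_col A) \<Longrightarrow> game_val A - e / 2 \<le> game_payoff A x y"
    using game_val_near_optimal_row[OF pos, of "e / 2"] e by auto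
  obtain y where y: "y \<in> mixed_strategies (dim_col A)" "game_payoff B x y \<le> game_val B + e / 2"
    using game_val_near_best_reply[of B "e / 2" x] e pos dims x by auto
  have "game_val A - e / 2 \<le> game_payoff A x y" using x y by blast
  also have "\<dots> \<le> game_payoff B x y + c"
    by (rule game_payoff_le_add[OF x(1) y(1) dims le])
  finally show "game_val A \<le> game_val B + c + e" using y(2) by simp
qed

lemma game_val_le_const:
  assumes pos: "0 < dim_row A" "0 < dim_col A"
    and le: "\<And>i j. i < dim_row A \<Longrightarrow> j < dim_col A \<Longrightarrow> A $$ (i, j) \<le> c"
  shows "game_val A \<le> c"
proof (rule field_le_epsilon)
  fix e :: real assume e: "0 < e"
  obtain x where x: "x \<in> mixed_strategies (dim_row A)"
    "\<And>y. y \<in> mixed_strategies (dim_col A) \<Longrightarrow> game_val A - e \<le> game_payoff A x y"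
    using game_val_near_optimal_row[OF pos, of e] e by auto
  obtain y where y: "y \<in> mixed_strategies (dim_col A)"
    using mixed_strategies_nonempty[OF pos(2)] by blast
  define Z :: "real mat" where "Z = 0\<^sub>m (dim_row A) (dim_col A)"
  have 0: "game_payoff Z x y = 0"
    using x y by (subst game_payoff_sum) (auto simp: Z_def)
  have "game_payoff A x y \<le> game_payoff Z x y + c"
    using le by (intro game_payoff_le_add x y) (fastforce simp: Z_def)+
  then show "game_val A \<le> c + e" using x(2)[OF y] 0 by simp
qed

lemma game_val_ge_const:
  assumes pos: "0 < dim_row A" "0 < dim_col A"
    and ge: "\<And>i j. i < dim_row A \<Longrightarrow> j < dim_col A \<Longrightarrow> c \<le> A $$ (i, j)"
  shows "c \<le> game_val A"
proof (rule field_le_epsilon)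
  fix e :: real assume e: "0 < e"
  obtain x where x: "x \<in> mixed_strategies (dim_row A)"
    using mixed_strategies_nonempty[OF pos(1)] by blast
  obtain y where y: "y \<in> mixed_strategies (dim_col A)" "game_payoff A x y \<le> game_val A + e"
    using game_val_near_best_reply[OF pos e x] by auto
  define Z :: "real mat" where "Z = 0\<^sub>m (dim_row A) (dim_col A)"
  have 0: "game_payoff Z x y = 0"
    using x y by (subst game_payoff_sum) (auto simp: Z_def)
  have "game_payoff Z x y \<le> game_payoff A x y + (- c)"
    using ge x y by (intro game_payoff_le_add) (fastforce simp: Z_def)+
  then show "c \<le> game_val A + e" using y(2) 0 by simp
qed

section \<open>The Shapley operator\<close>

lemma local_game_dim [simp]:
  "dim_row (local_game \<Gamma> lam z k) = acts1 \<Gamma> k" "dim_col (local_game \<Gamma> lam z k) = acts2 \<Gamma> k"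
  by (simp_all add: local_game_def)

lemma local_game_index:
  "i < acts1 \<Gamma> k \<Longrightarrow> j < acts2 \<Gamma> k \<Longrightarrow> local_game \<Gamma> lam z k $$ (i, j) =
    lam * payoff \<Gamma> k i j + (1 - lam) * (\<Sum>l = 1..n_states \<Gamma>. pmf (trans \<Gamma> k i j) l * z l)"
  by (simp add: local_game_def)

lemma transition_sum:
  assumes "stochastic_game \<Gamma>" "k \<in> {1..n_states \<Gamma>}" "i < acts1 \<Gamma> k" "j < acts2 \<Gamma> k"
  shows "(\<Sum>l = 1..n_states \<Gamma>. pmf (trans \<Gamma> k i j) l) = 1"
  using assms by (intro sum_pmf_eq_1) (auto simp: stochastic_game_def)

lemma transition_mean_le:
  assumes g: "stochastic_game \<Gamma>" "k \<in> {1..n_states \<Gamma>}" "i < acts1 \<Gamma> k" "j < acts2 \<Gamma> k"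
    and le: "\<And>l. l \<in> {1..n_states \<Gamma>} \<Longrightarrow> z l \<le> z' l + c"
  shows "(\<Sum>l = 1..n_states \<Gamma>. pmf (trans \<Gamma> k i j) l * z l) \<le>
    (\<Sum>l = 1..n_states \<Gamma>. pmf (trans \<Gamma> k i j) l * z' l) + c"
proof -
  have "(\<Sum>l = 1..n_states \<Gamma>. pmf (trans \<Gamma> k i j) l * z l) \<le>
    (\<Sum>l = 1..n_states \<Gamma>. pmf (trans \<Gamma> k i j) l * (z' l + c))"
    by (intro sum_mono mult_left_mono le) auto
  also have "\<dots> = (\<Sum>l = 1..n_states \<Gamma>. pmf (trans \<Gamma> k i j) l * z' l) + c"
    using transition_sum[OF g] by (simp add: distrib_left sum.distrib flip: sum_distrib_right)
  finally show ?thesis .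
qed

text \<open>The next-stage values enter the local games with total weight \<open>1 - lam\<close>, so this operator is a
  contraction.\<close>

lemma local_val_contraction:
  assumes g: "stochastic_game \<Gamma>" and k: "k \<in> {1..n_states \<Gamma>}" and lam: "lam \<in> {0<..1}"
    and le: "\<And>l. l \<in> {1..n_states \<Gamma>} \<Longrightarrow> \<bar>z l - z' l\<bar> \<le> c"
  shows "\<bar>game_val (local_game \<Gamma> lam z k) - game_val (local_game \<Gamma> lam z' k)\<bar> \<le> (1 - lam) * c"
proof -
  have pos: "0 < acts1 \<Gamma> k" "0 < acts2 \<Gamma> k" using g k by (auto simp: stochastic_game_def)
  have *: "game_val (local_game \<Gamma> lam z k) \<le> game_val (local_game \<Gamma> lam z' k) + (1 - lam) * c"
    if le: "\<And>l. l \<in> {1..n_states \<Gamma>} \<Longrightarrow> z l \<le> z' l + c" for z z'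
  proof (rule game_val_le_add)
    fix i j assume ij: "i < dim_row (local_game \<Gamma> lam z k)" "j < dim_col (local_game \<Gamma> lam z k)"
    then have "(\<Sum>l = 1..n_states \<Gamma>. pmf (trans \<Gamma> k i j) l * z l) \<le>
        (\<Sum>l = 1..n_states \<Gamma>. pmf (trans \<Gamma> k i j) l * z' l) + c"
      by (intro transition_mean_le[OF g k] le) auto
    from mult_left_mono[OF this, of "1 - lam"] ij lam
    show "local_game \<Gamma> lam z k $$ (i, j) \<le> local_game \<Gamma> lam z' k $$ (i, j) + (1 - lam) * c"
      by (simp add: local_game_index distrib_left)
  qed (use pos in auto)
  have "z l \<le> z' l + c" "z' l \<le> z l + c" if "l \<in> {1..n_states \<Gamma>}" for l using le[OF that] by auto
  then show ?thesis using *[of z z'] *[of z' z] by fastforce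
qed

text \<open>Banach's iteration from 0, state by state: only the finitely many states enter the local games, and
  there the differences of the iterates decay geometrically.\<close>

lemma shapley_fixed_point_exists:
  assumes g: "stochastic_game \<Gamma>" and lam: "lam \<in> {0<..1}"
  obtains z where "\<And>k. k \<in> {1..n_states \<Gamma>} \<Longrightarrow> game_val (local_game \<Gamma> lam z k) = z k"
proof -
  let ?N = "{1..n_states \<Gamma>}"
  define T :: "(nat \<Rightarrow> real) \<Rightarrow> nat \<Rightarrow> real" where
    "T z k = game_val (local_game \<Gamma> lam z k)" for z k
  define Z where "Z m = (T ^^ m) (\<lambda>_. 0)" for m
  define c where "c = (\<Sum>k\<in>?N. \<bar>T (\<lambda>_. 0) k\<bar>)"
  have Z_Suc: "Z (Suc m) k = T (Z m) k" for m k by (simp add: Z_def)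
  have step: "\<bar>Z (Suc m) k - Z m k\<bar> \<le> (1 - lam) ^ m * c" if "k \<in> ?N" for m k
    using that
  proof (induction m arbitrary: k)
    case 0
    then have "\<bar>T (\<lambda>_. 0) k\<bar> \<le> c" unfolding c_def by (intro member_le_sum) auto
    then show ?case by (simp add: Z_def)
  next
    case (Suc m)
    show ?case
      using local_val_contraction[OF g Suc.prems lam, of "Z (Suc m)" "Z m" "(1 - lam) ^ m * c"] Suc.IH
      unfolding Z_Suc[of "Suc m"] Z_Suc[of m k] T_def by simp
  qed
  have "convergent (\<lambda>m. Z m k)" if k: "k \<in> ?N" for k
  proof -
    have "summable (\<lambda>m. (1 - lam) ^ m * c)"
      using lam by (intro summable_mult2 summable_geometric) auto
    then have "summable (\<lambda>m. Z (Suc m) k - Z m k)"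
      by (rule summable_comparison_test'[where N = 0]) (use step[OF k] in auto)
    then have "convergent (\<lambda>m. \<Sum>i<m. Z (Suc i) k - Z i k)" by (simp add: summable_iff_convergent)
    then have "convergent (\<lambda>m. (\<Sum>i<m. Z (Suc i) k - Z i k) + Z 0 k)"
      by (intro convergent_add convergent_const)
    moreover have "(\<Sum>i<m. Z (Suc i) k - Z i k) + Z 0 k = Z m k" for m
      by (induction m) auto
    ultimately show ?thesis by simp
  qed
  then have "\<exists>z. \<forall>k\<in>?N. (\<lambda>m. Z m k) \<longlonglongrightarrow> z k"
    unfolding convergent_def by (intro bchoice) auto
  then obtain z where z: "\<And>k. k \<in> ?N \<Longrightarrow> (\<lambda>m. Z m k) \<longlonglongrightarrow> z k" by blast
  have "T z k = z k" if k: "k \<in> ?N" for k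
  proof -
    define d where "d m = (1 - lam) * (\<Sum>l\<in>?N. \<bar>Z m l - z l\<bar>)" for m
    have "d \<longlonglongrightarrow> (1 - lam) * (\<Sum>l\<in>?N. \<bar>z l - z l\<bar>)"
      unfolding d_def by (intro tendsto_intros z) auto
    then have d: "d \<longlonglongrightarrow> 0" by simp
    have "\<bar>Z (Suc m) k - T z k\<bar> \<le> d m" for m
      unfolding Z_Suc T_def d_def
      by (intro local_val_contraction[OF g k lam] member_le_sum[where f = "\<lambda>l. \<bar>Z m l - z l\<bar>"]) auto
    then have "(\<lambda>m. Z (Suc m) k - T z k) \<longlonglongrightarrow> 0"
      by (intro Lim_null_comparison[OF _ d]) auto
    then have "(\<lambda>m. Z (Suc m) k) \<longlonglongrightarrow> T z k" by (simp add: LIM_zero_iff)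
    moreover have "(\<lambda>m. Z (Suc m) k) \<longlonglongrightarrow> z k" using z[OF k] by (rule LIMSEQ_Suc)
    ultimately show ?thesis by (rule LIMSEQ_unique)
  qed
  then show ?thesis using that by (auto simp: T_def)
qed

section \<open>The law of the finite histories\<close>

text \<open>The finite-dimensional distributions of the play as discrete laws on lists of stages, with which all
  expectations are computed.\<close>

primrec history_law :: "stoch_game \<Rightarrow> nat \<Rightarrow> strategy \<Rightarrow> strategy \<Rightarrow> nat \<Rightarrow> stage list pmf" where
  "history_law \<Gamma> k0 \<sigma> \<tau> 0 = return_pmf []"
| "history_law \<Gamma> k0 \<sigma> \<tau> (Suc m) =
     bind_pmf (history_law \<Gamma> k0 \<sigma> \<tau> m) (\<lambda>h. map_pmf (\<lambda>s. h @ [s]) (stage_law \<Gamma> k0 \<sigma> \<tau> h))"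

abbreviation (input) hist_map :: "nat \<Rightarrow> (nat \<Rightarrow> stage) \<Rightarrow> stage list" where
  "hist_map m \<equiv> \<lambda>\<omega>. map \<omega> [0..<m]"

lemma hist_map_measurable_UNIV:
  "hist_map m \<in> PiM UNIV stage_space \<rightarrow>\<^sub>M (count_space UNIV :: stage list measure)"
proof -
  have "(\<lambda>\<omega>. hist_map m (restrict \<omega> {0..<m})) \<in> PiM UNIV stage_space \<rightarrow>\<^sub>M (count_space UNIV :: stage list measure)"
    by (rule measurable_compose[OF measurable_restrict_subset measurable_history]) auto
  moreover have "hist_map m (restrict \<omega> {0..<m}) = hist_map m \<omega>" for \<omega> by auto
  ultimately show ?thesis by simp
qed

context
  fixes \<Gamma> :: stoch_game and k0 :: nat and \<sigma> \<tau> :: strategy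
begin

interpretation IT: Ionescu_Tulcea "play_kernel \<Gamma> k0 \<sigma> \<tau>" stage_space
  by (rule Ionescu_Tulcea_play_kernel)

text \<open>A step of the Ionescu-Tulcea construction appends to the history a stage drawn from \<open>stage_law\<close>.\<close>

lemma distr_eP_history:
  assumes w: "\<omega> \<in> space (PiM {0..<m} stage_space)"
  shows "distr (IT.eP m \<omega>) (count_space UNIV) (hist_map (Suc m)) =
    measure_pmf (map_pmf (\<lambda>s. hist_map m \<omega> @ [s]) (stage_law \<Gamma> k0 \<sigma> \<tau> (hist_map m \<omega>)))"
proof -
  let ?h = "hist_map m \<omega>"
  have upd: "fun_upd \<omega> m \<in> measure_pmf (stage_law \<Gamma> k0 \<sigma> \<tau> ?h) \<rightarrow>\<^sub>M PiM {0..<Suc m} stage_space"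
    by (intro measurable_fun_upd[where J = "{0..<m}"]) (use w in auto)
  have "distr (IT.eP m \<omega>) (count_space UNIV) (hist_map (Suc m)) =
      distr (measure_pmf (stage_law \<Gamma> k0 \<sigma> \<tau> ?h)) (count_space UNIV) (hist_map (Suc m) \<circ> fun_upd \<omega> m)"
    unfolding IT.eP_def play_kernel_def
    by (rule distr_distr[OF measurable_history[OF order_refl] upd])
  also have "hist_map (Suc m) \<circ> fun_upd \<omega> m = (\<lambda>s. ?h @ [s])"
    by (auto simp: fun_eq_iff)
  also have "distr (measure_pmf (stage_law \<Gamma> k0 \<sigma> \<tau> ?h)) (count_space UNIV) (\<lambda>s. ?h @ [s]) =
      measure_pmf (map_pmf (\<lambda>s. ?h @ [s]) (stage_law \<Gamma> k0 \<sigma> \<tau> ?h))"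
    by (simp add: map_pmf_rep_eq)
  finally show ?thesis .
qed

lemma distr_C_history:
  "distr (IT.C 0 m (\<lambda>_. undefined)) (count_space UNIV) (hist_map m) = measure_pmf (history_law \<Gamma> k0 \<sigma> \<tau> m)"
proof (induction m)
  case 0
  show ?case
    by (simp add: distr_return return_pmf.rep_eq space_PiM)
next
  case (Suc m)
  let ?u = "\<lambda>_. undefined :: stage"
  have u: "?u \<in> space (PiM {0..<0} stage_space)" by (simp add: space_PiM)
  have sp: "space (IT.C 0 m ?u) = space (PiM {0..<m} stage_space)" using IT.space_C[OF u, of m] by simp
  have se: "sets (IT.C 0 m ?u) = sets (PiM {0..<m} stage_space)" using IT.sets_C[OF u, of m] by simp
  have ne: "space (IT.C 0 m ?u) \<noteq> {}" using IT.prob_space_C[OF u, of m] by (rule prob_space.not_empty)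
  let ?K = "\<lambda>h. measure_pmf (map_pmf (\<lambda>s. h @ [s]) (stage_law \<Gamma> k0 \<sigma> \<tau> h))"
  have eP: "IT.eP m \<in> IT.C 0 m ?u \<rightarrow>\<^sub>M subprob_algebra (PiM {0..<Suc m} stage_space)"
    using IT.measurable_eP[of m] measurable_cong_sets[OF se refl] by blast
  have hm: "hist_map m \<in> IT.C 0 m ?u \<rightarrow>\<^sub>M count_space UNIV"
    using measurable_history[OF order_refl] measurable_cong_sets[OF se refl] by blast
  have "distr (IT.C 0 (Suc m) ?u) (count_space UNIV) (hist_map (Suc m)) =
      IT.C 0 m ?u \<bind> (\<lambda>\<omega>. distr (IT.eP m \<omega>) (count_space UNIV) (hist_map (Suc m)))"
    using distr_bind[OF eP ne measurable_history[OF order_refl]] by simp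
  also have "\<dots> = IT.C 0 m ?u \<bind> (\<lambda>\<omega>. ?K (hist_map m \<omega>))"
    by (intro bind_cong_simp refl) (use distr_eP_history in \<open>auto simp: simp_implies_def sp\<close>)
  also have "\<dots> = distr (IT.C 0 m ?u) (count_space UNIV) (hist_map m) \<bind> ?K"
    by (rule bind_distr[symmetric, OF hm _ ne, where K = "count_space UNIV"])
      (simp add: measure_pmf_in_subprob_algebra)
  also have "\<dots> = measure_pmf (history_law \<Gamma> k0 \<sigma> \<tau> (Suc m))"
    by (simp add: Suc.IH measure_pmf_bind)
  finally show ?case .
qed

lemma distr_play_history:
  "distr (play_measure \<Gamma> k0 \<sigma> \<tau>) (count_space UNIV) (hist_map m) = measure_pmf (history_law \<Gamma> k0 \<sigma> \<tau> m)"
proof -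
  let ?u = "\<lambda>_. undefined :: stage" and ?J = "{0..<m}"
  have up: "IT.up_to ?J = m"
    by (rule antisym) (use IT.up_to_iff_Ico[of ?J m] IT.up_to[of ?J] in auto)
  have u: "?u \<in> space (PiM {0..<0} stage_space)" by (simp add: space_PiM)
  have se: "sets (IT.C 0 m ?u) = sets (PiM ?J stage_space)" using IT.sets_C[OF u, of m] by simp
  have res: "hist_map m \<circ> (\<lambda>x. restrict x ?J) = hist_map m" by (auto simp: fun_eq_iff)
  have 1: "(\<lambda>x. restrict x ?J) \<in> PiM UNIV stage_space \<rightarrow>\<^sub>M PiM ?J stage_space"
    by (rule measurable_restrict_subset) simp
  have 2: "(\<lambda>x. restrict x ?J) \<in> IT.C 0 m ?u \<rightarrow>\<^sub>M PiM ?J stage_space"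
    unfolding measurable_cong_sets[OF se refl] by (rule measurable_restrict_subset) simp
  have "distr (distr (play_measure \<Gamma> k0 \<sigma> \<tau>) (PiM ?J stage_space) (\<lambda>x. restrict x ?J)) (count_space UNIV) (hist_map m)
     = distr (distr (IT.C 0 m ?u) (PiM ?J stage_space) (\<lambda>x. restrict x ?J)) (count_space UNIV) (hist_map m)"
    using IT.distr_lim[of ?J] by (simp add: play_measure_def IT.CI_def up)
  then show ?thesis
    using 1 2 by (simp add: distr_distr measurable_history play_measure_def res distr_C_history
        measurable_cong_sets[OF IT.PF.sets_lim refl])
qed

lemma prob_space_play_measure: "prob_space (play_measure \<Gamma> k0 \<sigma> \<tau>)"
proof -
  have "hist_map 0 \<in> play_measure \<Gamma> k0 \<sigma> \<tau> \<rightarrow>\<^sub>M count_space UNIV" by simp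
  moreover have "prob_space (distr (play_measure \<Gamma> k0 \<sigma> \<tau>) (count_space UNIV) (hist_map 0))"
    unfolding distr_play_history by (rule prob_space_measure_pmf)
  ultimately show ?thesis by (rule prob_space_distrD)
qed

lemma hist_map_measurable_play [measurable]:
  "hist_map m \<in> play_measure \<Gamma> k0 \<sigma> \<tau> \<rightarrow>\<^sub>M count_space UNIV"
  unfolding play_measure_def measurable_cong_sets[OF IT.PF.sets_lim refl]
  by (rule hist_map_measurable_UNIV)

end

lemma integral_bind_pmf_finite:
  fixes f :: "'b \<Rightarrow> real"
  assumes "finite (set_pmf p)" "\<And>x. x \<in> set_pmf p \<Longrightarrow> finite (set_pmf (K x))"
  shows "measure_pmf.expectation (bind_pmf p K) f =
    measure_pmf.expectation p (\<lambda>x. measure_pmf.expectation (K x) f)"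
  using assms
  by (subst pmf_expectation_bind[of "set_pmf p"])
    (simp_all add: integral_measure_pmf[of "set_pmf p"])

lemma expectation_pmf_cong:
  fixes f :: "'b \<Rightarrow> real"
  assumes "\<And>x. x \<in> set_pmf p \<Longrightarrow> f x = g x"
  shows "measure_pmf.expectation p f = measure_pmf.expectation p g"
  by (intro integral_cong_AE) (use assms in \<open>auto simp: AE_measure_pmf_iff\<close>)

lemma expectation_pmf_mono:
  fixes f :: "'b \<Rightarrow> real"
  assumes "finite (set_pmf p)" "\<And>x. x \<in> set_pmf p \<Longrightarrow> f x \<le> g x"
  shows "measure_pmf.expectation p f \<le> measure_pmf.expectation p g"
  by (intro integral_mono_AE integrable_measure_pmf_finite)
    (use assms in \<open>auto simp: AE_measure_pmf_iff\<close>)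

lemma expectation_pmf_abs_le:
  fixes f :: "'b \<Rightarrow> real"
  assumes "finite (set_pmf p)" "\<And>x. x \<in> set_pmf p \<Longrightarrow> \<bar>f x\<bar> \<le> c"
  shows "\<bar>measure_pmf.expectation p f\<bar> \<le> c"
proof -
  have "measure_pmf.expectation p f \<le> measure_pmf.expectation p (\<lambda>_. c)"
    "measure_pmf.expectation p (\<lambda>_. - c) \<le> measure_pmf.expectation p f"
    using assms by (intro expectation_pmf_mono; force simp: abs_le_iff)+
  then show ?thesis by simp
qed

text \<open>Strategies prescribe discrete laws where matrix games take vectors.\<close>

definition mixed_of_pmf :: "nat \<Rightarrow> nat pmf \<Rightarrow> real vec" where
  "mixed_of_pmf m p = vec m (pmf p)"

lemma mixed_of_pmf_in: "set_pmf p \<subseteq> {..<m} \<Longrightarrow> mixed_of_pmf m p \<in> mixed_strategies m"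
  using sum_pmf_eq_1[of "{..<m}" p] by (auto simp: mixed_of_pmf_def mixed_strategies_def)

lemma mixed_of_pmf_surj:
  assumes x: "x \<in> mixed_strategies m"
  obtains p where "set_pmf p \<subseteq> {..<m}" "mixed_of_pmf m p = x"
proof -
  define f where "f i = (if i < m then x $ i else 0)" for i
  have nn: "\<And>i. 0 \<le> f i" using x by (auto simp: f_def mixed_strategies_def)
  have "(\<integral>\<^sup>+ i. ennreal (f i) \<partial>count_space UNIV) = (\<integral>\<^sup>+ i. ennreal (f i) \<partial>count_space {..<m})"
    by (rule nn_integral_count_space_eq) (auto simp: f_def)
  also have "\<dots> = (\<Sum>i<m. ennreal (f i))" by (rule nn_integral_count_space_finite) simp
  also have "\<dots> = ennreal (\<Sum>i<m. f i)" using nn by simp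
  also have "(\<Sum>i<m. f i) = 1" using x by (simp add: f_def mixed_strategies_def)
  finally have 1: "(\<integral>\<^sup>+ i. ennreal (f i) \<partial>count_space UNIV) = 1" by simp
  have pm: "pmf (embed_pmf f) i = f i" for i by (rule pmf_embed_pmf[OF nn 1])
  have "set_pmf (embed_pmf f) \<subseteq> {..<m}"
    by (auto simp: set_pmf_iff pm f_def split: if_splits)
  moreover have "mixed_of_pmf m (embed_pmf f) = x"
    using x by (auto simp: mixed_of_pmf_def pm f_def mixed_strategies_def)
  ultimately show ?thesis using that by blast
qed

section \<open>Shapley's equation\<close>

definition stages :: "stoch_game \<Rightarrow> stage set" where
  "stages \<Gamma> = (SIGMA k:{1..n_states \<Gamma>}. {..<acts1 \<Gamma> k} \<times> {..<acts2 \<Gamma> k})"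

lemma finite_stages: "finite (stages \<Gamma>)"
  by (auto simp: stages_def)

lemma payoff_bound_exists: "\<exists>c\<ge>0. \<forall>k i j. (k, i, j) \<in> stages \<Gamma> \<longrightarrow> \<bar>payoff \<Gamma> k i j\<bar> \<le> c"
proof (intro exI[of _ "\<Sum>(k, i, j)\<in>stages \<Gamma>. \<bar>payoff \<Gamma> k i j\<bar>"] conjI allI impI)
  fix k i j assume "(k, i, j) \<in> stages \<Gamma>"
  then show "\<bar>payoff \<Gamma> k i j\<bar> \<le> (\<Sum>(k, i, j)\<in>stages \<Gamma>. \<bar>payoff \<Gamma> k i j\<bar>)"
    using member_le_sum[of "(k, i, j)" "stages \<Gamma>" "\<lambda>(k, i, j). \<bar>payoff \<Gamma> k i j\<bar>"] finite_stages[of \<Gamma>] by auto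
qed (auto intro: sum_nonneg)

lemma stage_payoffs_image: "stage_payoffs \<Gamma> = (\<lambda>(k, i, j). payoff \<Gamma> k i j) ` stages \<Gamma>"
  by (force simp: stage_payoffs_def stages_def)

lemma finite_stage_payoffs: "finite (stage_payoffs \<Gamma>)"
  by (simp add: stage_payoffs_image finite_stages)

lemma game_payoff_expectation:
  assumes "set_pmf p \<subseteq> {..<dim_row A}" "set_pmf q \<subseteq> {..<dim_col A}"
  shows "measure_pmf.expectation (pair_pmf p q) (\<lambda>(i, j). A $$ (i, j)) =
    game_payoff A (mixed_of_pmf (dim_row A) p) (mixed_of_pmf (dim_col A) q)"
proof -
  have "measure_pmf.expectation (pair_pmf p q) (\<lambda>(i, j). A $$ (i, j)) =
      (\<Sum>ij\<in>{..<dim_row A} \<times> {..<dim_col A}. (case ij of (i, j) \<Rightarrow> A $$ (i, j)) * pmf (pair_pmf p q) ij)"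
    by (rule integral_measure_pmf_real) (use assms in auto)
  also have "\<dots> = (\<Sum>i<dim_row A. \<Sum>j<dim_col A. pmf p i * pmf q j * A $$ (i, j))"
    unfolding sum.cartesian_product by (intro sum.cong) (auto simp: pmf_pair)
  also have "\<dots> = game_payoff A (mixed_of_pmf (dim_row A) p) (mixed_of_pmf (dim_col A) q)"
    by (subst game_payoff_sum[OF mixed_of_pmf_in mixed_of_pmf_in]) (use assms in \<open>auto simp: mixed_of_pmf_def\<close>)
  finally show ?thesis .
qed

locale discounted_play =
  fixes \<Gamma> :: stoch_game and lam :: real and k0 :: nat and \<sigma> \<tau> :: strategy
  assumes game: "stochastic_game \<Gamma>" and lam: "lam \<in> {0<..1}" and k0: "k0 \<in> {1..n_states \<Gamma>}"
    and \<sigma>: "\<sigma> \<in> strategies (n_states \<Gamma>) (acts1 \<Gamma>)" and \<tau>: "\<tau> \<in> strategies (n_states \<Gamma>) (acts2 \<Gamma>)"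
begin

abbreviation "law \<equiv> history_law \<Gamma> k0 \<sigma> \<tau>"
abbreviation "payoff_of \<equiv> (\<lambda>(k, i, j). payoff \<Gamma> k i j)"

lemma next_state_support:
  assumes "set h \<subseteq> stages \<Gamma>"
  shows "set_pmf (next_state \<Gamma> k0 h) \<subseteq> {1..n_states \<Gamma>}"
proof (cases "h = []")
  case True then show ?thesis using k0 by (simp add: next_state_def)
next
  case False
  then have "last h \<in> stages \<Gamma>" using assms by auto
  then obtain k i j where "last h = (k, i, j)" "k \<in> {1..n_states \<Gamma>}" "i < acts1 \<Gamma> k" "j < acts2 \<Gamma> k"
    by (auto simp: stages_def)
  then show ?thesis using False game unfolding next_state_def stochastic_game_def by force
qed

lemma actions_support:
  assumes "k \<in> {1..n_states \<Gamma>}"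
  shows "set_pmf (\<sigma> h k) \<subseteq> {..<acts1 \<Gamma> k}" "set_pmf (\<tau> h k) \<subseteq> {..<acts2 \<Gamma> k}"
  using assms \<sigma> \<tau> by (auto simp: strategies_def)

lemma stage_law_support:
  assumes "set h \<subseteq> stages \<Gamma>"
  shows "set_pmf (stage_law \<Gamma> k0 \<sigma> \<tau> h) \<subseteq> stages \<Gamma>"
proof
  fix s assume "s \<in> set_pmf (stage_law \<Gamma> k0 \<sigma> \<tau> h)"
  then obtain k i j where s: "s = (k, i, j)" "k \<in> set_pmf (next_state \<Gamma> k0 h)"
    "i \<in> set_pmf (\<sigma> h k)" "j \<in> set_pmf (\<tau> h k)"
    by (auto simp: stage_law_def)
  then have k: "k \<in> {1..n_states \<Gamma>}" using next_state_support[OF assms] by blast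
  show "s \<in> stages \<Gamma>" using s k actions_support[OF k, of h] by (auto simp: stages_def)
qed

lemma law_support: "h \<in> set_pmf (law m) \<Longrightarrow> set h \<subseteq> stages \<Gamma> \<and> length h = m"
proof (induction m arbitrary: h)
  case (Suc m)
  then obtain h' s where h: "h' \<in> set_pmf (law m)" "s \<in> set_pmf (stage_law \<Gamma> k0 \<sigma> \<tau> h')" "h = h' @ [s]"
    by auto
  then show ?case using Suc.IH[OF h(1)] stage_law_support[of h'] by auto
qed simp

lemma finite_law: "finite (set_pmf (law m))"
  by (rule finite_subset[OF _ finite_lists_length_eq[OF finite_stages[of \<Gamma>], of m]]) (use law_support[of _ m] in blast)

lemma finite_supports:
  assumes "set h \<subseteq> stages \<Gamma>"
  shows "finite (set_pmf (next_state \<Gamma> k0 h))" "finite (set_pmf (stage_law \<Gamma> k0 \<sigma> \<tau> h))"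
    "k \<in> {1..n_states \<Gamma>} \<Longrightarrow> finite (set_pmf (\<sigma> h k))" "k \<in> {1..n_states \<Gamma>} \<Longrightarrow> finite (set_pmf (\<tau> h k))"
proof -
  show "finite (set_pmf (next_state \<Gamma> k0 h))" "finite (set_pmf (stage_law \<Gamma> k0 \<sigma> \<tau> h))"
    using finite_subset[OF next_state_support[OF assms]] finite_subset[OF stage_law_support[OF assms] finite_stages]
    by auto
  show "finite (set_pmf (\<sigma> h k))" "finite (set_pmf (\<tau> h k))" if "k \<in> {1..n_states \<Gamma>}"
    using actions_support[OF that, of h] finite_subset by blast+
qed

lemma finite_stage_law: "h \<in> set_pmf (law m) \<Longrightarrow> finite (set_pmf (stage_law \<Gamma> k0 \<sigma> \<tau> h))"
  using law_support[of h m] finite_supports(2)[of h] by blast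

definition mean_payoff :: "nat \<Rightarrow> real" where
  "mean_payoff m = measure_pmf.expectation (law m) (\<lambda>h. measure_pmf.expectation (stage_law \<Gamma> k0 \<sigma> \<tau> h) payoff_of)"

definition mean_state :: "(nat \<Rightarrow> real) \<Rightarrow> nat \<Rightarrow> real" where
  "mean_state z m = measure_pmf.expectation (law m) (\<lambda>h. measure_pmf.expectation (next_state \<Gamma> k0 h) z)"

lemma stage_expectation:
  assumes h: "set h \<subseteq> stages \<Gamma>"
  shows "measure_pmf.expectation (stage_law \<Gamma> k0 \<sigma> \<tau> h)
      (\<lambda>s. lam * payoff_of s + (1 - lam) * measure_pmf.expectation (next_state \<Gamma> k0 (h @ [s])) z) =
    measure_pmf.expectation (next_state \<Gamma> k0 h) (\<lambda>k. game_payoff (local_game \<Gamma> lam z k)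
      (mixed_of_pmf (acts1 \<Gamma> k) (\<sigma> h k)) (mixed_of_pmf (acts2 \<Gamma> k) (\<tau> h k)))"
  (is "measure_pmf.expectation _ ?F = _")
proof -
  have fin: "finite (set_pmf (map_pmf (Pair k) (pair_pmf (\<sigma> h k) (\<tau> h k))))"
    if "k \<in> set_pmf (next_state \<Gamma> k0 h)" for k
    using that next_state_support[OF h] finite_supports(3,4)[OF h, of k] by auto
  have "measure_pmf.expectation (stage_law \<Gamma> k0 \<sigma> \<tau> h) ?F =
      measure_pmf.expectation (next_state \<Gamma> k0 h)
        (\<lambda>k. measure_pmf.expectation (map_pmf (Pair k) (pair_pmf (\<sigma> h k) (\<tau> h k))) ?F)"
    unfolding stage_law_def by (rule integral_bind_pmf_finite) (use finite_supports[OF h] fin in auto)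
  also have "\<dots> = measure_pmf.expectation (next_state \<Gamma> k0 h) (\<lambda>k. game_payoff (local_game \<Gamma> lam z k)
      (mixed_of_pmf (acts1 \<Gamma> k) (\<sigma> h k)) (mixed_of_pmf (acts2 \<Gamma> k) (\<tau> h k)))"
  proof (rule expectation_pmf_cong)
    fix k assume "k \<in> set_pmf (next_state \<Gamma> k0 h)"
    then have k: "k \<in> {1..n_states \<Gamma>}" using next_state_support[OF h] by blast
    have "measure_pmf.expectation (map_pmf (Pair k) (pair_pmf (\<sigma> h k) (\<tau> h k))) ?F =
        measure_pmf.expectation (pair_pmf (\<sigma> h k) (\<tau> h k)) (\<lambda>ij. ?F (k, ij))"
      by simp
    also have "\<dots> = measure_pmf.expectation (pair_pmf (\<sigma> h k) (\<tau> h k)) (\<lambda>(i, j). local_game \<Gamma> lam z k $$ (i, j))"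
    proof (rule expectation_pmf_cong)
      fix ij assume "ij \<in> set_pmf (pair_pmf (\<sigma> h k) (\<tau> h k))"
      then obtain i j where ij: "ij = (i, j)" "i < acts1 \<Gamma> k" "j < acts2 \<Gamma> k"
        using actions_support[OF k, of h] by auto
      have "measure_pmf.expectation (trans \<Gamma> k i j) z = (\<Sum>l = 1..n_states \<Gamma>. z l * pmf (trans \<Gamma> k i j) l)"
      proof (rule integral_measure_pmf_real)
        have "set_pmf (trans \<Gamma> k i j) \<subseteq> {1..n_states \<Gamma>}"
          using game k ij unfolding stochastic_game_def by blast
        then show "l \<in> {1..n_states \<Gamma>}" if "l \<in> set_pmf (trans \<Gamma> k i j)" for l
          using that by blast
      qed simp
      then show "?F (k, ij) = (case ij of (i, j) \<Rightarrow> local_game \<Gamma> lam z k $$ (i, j))"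
        using ij by (simp add: local_game_index next_state_def mult_ac)
    qed
    also have "\<dots> = game_payoff (local_game \<Gamma> lam z k)
      (mixed_of_pmf (acts1 \<Gamma> k) (\<sigma> h k)) (mixed_of_pmf (acts2 \<Gamma> k) (\<tau> h k))"
      using game_payoff_expectation[of "\<sigma> h k" "local_game \<Gamma> lam z k" "\<tau> h k"] actions_support[OF k, of h]
      by simp
    finally show "measure_pmf.expectation (map_pmf (Pair k) (pair_pmf (\<sigma> h k) (\<tau> h k))) ?F = \<dots>" .
  qed
  finally show ?thesis .
qed

definition advantage :: "(nat \<Rightarrow> real) \<Rightarrow> nat \<Rightarrow> real" where
  "advantage z m = measure_pmf.expectation (law m) (\<lambda>h. measure_pmf.expectation (next_state \<Gamma> k0 h)
     (\<lambda>k. game_payoff (local_game \<Gamma> lam z k)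
       (mixed_of_pmf (acts1 \<Gamma> k) (\<sigma> h k)) (mixed_of_pmf (acts2 \<Gamma> k) (\<tau> h k)) - z k))"

text \<open>The payoffs of the local games average to the weighted sum of the stage payoff and of \<open>z\<close> at the next
  state.\<close>

lemma one_stage:
  "lam * mean_payoff m + (1 - lam) * mean_state z (Suc m) = mean_state z m + advantage z m"
proof -
  let ?E = "\<lambda>h f. measure_pmf.expectation (stage_law \<Gamma> k0 \<sigma> \<tau> h) f"
  let ?c = "\<lambda>h. measure_pmf.expectation (next_state \<Gamma> k0 h) z"
  let ?p = "\<lambda>h k. game_payoff (local_game \<Gamma> lam z k)
       (mixed_of_pmf (acts1 \<Gamma> k) (\<sigma> h k)) (mixed_of_pmf (acts2 \<Gamma> k) (\<tau> h k))"
  have int: "integrable (measure_pmf (law m)) f" for f :: "_ \<Rightarrow> real"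
    by (rule integrable_measure_pmf_finite[OF finite_law])
  have "mean_state z (Suc m) = measure_pmf.expectation (law m) (\<lambda>h. ?E h (\<lambda>s. ?c (h @ [s])))"
    unfolding mean_state_def history_law.simps
    by (subst integral_bind_pmf_finite) (simp_all add: finite_law finite_stage_law)
  then have "lam * mean_payoff m + (1 - lam) * mean_state z (Suc m) =
      measure_pmf.expectation (law m) (\<lambda>h. lam * ?E h payoff_of + (1 - lam) * ?E h (\<lambda>s. ?c (h @ [s])))"
    unfolding mean_payoff_def by (simp add: int)
  also have "\<dots> = measure_pmf.expectation (law m) (\<lambda>h. ?c h +
      measure_pmf.expectation (next_state \<Gamma> k0 h) (\<lambda>k. ?p h k - z k))"
  proof (rule expectation_pmf_cong)
    fix h assume "h \<in> set_pmf (law m)"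
    then have h: "set h \<subseteq> stages \<Gamma>" using law_support by blast
    have int1: "integrable (measure_pmf (stage_law \<Gamma> k0 \<sigma> \<tau> h)) f" for f :: "_ \<Rightarrow> real"
      by (rule integrable_measure_pmf_finite[OF finite_supports(2)[OF h]])
    have int2: "integrable (measure_pmf (next_state \<Gamma> k0 h)) f" for f :: "_ \<Rightarrow> real"
      by (rule integrable_measure_pmf_finite[OF finite_supports(1)[OF h]])
    have "lam * ?E h payoff_of + (1 - lam) * ?E h (\<lambda>s. ?c (h @ [s])) =
      ?E h (\<lambda>s. lam * payoff_of s + (1 - lam) * ?c (h @ [s]))"
      by (simp add: int1)
    also have "\<dots> = measure_pmf.expectation (next_state \<Gamma> k0 h) (?p h)"
      by (rule stage_expectation[OF h])
    also have "\<dots> = ?c h + measure_pmf.expectation (next_state \<Gamma> k0 h) (\<lambda>k. ?p h k - z k)"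
      by (simp add: int2)
    finally show "lam * ?E h payoff_of + (1 - lam) * ?E h (\<lambda>s. ?c (h @ [s])) = \<dots>" .
  qed
  also have "\<dots> = mean_state z m + advantage z m"
    unfolding mean_state_def advantage_def by (simp add: int)
  finally show ?thesis .
qed

lemma mean_payoff_bound:
  assumes "\<And>k i j. (k, i, j) \<in> stages \<Gamma> \<Longrightarrow> \<bar>payoff \<Gamma> k i j\<bar> \<le> c"
  shows "\<bar>mean_payoff m\<bar> \<le> c"
proof -
  show ?thesis unfolding mean_payoff_def
  proof (rule expectation_pmf_abs_le[OF finite_law], rule expectation_pmf_abs_le)
    fix h s assume "h \<in> set_pmf (law m)" "s \<in> set_pmf (stage_law \<Gamma> k0 \<sigma> \<tau> h)"
    then have "s \<in> stages \<Gamma>" using law_support stage_law_support by blast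
    then show "\<bar>payoff_of s\<bar> \<le> c" using assms by (cases s) auto
  next
    fix h assume "h \<in> set_pmf (law m)"
    then show "finite (set_pmf (stage_law \<Gamma> k0 \<sigma> \<tau> h))" using law_support finite_supports(2) by blast
  qed
qed

lemma mean_state_bound:
  assumes "\<And>k. k \<in> {1..n_states \<Gamma>} \<Longrightarrow> \<bar>z k\<bar> \<le> c"
  shows "\<bar>mean_state z m\<bar> \<le> c"
proof -
  show ?thesis unfolding mean_state_def
  proof (rule expectation_pmf_abs_le[OF finite_law], rule expectation_pmf_abs_le)
    fix h assume h: "h \<in> set_pmf (law m)"
    then show "finite (set_pmf (next_state \<Gamma> k0 h))" using law_support finite_supports(1) by blast
    fix k assume "k \<in> set_pmf (next_state \<Gamma> k0 h)"
    then show "\<bar>z k\<bar> \<le> c" using assms law_support[OF h] next_state_support by blast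
  qed
qed

text \<open>Almost surely the play stays in the finite set \<open>stages \<Gamma>\<close>, where the payoffs are bounded, so the series
  can be integrated term by term.\<close>

lemma discounted_payoff_sums:
  "(\<lambda>m. lam * (1 - lam) ^ m * mean_payoff m) sums discounted_payoff \<Gamma> lam k0 \<sigma> \<tau>"
proof -
  let ?M = "play_measure \<Gamma> k0 \<sigma> \<tau>"
  interpret prob_space ?M by (rule prob_space_play_measure)
  obtain c where c: "0 \<le> c" "\<And>k i j. (k, i, j) \<in> stages \<Gamma> \<Longrightarrow> \<bar>payoff \<Gamma> k i j\<bar> \<le> c"
    using payoff_bound_exists[of \<Gamma>] by blast
  define f where "f m \<omega> = lam * (1 - lam) ^ m * payoff_of (\<omega> m)" for m and \<omega> :: "nat \<Rightarrow> stage"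
  have meas_last: "(\<lambda>h. payoff_of (last h)) \<in> count_space UNIV \<rightarrow>\<^sub>M borel" by simp
  have last: "last (map \<omega> [0..<Suc m]) = \<omega> m" for \<omega> :: "nat \<Rightarrow> stage" and m by simp
  have AE_stage: "AE \<omega> in ?M. \<omega> m \<in> stages \<Gamma>" for m
  proof -
    have "AE h in distr ?M (count_space UNIV) (\<lambda>\<omega>. map \<omega> [0..<Suc m]). last h \<in> stages \<Gamma>"
      unfolding distr_play_history AE_measure_pmf_iff
    proof
      fix h assume "h \<in> set_pmf (law (Suc m))"
      then have h: "set h \<subseteq> stages \<Gamma> \<and> length h = Suc m" by (rule law_support)
      then have "h \<noteq> []" by auto
      then show "last h \<in> stages \<Gamma>" using h by auto
    qed
    from AE_distrD[OF hist_map_measurable_play this] show ?thesis unfolding last .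
  qed
  have f_meas: "f m \<in> borel_measurable ?M" for m
  proof -
    have "(\<lambda>\<omega>. lam * (1 - lam) ^ m * payoff_of (last (map \<omega> [0..<Suc m]))) \<in> borel_measurable ?M"
      by (intro borel_measurable_times borel_measurable_const measurable_compose[OF hist_map_measurable_play meas_last])
    then show ?thesis unfolding f_def last .
  qed
  have f_bound: "AE \<omega> in ?M. \<bar>f m \<omega>\<bar> \<le> lam * (1 - lam) ^ m * c" for m
    using AE_stage[of m]
  proof eventually_elim
    case (elim \<omega>)
    then have "\<bar>payoff_of (\<omega> m)\<bar> \<le> c" using c(2) by (cases "\<omega> m") auto
    then have "lam * (1 - lam) ^ m * \<bar>payoff_of (\<omega> m)\<bar> \<le> lam * (1 - lam) ^ m * c"
      using lam by (intro mult_left_mono) auto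
    then show ?case using lam by (simp add: f_def abs_mult)
  qed
  have f_int: "integrable ?M (f m)" for m
    by (rule integrable_const_bound[OF _ f_meas]) (use f_bound[of m] in auto)
  have f_integral: "integral\<^sup>L ?M (f m) = lam * (1 - lam) ^ m * mean_payoff m" for m
  proof -
    have "integral\<^sup>L ?M (f m) = lam * (1 - lam) ^ m * integral\<^sup>L ?M (\<lambda>\<omega>. payoff_of (last (map \<omega> [0..<Suc m])))"
      unfolding f_def last by simp
    also have "integral\<^sup>L ?M (\<lambda>\<omega>. payoff_of (last (map \<omega> [0..<Suc m]))) =
        integral\<^sup>L (distr ?M (count_space UNIV) (\<lambda>\<omega>. map \<omega> [0..<Suc m])) (\<lambda>h. payoff_of (last h))"
      by (rule integral_distr[OF hist_map_measurable_play meas_last, symmetric])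
    also have "\<dots> = mean_payoff m"
      unfolding distr_play_history mean_payoff_def history_law.simps
      by (subst integral_bind_pmf_finite) (simp_all add: finite_law finite_stage_law)
    finally show ?thesis .
  qed
  have geo: "summable (\<lambda>m. lam * (1 - lam) ^ m * c)"
    using lam by (intro summable_mult summable_mult2 summable_geometric) auto
  have "AE \<omega> in ?M. \<forall>m. \<bar>f m \<omega>\<bar> \<le> lam * (1 - lam) ^ m * c"
    unfolding AE_all_countable using f_bound by blast
  then have "AE \<omega> in ?M. summable (\<lambda>m. norm (f m \<omega>))"
    by eventually_elim (rule summable_comparison_test'[OF geo, of 0], auto)
  moreover have "summable (\<lambda>m. LINT \<omega>|?M. norm (f m \<omega>))"
  proof (rule summable_comparison_test'[OF geo, of 0])
    fix m
    have "(LINT \<omega>|?M. norm (f m \<omega>)) \<le> (LINT \<omega>|?M. lam * (1 - lam) ^ m * c)"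
      using f_bound[of m] by (intro integral_mono_AE) (auto intro: f_int)
    then show "norm (LINT \<omega>|?M. norm (f m \<omega>)) \<le> lam * (1 - lam) ^ m * c" by (simp add: prob_space)
  qed
  ultimately have "(\<lambda>m. integral\<^sup>L ?M (f m)) sums (LINT \<omega>|?M. (\<Sum>m. f m \<omega>))"
    by (intro sums_integral f_int)
  then show ?thesis
    unfolding f_integral unfolding f_def discounted_payoff_def .
qed

text \<open>The stage identities telescope: the discounted payoff exceeds \<open>z k0\<close> by the discounted sum of
  what the players gain over \<open>z\<close> in the local games they meet.\<close>

lemma discounted_payoff_eq:
  "(\<lambda>m. (1 - lam) ^ m * advantage z m) sums (discounted_payoff \<Gamma> lam k0 \<sigma> \<tau> - z k0)"
proof -
  let ?t = "\<lambda>m. (1 - lam) ^ m * mean_state z m - (1 - lam) ^ Suc m * mean_state z (Suc m)"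
  define c where "c = (\<Sum>k = 1..n_states \<Gamma>. \<bar>z k\<bar>)"
  have "\<bar>z k\<bar> \<le> c" if "k \<in> {1..n_states \<Gamma>}" for k
    unfolding c_def using that by (intro member_le_sum) auto
  then have bound: "\<bar>mean_state z m\<bar> \<le> c" for m by (intro mean_state_bound)
  have geo: "(\<lambda>m. (1 - lam) ^ m * c) \<longlonglongrightarrow> 0"
    using lam by (intro tendsto_mult_left_zero LIMSEQ_power_zero) auto
  have "(\<lambda>m. (1 - lam) ^ m * mean_state z m) \<longlonglongrightarrow> 0"
  proof (rule Lim_null_comparison[OF _ geo], rule always_eventually, rule allI)
    fix m show "norm ((1 - lam) ^ m * mean_state z m) \<le> (1 - lam) ^ m * c"
      using bound[of m] lam by (simp add: abs_mult mult_left_mono)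
  qed
  from telescope_sums'[OF this]
  have "?t sums z k0"
    by (simp add: mean_state_def next_state_def)
  from sums_diff[OF discounted_payoff_sums this]
  have "(\<lambda>m. lam * (1 - lam) ^ m * mean_payoff m - ?t m)
    sums (discounted_payoff \<Gamma> lam k0 \<sigma> \<tau> - z k0)" .
  moreover have "lam * (1 - lam) ^ m * mean_payoff m - ?t m
     = (1 - lam) ^ m * advantage z m" for m
  proof -
    have "lam * (1 - lam) ^ m * mean_payoff m - ?t m =
      (1 - lam) ^ m * (lam * mean_payoff m + (1 - lam) * mean_state z (Suc m) - mean_state z m)"
      by (simp add: algebra_simps)
    then show ?thesis using one_stage[of m z] by simp
  qed
  ultimately show ?thesis by simp
qed

lemma geometric_weight: "(\<lambda>m. (1 - lam) ^ m * e) sums (e / lam)"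
proof -
  have "(\<lambda>m. (1 - lam) ^ m) sums (1 / (1 - (1 - lam)))" using lam by (intro geometric_sums) auto
  from sums_mult2[OF this, of e] show ?thesis by simp
qed

lemma discounted_payoff_bound:
  assumes "\<And>k i j. (k, i, j) \<in> stages \<Gamma> \<Longrightarrow> \<bar>payoff \<Gamma> k i j\<bar> \<le> c"
  shows "\<bar>discounted_payoff \<Gamma> lam k0 \<sigma> \<tau>\<bar> \<le> c"
proof -
  have w: "(\<lambda>m. (1 - lam) ^ m * (lam * d)) sums d" for d using geometric_weight[of "lam * d"] lam by simp
  have b: "mean_payoff m \<le> c" "- c \<le> mean_payoff m" for m using mean_payoff_bound[OF assms, of m] by auto
  have "discounted_payoff \<Gamma> lam k0 \<sigma> \<tau> \<le> c"
  proof (rule sums_le[OF _ discounted_payoff_sums w])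
    fix m have "(lam * (1 - lam) ^ m) * mean_payoff m \<le> (lam * (1 - lam) ^ m) * c"
      using b[of m] lam by (intro mult_left_mono) auto
    then show "lam * (1 - lam) ^ m * mean_payoff m \<le> (1 - lam) ^ m * (lam * c)" by (simp add: mult_ac)
  qed
  moreover have "- c \<le> discounted_payoff \<Gamma> lam k0 \<sigma> \<tau>"
  proof (rule sums_le[OF _ w discounted_payoff_sums])
    fix m have "(lam * (1 - lam) ^ m) * (- c) \<le> (lam * (1 - lam) ^ m) * mean_payoff m"
      using b[of m] lam by (intro mult_left_mono) auto
    then show "(1 - lam) ^ m * (lam * (- c)) \<le> lam * (1 - lam) ^ m * mean_payoff m" by (simp add: mult_ac)
  qed
  ultimately show ?thesis by simp
qed

lemma discounted_payoff_ge:
  assumes "\<And>h k. k \<in> {1..n_states \<Gamma>} \<Longrightarrow> z k - e \<le> game_payoff (local_game \<Gamma> lam z k)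
    (mixed_of_pmf (acts1 \<Gamma> k) (\<sigma> h k)) (mixed_of_pmf (acts2 \<Gamma> k) (\<tau> h k))"
  shows "z k0 - e / lam \<le> discounted_payoff \<Gamma> lam k0 \<sigma> \<tau>"
proof -
  have "- e \<le> advantage z m" for m
  proof -
    have "measure_pmf.expectation (law m) (\<lambda>h. measure_pmf.expectation (next_state \<Gamma> k0 h) (\<lambda>_. - e)) \<le> advantage z m"
      unfolding advantage_def
    proof (intro expectation_pmf_mono finite_law)
      fix h k assume h: "h \<in> set_pmf (law m)"
      show "finite (set_pmf (next_state \<Gamma> k0 h))"
        using finite_supports(1) law_support[OF h] by blast
      assume "k \<in> set_pmf (next_state \<Gamma> k0 h)"
      then have "k \<in> {1..n_states \<Gamma>}" using next_state_support law_support[OF h] by blast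
      from assms[OF this, of h] show "- e \<le> game_payoff (local_game \<Gamma> lam z k) (mixed_of_pmf (acts1 \<Gamma> k) (\<sigma> h k)) (mixed_of_pmf (acts2 \<Gamma> k) (\<tau> h k)) - z k" by simp
    qed
    then show ?thesis by simp
  qed
  then have "- e / lam \<le> discounted_payoff \<Gamma> lam k0 \<sigma> \<tau> - z k0"
    using lam by (intro sums_le[OF _ geometric_weight discounted_payoff_eq] mult_left_mono) auto
  then show ?thesis by simp
qed

lemma discounted_payoff_le:
  assumes "\<And>h k. k \<in> {1..n_states \<Gamma>} \<Longrightarrow> game_payoff (local_game \<Gamma> lam z k)
    (mixed_of_pmf (acts1 \<Gamma> k) (\<sigma> h k)) (mixed_of_pmf (acts2 \<Gamma> k) (\<tau> h k)) \<le> z k + e"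
  shows "discounted_payoff \<Gamma> lam k0 \<sigma> \<tau> \<le> z k0 + e / lam"
proof -
  have "advantage z m \<le> e" for m
  proof -
    have "advantage z m \<le> measure_pmf.expectation (law m) (\<lambda>h. measure_pmf.expectation (next_state \<Gamma> k0 h) (\<lambda>_. e))"
      unfolding advantage_def
    proof (intro expectation_pmf_mono finite_law)
      fix h k assume h: "h \<in> set_pmf (law m)"
      show "finite (set_pmf (next_state \<Gamma> k0 h))"
        using finite_supports(1) law_support[OF h] by blast
      assume "k \<in> set_pmf (next_state \<Gamma> k0 h)"
      then have "k \<in> {1..n_states \<Gamma>}" using next_state_support law_support[OF h] by blast
      from assms[OF this, of h] show "game_payoff (local_game \<Gamma> lam z k) (mixed_of_pmf (acts1 \<Gamma> k) (\<sigma> h k)) (mixed_of_pmf (acts2 \<Gamma> k) (\<tau> h k)) - z k \<le> e" by simp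
    qed
    then show ?thesis by simp
  qed
  then have "discounted_payoff \<Gamma> lam k0 \<sigma> \<tau> - z k0 \<le> e / lam"
    using lam by (intro sums_le[OF _ discounted_payoff_eq geometric_weight] mult_left_mono) auto
  then show ?thesis by simp
qed

end

lemma strategies_nonempty:
  assumes "\<And>k. k \<in> {1..n} \<Longrightarrow> 0 < acts k"
  shows "strategies n acts \<noteq> {}"
proof -
  have "(\<lambda>h k. return_pmf 0) \<in> strategies n acts" using assms by (auto simp: strategies_def)
  then show ?thesis by blast
qed

text \<open>Player 1 secures any solution \<open>z\<close> of Shapley's equation up to \<open>e / lam\<close> by playing
  \<open>e\<close>-optimally in the local game of the current state. In the supremum of infima Player 2 replies to a
  known strategy: an \<open>e\<close>-best reply to the mixed action that it prescribes after each history holds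
  Player 1 to \<open>z\<close> up to \<open>e / lam\<close>.\<close>

theorem discounted_value_eq_fixed_point:
  assumes g: "stochastic_game \<Gamma>" and lam: "lam \<in> {0<..1}" and k0: "k0 \<in> {1..n_states \<Gamma>}"
    and z: "\<And>k. k \<in> {1..n_states \<Gamma>} \<Longrightarrow> game_val (local_game \<Gamma> lam z k) = z k"
  shows "discounted_value \<Gamma> lam k0 = z k0"
proof -
  let ?S = "strategies (n_states \<Gamma>) (acts1 \<Gamma>)" and ?T = "strategies (n_states \<Gamma>) (acts2 \<Gamma>)"
  let ?p = "discounted_payoff \<Gamma> lam k0"
  have pos: "0 < dim_row (local_game \<Gamma> lam z k)" "0 < dim_col (local_game \<Gamma> lam z k)"
    if "k \<in> {1..n_states \<Gamma>}" for k using g that by (auto simp: stochastic_game_def)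
  have ne: "?S \<noteq> {}" "?T \<noteq> {}" using strategies_nonempty pos by auto
  have play: "discounted_play \<Gamma> lam k0 \<sigma> \<tau>" if "\<sigma> \<in> ?S" "\<tau> \<in> ?T" for \<sigma> \<tau>
    by standard (use g lam k0 that in auto)
  obtain c where c: "\<And>k i j. (k, i, j) \<in> stages \<Gamma> \<Longrightarrow> \<bar>payoff \<Gamma> k i j\<bar> \<le> c"
    using payoff_bound_exists[of \<Gamma>] by blast
  have b: "\<bar>?p \<sigma> \<tau>\<bar> \<le> c" if "\<sigma> \<in> ?S" "\<tau> \<in> ?T" for \<sigma> \<tau>
    using discounted_play.discounted_payoff_bound[OF play[OF that] c] by blast
  have bb: "bdd_below (?p \<sigma> ` ?T)" if "\<sigma> \<in> ?S" for \<sigma>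
    using b[OF that] by (intro bdd_belowI2[of _ "- c"]) (force simp: abs_le_iff)
  obtain \<tau>0 where \<tau>0: "\<tau>0 \<in> ?T" using ne by blast
  have ba: "bdd_above ((\<lambda>\<sigma>. INF \<tau>\<in>?T. ?p \<sigma> \<tau>) ` ?S)"
  proof (rule bdd_aboveI2[of _ _ c])
    fix \<sigma> assume \<sigma>: "\<sigma> \<in> ?S"
    have "(INF \<tau>\<in>?T. ?p \<sigma> \<tau>) \<le> ?p \<sigma> \<tau>0" by (rule cINF_lower[OF bb[OF \<sigma>] \<tau>0])
    then show "(INF \<tau>\<in>?T. ?p \<sigma> \<tau>) \<le> c" using b[OF \<sigma> \<tau>0] by simp
  qed
  show ?thesis
  proof (rule antisym)
    show "z k0 \<le> discounted_value \<Gamma> lam k0"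
    proof (rule field_le_epsilon)
      fix d :: real assume d: "0 < d"
      define e where "e = d * lam"
      have e: "0 < e" "e / lam = d" using d lam by (auto simp: e_def)
      have "\<exists>p. set_pmf p \<subseteq> {..<acts1 \<Gamma> k} \<and> (\<forall>y\<in>mixed_strategies (acts2 \<Gamma> k).
          z k - e \<le> game_payoff (local_game \<Gamma> lam z k) (mixed_of_pmf (acts1 \<Gamma> k) p) y)"
        if k: "k \<in> {1..n_states \<Gamma>}" for k
      proof -
        obtain x where x: "x \<in> mixed_strategies (acts1 \<Gamma> k)"
          "\<And>y. y \<in> mixed_strategies (acts2 \<Gamma> k) \<Longrightarrow> z k - e \<le> game_payoff (local_game \<Gamma> lam z k) x y"
          using game_val_near_optimal_row[OF pos[OF k] e(1)] z[OF k] by auto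
        obtain p where "set_pmf p \<subseteq> {..<acts1 \<Gamma> k}" "mixed_of_pmf (acts1 \<Gamma> k) p = x"
          using mixed_of_pmf_surj[OF x(1)] by blast
        then show ?thesis using x(2) by blast
      qed
      then obtain p where p: "\<And>k. k \<in> {1..n_states \<Gamma>} \<Longrightarrow> set_pmf (p k) \<subseteq> {..<acts1 \<Gamma> k}"
        "\<And>k y. k \<in> {1..n_states \<Gamma>} \<Longrightarrow> y \<in> mixed_strategies (acts2 \<Gamma> k) \<Longrightarrow>
          z k - e \<le> game_payoff (local_game \<Gamma> lam z k) (mixed_of_pmf (acts1 \<Gamma> k) (p k)) y"
        by metis
      define \<sigma> :: strategy where "\<sigma> h k = p k" for h k
      have \<sigma>: "\<sigma> \<in> ?S" using p(1) by (auto simp: strategies_def \<sigma>_def)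
      have "z k0 - d \<le> ?p \<sigma> \<tau>" if \<tau>: "\<tau> \<in> ?T" for \<tau>
      proof -
        have "z k0 - e / lam \<le> ?p \<sigma> \<tau>"
        proof (rule discounted_play.discounted_payoff_ge[OF play[OF \<sigma> \<tau>]])
          fix h k assume k: "k \<in> {1..n_states \<Gamma>}"
          show "z k - e \<le> game_payoff (local_game \<Gamma> lam z k)
            (mixed_of_pmf (acts1 \<Gamma> k) (\<sigma> h k)) (mixed_of_pmf (acts2 \<Gamma> k) (\<tau> h k))"
            unfolding \<sigma>_def using k \<tau> by (intro p(2) mixed_of_pmf_in) (auto simp: strategies_def)
        qed
        then show ?thesis using e by simp
      qed
      then have "z k0 - d \<le> (INF \<tau>\<in>?T. ?p \<sigma> \<tau>)" by (intro cINF_greatest ne)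
      also have "\<dots> \<le> discounted_value \<Gamma> lam k0"
        unfolding discounted_value_def by (rule cSUP_upper[OF \<sigma> ba])
      finally show "z k0 \<le> discounted_value \<Gamma> lam k0 + d" by simp
    qed
    show "discounted_value \<Gamma> lam k0 \<le> z k0"
    proof (rule field_le_epsilon)
      fix d :: real assume d: "0 < d"
      define e where "e = d * lam"
      have e: "0 < e" "e / lam = d" using d lam by (auto simp: e_def)
      show "discounted_value \<Gamma> lam k0 \<le> z k0 + d"
        unfolding discounted_value_def
      proof (rule cSUP_least[OF ne(1)])
        fix \<sigma> assume \<sigma>: "\<sigma> \<in> ?S"
        define best where "best h k q \<longleftrightarrow> set_pmf q \<subseteq> {..<acts2 \<Gamma> k} \<and>
            game_payoff (local_game \<Gamma> lam z k) (mixed_of_pmf (acts1 \<Gamma> k) (\<sigma> h k)) (mixed_of_pmf (acts2 \<Gamma> k) q) \<le> z k + e"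
          for h k q
        have ex: "\<exists>q. best h k q" if k: "k \<in> {1..n_states \<Gamma>}" for h k
        proof -
          have x: "mixed_of_pmf (acts1 \<Gamma> k) (\<sigma> h k) \<in> mixed_strategies (dim_row (local_game \<Gamma> lam z k))"
            using \<sigma> k unfolding strategies_def local_game_dim by (intro mixed_of_pmf_in) blast
          obtain y where y: "y \<in> mixed_strategies (acts2 \<Gamma> k)"
            "game_payoff (local_game \<Gamma> lam z k) (mixed_of_pmf (acts1 \<Gamma> k) (\<sigma> h k)) y \<le> z k + e"
            using game_val_near_best_reply[OF pos[OF k] e(1) x] z[OF k] by auto
          obtain q where "set_pmf q \<subseteq> {..<acts2 \<Gamma> k}" "mixed_of_pmf (acts2 \<Gamma> k) q = y"
            using mixed_of_pmf_surj[OF y(1)] by blast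
          then show ?thesis using y(2) unfolding best_def by blast
        qed
        define \<tau> :: strategy where "\<tau> h k = (SOME q. best h k q)" for h k
        have "best h k (\<tau> h k)" if "k \<in> {1..n_states \<Gamma>}" for h k
          unfolding \<tau>_def by (rule someI_ex) (rule ex[OF that])
        then have \<tau>: "\<And>h k. k \<in> {1..n_states \<Gamma>} \<Longrightarrow> set_pmf (\<tau> h k) \<subseteq> {..<acts2 \<Gamma> k}"
          "\<And>h k. k \<in> {1..n_states \<Gamma>} \<Longrightarrow> game_payoff (local_game \<Gamma> lam z k)
            (mixed_of_pmf (acts1 \<Gamma> k) (\<sigma> h k)) (mixed_of_pmf (acts2 \<Gamma> k) (\<tau> h k)) \<le> z k + e"
          unfolding best_def by blast+
        have \<tau>': "\<tau> \<in> ?T" using \<tau>(1) by (auto simp: strategies_def)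
        have "(INF \<tau>\<in>?T. ?p \<sigma> \<tau>) \<le> ?p \<sigma> \<tau>" by (rule cINF_lower[OF bb[OF \<sigma>] \<tau>'])
        also have "\<dots> \<le> z k0 + e / lam"
          by (rule discounted_play.discounted_payoff_le[OF play[OF \<sigma> \<tau>'] \<tau>(2)])
        finally show "(INF \<tau>\<in>?T. ?p \<sigma> \<tau>) \<le> z k0 + d" using e by simp
      qed
    qed
  qed
qed

corollary discounted_value_fixed_point:
  assumes g: "stochastic_game \<Gamma>" and lam: "lam \<in> {0<..1}" and k: "k \<in> {1..n_states \<Gamma>}"
  shows "game_val (local_game \<Gamma> lam (discounted_value \<Gamma> lam) k) = discounted_value \<Gamma> lam k"
proof -
  obtain z where z: "\<And>k. k \<in> {1..n_states \<Gamma>} \<Longrightarrow> game_val (local_game \<Gamma> lam z k) = z k"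
    using shapley_fixed_point_exists[OF g lam] by blast
  have v: "discounted_value \<Gamma> lam l = z l" if "l \<in> {1..n_states \<Gamma>}" for l
    by (rule discounted_value_eq_fixed_point[OF g lam that z])
  have "local_game \<Gamma> lam (discounted_value \<Gamma> lam) k = local_game \<Gamma> lam z k"
    unfolding local_game_def by (intro cong_mat) (simp_all add: v)
  then show ?thesis using z v k by simp
qed

text \<open>At a state of extreme value, Shapley's equation bounds this value by a convex combination of itself and
  an extreme payoff.\<close>

lemma discounted_value_bounds:
  assumes g: "stochastic_game \<Gamma>" and lam: "lam \<in> {0<..1}" and k: "k \<in> {1..n_states \<Gamma>}"
  shows "discounted_value \<Gamma> lam k \<in> {Min (stage_payoffs \<Gamma>)..Max (stage_payoffs \<Gamma>)}"
proof -
  let ?v = "discounted_value \<Gamma> lam" and ?N = "{1..n_states \<Gamma>}"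
  let ?lo = "Min (stage_payoffs \<Gamma>)" and ?hi = "Max (stage_payoffs \<Gamma>)"
  have ne: "?N \<noteq> {}" using k by auto
  have pos: "0 < acts1 \<Gamma> k" "0 < acts2 \<Gamma> k" if "k \<in> ?N" for k using g that by (auto simp: stochastic_game_def)
  have pay: "?lo \<le> payoff \<Gamma> k i j \<and> payoff \<Gamma> k i j \<le> ?hi" if "k \<in> ?N" "i < acts1 \<Gamma> k" "j < acts2 \<Gamma> k" for k i j
  proof -
    have "payoff \<Gamma> k i j \<in> stage_payoffs \<Gamma>" using that by (auto simp: stage_payoffs_def)
    then show ?thesis using finite_stage_payoffs by auto
  qed
  have "?v ` ?N \<noteq> {}" "finite (?v ` ?N)" using ne by auto
  then obtain a b where a: "a \<in> ?N" "?v a = Max (?v ` ?N)" and b: "b \<in> ?N" "?v b = Min (?v ` ?N)"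
    using imageE[OF Max_in[of "?v ` ?N"]] imageE[OF Min_in[of "?v ` ?N"]] by metis
  have max: "?v l \<le> ?v a" and min: "?v b \<le> ?v l" if "l \<in> ?N" for l
    using that a b by auto
  have "?v a \<le> lam * ?hi + (1 - lam) * ?v a"
  proof -
    have "game_val (local_game \<Gamma> lam ?v a) \<le> lam * ?hi + (1 - lam) * ?v a"
    proof (rule game_val_le_const)
      fix i j assume ij: "i < dim_row (local_game \<Gamma> lam ?v a)" "j < dim_col (local_game \<Gamma> lam ?v a)"
      have "(\<Sum>l\<in>?N. pmf (trans \<Gamma> a i j) l * ?v l) \<le> (\<Sum>l\<in>?N. pmf (trans \<Gamma> a i j) l * 0) + ?v a"
        by (rule transition_mean_le[OF g a(1)]) (use ij max in auto)
      then show "local_game \<Gamma> lam ?v a $$ (i, j) \<le> lam * ?hi + (1 - lam) * ?v a"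
        using ij pay[OF a(1), of i j] lam by (simp add: local_game_index add_mono mult_left_mono)
    qed (use pos[OF a(1)] in auto)
    then show ?thesis using discounted_value_fixed_point[OF g lam a(1)] by simp
  qed
  then have "lam * ?v a \<le> lam * ?hi" by (simp add: algebra_simps)
  then have hi: "?v a \<le> ?hi" using lam by simp
  have "lam * ?lo + (1 - lam) * ?v b \<le> ?v b"
  proof -
    have "lam * ?lo + (1 - lam) * ?v b \<le> game_val (local_game \<Gamma> lam ?v b)"
    proof (rule game_val_ge_const)
      fix i j assume ij: "i < dim_row (local_game \<Gamma> lam ?v b)" "j < dim_col (local_game \<Gamma> lam ?v b)"
      have "(\<Sum>l\<in>?N. pmf (trans \<Gamma> b i j) l * 0) \<le> (\<Sum>l\<in>?N. pmf (trans \<Gamma> b i j) l * ?v l) + (- ?v b)"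
        by (rule transition_mean_le[OF g b(1)]) (use ij min in auto)
      then show "lam * ?lo + (1 - lam) * ?v b \<le> local_game \<Gamma> lam ?v b $$ (i, j)"
        using ij pay[OF b(1), of i j] lam by (simp add: local_game_index add_mono mult_left_mono)
    qed (use pos[OF b(1)] in auto)
    then show ?thesis using discounted_value_fixed_point[OF g lam b(1)] by simp
  qed
  then have "lam * ?lo \<le> lam * ?v b" by (simp add: algebra_simps)
  then have "?lo \<le> ?v b" using lam by simp
  then show ?thesis using hi max[OF k] min[OF k] by auto
qed

text \<open>The local games at two discount rates differ by a multiple of the difference of the rates; the contraction
  factor \<open>1 - lam\<close> turns this into a bound on the fixed points.\<close>

lemma discounted_value_lipschitz:
  assumes g: "stochastic_game \<Gamma>"
  obtains c where "0 \<le> c" "\<And>lam mu k. lam \<in> {0<..1} \<Longrightarrow> mu \<in> {0<..1} \<Longrightarrow> k \<in> {1..n_states \<Gamma>} \<Longrightarrow>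
    lam * \<bar>discounted_value \<Gamma> lam k - discounted_value \<Gamma> mu k\<bar> \<le> c * \<bar>lam - mu\<bar>"
proof -
  let ?N = "{1..n_states \<Gamma>}" and ?v = "discounted_value \<Gamma>"
  have pos: "0 < acts1 \<Gamma> k" "0 < acts2 \<Gamma> k" if "k \<in> ?N" for k using g that by (auto simp: stochastic_game_def)
  obtain c where c: "0 \<le> c" "\<And>k i j. (k, i, j) \<in> stages \<Gamma> \<Longrightarrow> \<bar>payoff \<Gamma> k i j\<bar> \<le> c"
    using payoff_bound_exists[of \<Gamma>] by blast
  have vc: "\<bar>?v lam k\<bar> \<le> c" if "lam \<in> {0<..1}" "k \<in> ?N" for lam k
  proof -
    have "(k, 0, 0) \<in> stages \<Gamma>" using pos[OF that(2)] that by (auto simp: stages_def)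
    then have ne: "stage_payoffs \<Gamma> \<noteq> {}" by (auto simp: stage_payoffs_image)
    have "Max (stage_payoffs \<Gamma>) \<in> stage_payoffs \<Gamma>" "Min (stage_payoffs \<Gamma>) \<in> stage_payoffs \<Gamma>"
      using Max_in Min_in ne finite_stage_payoffs by auto
    then have "Max (stage_payoffs \<Gamma>) \<le> c" "- c \<le> Min (stage_payoffs \<Gamma>)"
      using c(2) unfolding stage_payoffs_image by (force simp: abs_le_iff)+
    then show ?thesis using discounted_value_bounds[OF g that] by auto
  qed
  have key: "game_val (local_game \<Gamma> lam z k) \<le> game_val (local_game \<Gamma> mu z k) + 2 * c * \<bar>lam - mu\<bar>"
    if k: "k \<in> ?N" and z: "\<And>l. l \<in> ?N \<Longrightarrow> \<bar>z l\<bar> \<le> c" for lam mu z k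
  proof (rule game_val_le_add)
    fix i j assume ij: "i < dim_row (local_game \<Gamma> lam z k)" "j < dim_col (local_game \<Gamma> lam z k)"
    let ?q = "\<Sum>l\<in>?N. pmf (trans \<Gamma> k i j) l * z l"
    have "?q \<le> (\<Sum>l\<in>?N. pmf (trans \<Gamma> k i j) l * 0) + c"
      by (rule transition_mean_le[OF g k]) (use ij z in \<open>auto simp: abs_le_iff\<close>)
    moreover have "(\<Sum>l\<in>?N. pmf (trans \<Gamma> k i j) l * 0) \<le> ?q + c"
      by (rule transition_mean_le[OF g k]) (use ij z in \<open>force simp: abs_le_iff\<close>)+
    ultimately have q: "\<bar>?q\<bar> \<le> c" by auto
    have p: "\<bar>payoff \<Gamma> k i j\<bar> \<le> c" using ij k by (intro c) (auto simp: stages_def)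
    have "local_game \<Gamma> lam z k $$ (i, j) - local_game \<Gamma> mu z k $$ (i, j) = (lam - mu) * (payoff \<Gamma> k i j - ?q)"
      using ij by (simp add: local_game_index algebra_simps)
    also have "\<dots> \<le> \<bar>lam - mu\<bar> * \<bar>payoff \<Gamma> k i j - ?q\<bar>" by (metis abs_ge_self abs_mult)
    also have "\<dots> \<le> \<bar>lam - mu\<bar> * (2 * c)" using p q by (intro mult_left_mono) auto
    finally show "local_game \<Gamma> lam z k $$ (i, j) \<le> local_game \<Gamma> mu z k $$ (i, j) + 2 * c * \<bar>lam - mu\<bar>"
      by (simp add: mult_ac)
  qed (use pos[OF k] in auto)
  have "lam * \<bar>?v lam k - ?v mu k\<bar> \<le> 2 * c * \<bar>lam - mu\<bar>"
    if lam: "lam \<in> {0<..1}" and mu: "mu \<in> {0<..1}" and k: "k \<in> ?N" for lam mu k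
  proof -
    let ?d = "\<lambda>l. \<bar>?v lam l - ?v mu l\<bar>"
    have "finite (?d ` ?N)" "?d ` ?N \<noteq> {}" using k by auto
    then obtain a where a: "a \<in> ?N" "?d a = Max (?d ` ?N)"
      using imageE[OF Max_in[of "?d ` ?N"]] by metis
    have max: "?d l \<le> ?d a" if "l \<in> ?N" for l using that a by auto
    have "\<bar>game_val (local_game \<Gamma> lam (?v lam) a) - game_val (local_game \<Gamma> lam (?v mu) a)\<bar> \<le> (1 - lam) * ?d a"
      by (rule local_val_contraction[OF g a(1) lam max])
    moreover have "\<bar>game_val (local_game \<Gamma> lam (?v mu) a) - game_val (local_game \<Gamma> mu (?v mu) a)\<bar> \<le> 2 * c * \<bar>lam - mu\<bar>"
      using key[of a "?v mu" lam mu] key[of a "?v mu" mu lam] a(1) vc[OF mu] by (auto simp: abs_le_iff abs_minus_commute)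
    ultimately have "?d a \<le> (1 - lam) * ?d a + 2 * c * \<bar>lam - mu\<bar>"
      using discounted_value_fixed_point[OF g lam a(1)] discounted_value_fixed_point[OF g mu a(1)] by linarith
    then have "lam * ?d a \<le> 2 * c * \<bar>lam - mu\<bar>" by (simp add: algebra_simps)
    moreover have "lam * ?d k \<le> lam * ?d a" using max[OF k] lam by (intro mult_left_mono) auto
    ultimately show ?thesis by simp
  qed
  then show ?thesis using c(1) by (intro that[of "2 * c"]) auto
qed

lemma continuous_on_discounted_value:
  assumes g: "stochastic_game \<Gamma>" and k: "k \<in> {1..n_states \<Gamma>}"
  shows "continuous_on {0<..1} (\<lambda>lam. discounted_value \<Gamma> lam k)"
  unfolding continuous_on_def
proof
  fix lam :: real assume lam: "lam \<in> {0<..1}"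
  obtain c where c: "0 \<le> c" "\<And>lam mu k. lam \<in> {0<..1} \<Longrightarrow> mu \<in> {0<..1} \<Longrightarrow> k \<in> {1..n_states \<Gamma>} \<Longrightarrow>
    lam * \<bar>discounted_value \<Gamma> lam k - discounted_value \<Gamma> mu k\<bar> \<le> c * \<bar>lam - mu\<bar>"
    using discounted_value_lipschitz[OF g] by blast
  have lim: "((\<lambda>mu. c / lam * \<bar>lam - mu\<bar>) \<longlongrightarrow> 0) (at lam within {0<..1})"
    by (rule tendsto_eq_intros refl | simp)+
  have "((\<lambda>mu. discounted_value \<Gamma> mu k - discounted_value \<Gamma> lam k) \<longlongrightarrow> 0) (at lam within {0<..1})"
  proof (rule Lim_null_comparison[OF _ lim])
    show "\<forall>\<^sub>F mu in at lam within {0<..1}. norm (discounted_value \<Gamma> mu k - discounted_value \<Gamma> lam k) \<le> c / lam * \<bar>lam - mu\<bar>"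
      unfolding eventually_at_filter
      using c(2)[OF lam _ k] lam
      by (intro always_eventually allI impI) (simp add: field_simps abs_minus_commute)
  qed
  then show "((\<lambda>lam. discounted_value \<Gamma> lam k) \<longlongrightarrow> discounted_value \<Gamma> lam k) (at lam within {0<..1})"
    by (simp add: LIM_zero_iff)
qed

section \<open>Kronecker products in mixed radix\<close>

text \<open>A row index of a Kronecker product is a number whose digits, in the mixed radix given by the
  dimensions of the factors, are row indices of the factors.\<close>

fun digits :: "nat list \<Rightarrow> nat \<Rightarrow> nat list" where
  "digits [] I = []"
| "digits (d # ds) I = I div prod_list ds # digits ds (I mod prod_list ds)"

lemma digits_less: "I < prod_list ds \<Longrightarrow> k < length ds \<Longrightarrow> digits ds I ! k < ds ! k"
proof (induction ds arbitrary: I k)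
  case (Cons d ds)
  have pos: "0 < prod_list ds" using Cons.prems(1) by (cases "prod_list ds") auto
  show ?case
  proof (cases k)
    case 0
    then show ?thesis using Cons.prems(1) by (simp add: less_mult_imp_div_less)
  next
    case (Suc m)
    then show ?thesis using Cons.IH[of "I mod prod_list ds" m] Cons.prems pos by simp
  qed
qed simp

lemma digits_surj:
  assumes "\<And>k. k < length ds \<Longrightarrow> a k < ds ! k"
  shows "\<exists>I<prod_list ds. \<forall>k<length ds. digits ds I ! k = a k"
  using assms
proof (induction ds arbitrary: a)
  case (Cons d ds)
  have "\<exists>I<prod_list ds. \<forall>k<length ds. digits ds I ! k = a (Suc k)"
    using Cons.prems by (intro Cons.IH) force
  then obtain I where I: "I < prod_list ds" "\<And>k. k < length ds \<Longrightarrow> digits ds I ! k = a (Suc k)" by blast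
  have a0: "a 0 < d" using Cons.prems[of 0] by simp
  let ?J = "a 0 * prod_list ds + I"
  have "?J < Suc (a 0) * prod_list ds" using I(1) by simp
  also have "\<dots> \<le> d * prod_list ds" using a0 by (intro mult_right_mono) auto
  finally have "?J < prod_list (d # ds)" by simp
  moreover have "?J div prod_list ds = a 0" using I(1) by (intro div_nat_eqI) auto
  then have "digits (d # ds) ?J ! k = a k" if "k < length (d # ds)" for k
    using that I by (cases k) auto
  ultimately show ?case by blast
qed simp

lemma sum_digits:
  fixes f :: "nat \<Rightarrow> nat \<Rightarrow> 'a::comm_semiring_1"
  shows "(\<Sum>I<prod_list ds. \<Prod>k<length ds. f k (digits ds I ! k)) = (\<Prod>k<length ds. \<Sum>i<ds ! k. f k i)"
proof (induction ds arbitrary: f)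
  case (Cons d ds)
  let ?D = "prod_list ds"
  have "(\<Sum>I<prod_list (d # ds). \<Prod>k<length (d # ds). f k (digits (d # ds) I ! k)) =
      (\<Sum>I<d * ?D. f 0 (I div ?D) * (\<Prod>k<length ds. f (Suc k) (digits ds (I mod ?D) ! k)))"
    by (simp add: prod.lessThan_Suc_shift del: prod.lessThan_Suc)
  also have "\<dots> = (\<Sum>a<d. \<Sum>I = a * ?D..<a * ?D + ?D. f 0 (I div ?D) * (\<Prod>k<length ds. f (Suc k) (digits ds (I mod ?D) ! k)))"
    by (rule sum.nat_group[symmetric])
  also have "\<dots> = (\<Sum>a<d. \<Sum>I<?D. f 0 a * (\<Prod>k<length ds. f (Suc k) (digits ds I ! k)))"
  proof (rule sum.cong[OF refl])
    fix a
    have div: "(a * ?D + I) div ?D = a" if "I < ?D" for I using that by (intro div_nat_eqI) auto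
    show "(\<Sum>I = a * ?D..<a * ?D + ?D. f 0 (I div ?D) * (\<Prod>k<length ds. f (Suc k) (digits ds (I mod ?D) ! k)))
      = (\<Sum>I<?D. f 0 a * (\<Prod>k<length ds. f (Suc k) (digits ds I ! k)))"
      by (rule sum.reindex_bij_witness[where i = "\<lambda>I. a * ?D + I" and j = "\<lambda>I. I - a * ?D"])
        (auto simp: div dest!: le_Suc_ex)
  qed
  also have "\<dots> = (\<Sum>a<d. f 0 a) * (\<Sum>I<?D. \<Prod>k<length ds. f (Suc k) (digits ds I ! k))"
    by (simp add: sum_product)
  also have "\<dots> = (\<Prod>k<length (d # ds). \<Sum>i<(d # ds) ! k. f k i)"
    using Cons.IH[of "\<lambda>k. f (Suc k)"] by (simp add: prod.lessThan_Suc_shift del: prod.lessThan_Suc)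
  finally show ?case .
qed simp

lemma kronecker_list_dim:
  "dim_row (kronecker_list As) = prod_list (map dim_row As)"
  "dim_col (kronecker_list As) = prod_list (map dim_col As)"
  by (induction As) (auto simp: kronecker_list_def kronecker_def)

lemma kronecker_list_index:
  "I < prod_list (map dim_row As) \<Longrightarrow> J < prod_list (map dim_col As) \<Longrightarrow>
    kronecker_list As $$ (I, J) =
      (\<Prod>k<length As. (As ! k) $$ (digits (map dim_row As) I ! k, digits (map dim_col As) J ! k))"
proof (induction As arbitrary: I J)
  case Nil
  then show ?case by (simp add: kronecker_list_def)
next
  case (Cons A As)
  have pos: "0 < prod_list (map dim_row As)" "0 < prod_list (map dim_col As)"
    using Cons.prems by (auto intro!: Nat.gr0I)
  have "kronecker_list (A # As) $$ (I, J) = A $$ (I div prod_list (map dim_row As), J div prod_list (map dim_col As)) *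
      kronecker_list As $$ (I mod prod_list (map dim_row As), J mod prod_list (map dim_col As))"
  proof -
    have "kronecker_list (A # As) = kronecker A (kronecker_list As)" by (simp add: kronecker_list_def)
    then show ?thesis using Cons.prems by (simp add: kronecker_def kronecker_list_dim)
  qed
  then show ?case
    using Cons.IH[of "I mod prod_list (map dim_row As)" "J mod prod_list (map dim_col As)"] pos
    by (simp add: prod.lessThan_Suc_shift del: prod.lessThan_Suc)
qed

section \<open>The auxiliary matrices as maximal minors\<close>

text \<open>The deleted column is skipped by the renumbering of \<open>delete_column\<close>, so these are the entries of the
  auxiliary matrices of an array of \<open>1 \<times> 1\<close> matrices.\<close>

definition signed_minor :: "nat \<Rightarrow> (nat \<Rightarrow> nat \<Rightarrow> 'a::comm_ring_1) \<Rightarrow> nat \<Rightarrow> 'a" where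
  "signed_minor n c l = (- 1) ^ l * (\<Sum>p | p permutes {1..n}. of_int (sign p) *
     (\<Prod>k = 1..n. c k (if p k \<le> l then p k - 1 else p k)))"

lemma signed_minor_cong:
  assumes "\<And>k m. k \<in> {1..n} \<Longrightarrow> m \<le> n \<Longrightarrow> c k m = c' k m" "l \<le> n"
  shows "signed_minor n c l = signed_minor n c' l"
  unfolding signed_minor_def
proof (intro arg_cong[where f = "(*) _"] sum.cong prod.cong refl)
  fix p k assume p: "p \<in> {p. p permutes {1..n}}" and k: "k \<in> {1..n}"
  with p have "p k \<in> {1..n}" using permutes_in_image[of p "{1..n}" k] by blast
  then show "c k (if p k \<le> l then p k - 1 else p k) = c' k (if p k \<le> l then p k - 1 else p k)"
    using k by (intro assms) auto
qed

text \<open>The permutations of \<open>{1..n}\<close> are those of \<open>{0..n}\<close> that fix 0, and bordering with a unit row selects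
  these.\<close>

lemma leibniz_shift:
  fixes B :: "nat \<Rightarrow> nat \<Rightarrow> 'a::comm_ring_1"
  shows "(\<Sum>p | p permutes {1..n}. of_int (sign p) * (\<Prod>k = 1..n. B k (p k))) =
    det (mat n n (\<lambda>(a, b). B (Suc a) (Suc b)))"
proof -
  define K where "K = mat (Suc n) (Suc n) (\<lambda>(a, b). if a = 0 then (if b = 0 then 1 else 0) else B a b)"
  have K: "K \<in> carrier_mat (Suc n) (Suc n)" by (simp add: K_def)
  have "det K = (\<Sum>p\<in>{p. p permutes {0..<Suc n}}. of_int (sign p) * (\<Prod>i = 0..<Suc n. K $$ (i, p i)))"
    using det_def'[OF K] by (simp add: sign_def)
  also have "\<dots> = (\<Sum>p | p permutes {1..n}. of_int (sign p) * (\<Prod>k = 1..n. B k (p k)))"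
  proof (rule sum.mono_neutral_cong_right)
    show "{p. p permutes {1..n}} \<subseteq> {p. p permutes {0..<Suc n}}"
    proof clarify
      fix p assume "p permutes {1..n}"
      moreover have "{1..n} \<subseteq> {0..<Suc n}" by auto
      ultimately show "p permutes {0..<Suc n}" by (rule permutes_subset)
    qed
    show "\<forall>p\<in>{p. p permutes {0..<Suc n}} - {p. p permutes {1..n}}.
      of_int (sign p) * (\<Prod>i = 0..<Suc n. K $$ (i, p i)) = 0"
    proof
      fix p assume p: "p \<in> {p. p permutes {0..<Suc n}} - {p. p permutes {1..n}}"
      have "p 0 \<noteq> 0"
      proof
        assume "p 0 = 0"
        have "p permutes {1..n}"
        proof (rule permutes_superset)
          show "p permutes {0..<Suc n}" using p by blast
          fix x assume "x \<in> {0..<Suc n} - {1..n}"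
          then have "x = 0" by auto
          then show "p x = x" using \<open>p 0 = 0\<close> by simp
        qed
        then show False using p by simp
      qed
      moreover have "p 0 < Suc n" using p permutes_in_image[of p "{0..<Suc n}" 0] by simp
      ultimately have "K $$ (0, p 0) = 0" by (simp add: K_def)
      then have "(\<Prod>i = 0..<Suc n. K $$ (i, p i)) = 0" by (intro prod_zero bexI[of _ 0]) auto
      then show "of_int (sign p) * (\<Prod>i = 0..<Suc n. K $$ (i, p i)) = 0" by simp
    qed
    fix p assume p: "p \<in> {p. p permutes {1..n}}"
    have "{0..<Suc n} = insert 0 {1..n}" by auto
    then have "(\<Prod>i = 0..<Suc n. K $$ (i, p i)) = K $$ (0, p 0) * (\<Prod>i = 1..n. K $$ (i, p i))"
      by simp
    also have "p 0 = 0" using permutes_not_in[of p "{1..n}" 0] p by simp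
    also have "(\<Prod>i = 1..n. K $$ (i, p i)) = (\<Prod>i = 1..n. B i (p i))"
    proof (rule prod.cong[OF refl])
      fix i assume i: "i \<in> {1..n}"
      then have "p i \<in> {1..n}" using p permutes_in_image[of p "{1..n}" i] by blast
      then show "K $$ (i, p i) = B i (p i)" using i by (simp add: K_def)
    qed
    finally show "of_int (sign p) * (\<Prod>i = 0..<Suc n. K $$ (i, p i)) = of_int (sign p) * (\<Prod>k = 1..n. B k (p k))"
      by (simp add: K_def)
  qed (simp add: finite_permutations)
  finally have 1: "det K = \<dots>" .
  have "det K = (\<Sum>j<Suc n. K $$ (0, j) * cofactor K 0 j)"
    by (rule laplace_expansion_row[OF K]) simp
  also have "\<dots> = (\<Sum>j<Suc n. if j = 0 then cofactor K 0 0 else 0)"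
    by (intro sum.cong) (auto simp: K_def)
  also have "\<dots> = det (mat_delete K 0 0)" by (simp add: cofactor_def sum.lessThan_Suc_shift del: sum.lessThan_Suc)
  also have "mat_delete K 0 0 = mat n n (\<lambda>(a, b). B (Suc a) (Suc b))"
    by (rule eq_matI) (auto simp: mat_delete_def K_def)
  finally show ?thesis using 1 by simp
qed

text \<open>The signs make the maximal minors the coefficients of a determinant in its row of index 0;
  this contains Cramer's rule for an underdetermined system.\<close>

lemma signed_minor_expansion:
  "(\<Sum>l\<le>n. e l * signed_minor n c l) = det (mat (Suc n) (Suc n) (\<lambda>(a, b). if a = 0 then e b else c a b))"
  (is "_ = det ?H")
proof -
  have H: "?H \<in> carrier_mat (Suc n) (Suc n)" by simp
  have "signed_minor n c l = cofactor ?H 0 l" if "l \<le> n" for l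
  proof -
    have "mat_delete ?H 0 l = mat n n (\<lambda>(a, b). (\<lambda>k m. c k (if m \<le> l then m - 1 else m)) (Suc a) (Suc b))"
      using that by (intro eq_matI) (auto simp: mat_delete_def)
    then show ?thesis
      unfolding signed_minor_def cofactor_def
      using leibniz_shift[where n = n and B = "\<lambda>k m. c k (if m \<le> l then m - 1 else m)"] by simp
  qed
  then show ?thesis
    using laplace_expansion_row[OF H, of 0] by (simp add: lessThan_Suc_atMost)
qed

lemma signed_minor_kernel:
  fixes c :: "nat \<Rightarrow> nat \<Rightarrow> 'a::idom"
  assumes rows: "\<And>k. k \<in> {1..n} \<Longrightarrow> (\<Sum>l\<le>n. c k l * z l) = 0"
    and z: "z 0 = 1" and e: "(\<Sum>l\<le>n. e l * z l) = 0"
  shows "(\<Sum>l\<le>n. e l * signed_minor n c l) = 0"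
proof -
  let ?H = "mat (Suc n) (Suc n) (\<lambda>(a, b). if a = 0 then e b else c a b)"
  have H: "?H \<in> carrier_mat (Suc n) (Suc n)" by simp
  have zv: "vec (Suc n) z \<in> carrier_vec (Suc n)" "vec (Suc n) z \<noteq> 0\<^sub>v (Suc n)"
    using z by (auto simp: vec_eq_iff intro!: exI[of _ 0] dest: arg_cong[where f = "\<lambda>v. v $ 0"])
  have "?H *\<^sub>v vec (Suc n) z = 0\<^sub>v (Suc n)"
  proof (rule eq_vecI)
    fix a assume a: "a < dim_vec (0\<^sub>v (Suc n) :: 'a vec)"
    have "(?H *\<^sub>v vec (Suc n) z) $ a = (\<Sum>l\<le>n. (if a = 0 then e l else c a l) * z l)"
      using a by (auto simp: scalar_prod_def atLeast0LessThan lessThan_Suc_atMost intro!: sum.cong)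
    also have "\<dots> = 0" using rows[of a] e a by (cases "a = 0") auto
    finally show "(?H *\<^sub>v vec (Suc n) z) $ a = 0\<^sub>v (Suc n) $ a" using a by simp
  qed simp
  then have "det ?H = 0" using det_0_iff_vec_prod_zero[OF H] zv by blast
  then show ?thesis by (simp add: signed_minor_expansion)
qed

lemma signed_minor_0:
  "signed_minor n c 0 = det (mat n n (\<lambda>(a, b). c (Suc a) (Suc b)))"
proof -
  have "signed_minor n c 0 = (\<Sum>p | p permutes {1..n}. of_int (sign p) * (\<Prod>k = 1..n. c k (p k)))"
    unfolding signed_minor_def
  proof (simp only: power_0 mult_1, intro sum.cong prod.cong refl arg_cong2[where f = "(*)"])
    fix p k assume p: "p \<in> {p. p permutes {1..n}}" and k: "k \<in> {1..n}"
    then have "p k \<in> {1..n}" using permutes_in_image[of p "{1..n}" k] by blast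
    then show "c k (if p k \<le> 0 then p k - 1 else p k) = c k (p k)" by simp
  qed
  then show ?thesis unfolding leibniz_shift .
qed

text \<open>Multilinearity in the rows: summing over all digits sums every row separately.\<close>

lemma sum_signed_minor:
  fixes h :: "nat \<Rightarrow> nat \<Rightarrow> nat \<Rightarrow> 'a::comm_ring_1"
  shows "(\<Sum>I<prod_list (map d [1..<Suc n]). signed_minor n (\<lambda>k m. h k m (digits (map d [1..<Suc n]) I ! (k - 1))) l) =
    signed_minor n (\<lambda>k m. \<Sum>i<d k. h k m i) l"
proof -
  let ?ds = "map d [1..<Suc n]"
  have shift: "(\<Prod>k = 1..n. g k) = (\<Prod>k<n. g (Suc k))" for g :: "nat \<Rightarrow> 'a"
    by (rule prod.reindex_bij_witness[where i = Suc and j = "\<lambda>k. k - 1"]) auto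
  have *: "(\<Sum>I<prod_list ?ds. \<Prod>k = 1..n. g k (digits ?ds I ! (k - 1))) = (\<Prod>k = 1..n. \<Sum>i<d k. g k i)"
    for g :: "nat \<Rightarrow> nat \<Rightarrow> 'a"
  proof -
    have "(\<Sum>I<prod_list ?ds. \<Prod>k<length ?ds. g (Suc k) (digits ?ds I ! k)) = (\<Prod>k<length ?ds. \<Sum>i<?ds ! k. g (Suc k) i)"
      by (rule sum_digits)
    then show ?thesis unfolding shift by (simp del: upt_Suc)
  qed
  have "(\<Sum>I<prod_list ?ds. signed_minor n (\<lambda>k m. h k m (digits ?ds I ! (k - 1))) l) =
    (- 1) ^ l * (\<Sum>p | p permutes {1..n}. of_int (sign p) * (\<Sum>I<prod_list ?ds. \<Prod>k = 1..n.
       h k (if p k \<le> l then p k - 1 else p k) (digits ?ds I ! (k - 1))))"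
    unfolding signed_minor_def sum_distrib_left by (rule sum.swap)
  also have "\<dots> = signed_minor n (\<lambda>k m. \<Sum>i<d k. h k m i) l"
    unfolding signed_minor_def using *[of "\<lambda>k. h k (if p k \<le> l then p k - 1 else p k)" for p] by simp
  finally show ?thesis .
qed

lemma signed_minor_scale:
  "signed_minor n c l * (\<Prod>k = 1..n. s k) = signed_minor n (\<lambda>k m. c k m * s k) l"
  unfolding signed_minor_def by (simp add: prod.distrib sum_distrib_right mult.assoc)

context
  fixes A :: "nat \<Rightarrow> nat \<Rightarrow> 'a::comm_ring_1 mat" and n :: nat and r s :: "nat \<Rightarrow> nat"
  assumes n: "1 \<le> n" and dims: "\<And>k l. k \<in> {1..n} \<Longrightarrow> l \<le> n \<Longrightarrow> A k l \<in> carrier_mat (r k) (s k)"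
begin

lemma prod_dims: "(\<Prod>k = 1..n. d k) = prod_list (map d [1..<Suc n])" for d :: "nat \<Rightarrow> nat"
  using prod.distinct_set_conv_list[of "[1..<Suc n]" d] by (simp add: atLeastLessThanSuc_atLeastAtMost del: upt_Suc)

lemma aux_mat_carrier:
  assumes "l \<le> n"
  shows "aux_mat n A l \<in> carrier_mat (prod_list (map r [1..<Suc n])) (prod_list (map s [1..<Suc n]))"
proof -
  have *: "delete_column l A k 1 \<in> carrier_mat (r k) (s k)" if "k \<in> {1..n}" for k
    unfolding delete_column_def using that n by (intro dims) auto
  have "(\<Prod>k = 1..n. dim_row (delete_column l A k 1)) = (\<Prod>k = 1..n. r k)"
    "(\<Prod>k = 1..n. dim_col (delete_column l A k 1)) = (\<Prod>k = 1..n. s k)"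
    using *[THEN carrier_matD(1)] *[THEN carrier_matD(2)] by (auto intro!: prod.cong simp del: One_nat_def)
  then show ?thesis unfolding prod_dims[symmetric] by (simp add: aux_mat_def kronecker_det_def)
qed

text \<open>Each entry of a Kronecker product is a product of one entry from each factor, at the digits of its
  indices, so the Kronecker determinant is a determinant entry by entry.\<close>

lemma aux_mat_index:
  assumes l: "l \<le> n" and I: "I < prod_list (map r [1..<Suc n])" and J: "J < prod_list (map s [1..<Suc n])"
  shows "aux_mat n A l $$ (I, J) = signed_minor n (\<lambda>k m. A k m $$
    (digits (map r [1..<Suc n]) I ! (k - 1), digits (map s [1..<Suc n]) J ! (k - 1))) l"
proof -
  let ?N = "[1..<Suc n]"
  have *: "delete_column l A k 1 \<in> carrier_mat (r k) (s k)" if "k \<in> {1..n}" for k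
    unfolding delete_column_def using that n by (intro dims) auto
  have pd: "(\<Prod>k = 1..n. dim_row (delete_column l A k 1)) = prod_list (map r ?N)"
    "(\<Prod>k = 1..n. dim_col (delete_column l A k 1)) = prod_list (map s ?N)"
    unfolding prod_dims[symmetric] using *[THEN carrier_matD(1)] *[THEN carrier_matD(2)] by (auto intro!: prod.cong simp del: One_nat_def)
  have shift: "(\<Prod>k = 1..n. g k) = (\<Prod>k<n. g (Suc k))" for g :: "nat \<Rightarrow> 'a"
    by (rule prod.reindex_bij_witness[where i = Suc and j = "\<lambda>k. k - 1"]) auto
  have "kronecker_list (map (\<lambda>k. delete_column l A k (p k)) ?N) $$ (I, J) =
    (\<Prod>k = 1..n. A k (if p k \<le> l then p k - 1 else p k) $$
      (digits (map r ?N) I ! (k - 1), digits (map s ?N) J ! (k - 1)))" if p: "p permutes {1..n}" for p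
  proof -
    let ?As = "map (\<lambda>k. delete_column l A k (p k)) ?N"
    have c: "delete_column l A k (p k) \<in> carrier_mat (r k) (s k)" if k: "k \<in> {1..n}" for k
    proof -
      have "p k \<in> {1..n}" using p k permutes_in_image[of p "{1..n}" k] by blast
      then show ?thesis unfolding delete_column_def using k by (intro dims) auto
    qed
    have d: "dim_row (delete_column l A k (p k)) = r k" "dim_col (delete_column l A k (p k)) = s k"
      if "k \<in> set ?N" for k
    proof -
      have "k \<in> {1..n}" using that by auto
      from c[OF this] show "dim_row (delete_column l A k (p k)) = r k" "dim_col (delete_column l A k (p k)) = s k"
        by auto
    qed
    have dr: "map dim_row ?As = map r ?N" and dc: "map dim_col ?As = map s ?N"
      unfolding map_map by (rule map_cong[OF refl], simp only: o_apply d)+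
    note kronecker_list_index[of I ?As J, unfolded dr dc, OF I J]
    then show ?thesis unfolding shift by (simp add: delete_column_def del: upt_Suc cong: if_cong)
  qed
  then have "(\<Sum>p | p permutes {1..n}. of_int (sign p) * kronecker_list (map (\<lambda>k. delete_column l A k (p k)) ?N) $$ (I, J)) =
    (\<Sum>p | p permutes {1..n}. of_int (sign p) * (\<Prod>k = 1..n. A k (if p k \<le> l then p k - 1 else p k) $$
      (digits (map r ?N) I ! (k - 1), digits (map s ?N) J ! (k - 1))))"
    by (intro sum.cong) auto
  then show ?thesis
    using I J unfolding aux_mat_def kronecker_det_def pd signed_minor_def by (simp del: upt_Suc)
qed

end

section \<open>Minors\<close>

text \<open>Index functions in place of index sets: reduced matrices sit in the full ones along index maps that need
  not be increasing.\<close>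

definition fminor :: "'a::comm_ring_1 mat \<Rightarrow> (nat \<Rightarrow> nat) \<Rightarrow> (nat \<Rightarrow> nat) \<Rightarrow> nat \<Rightarrow> 'a" where
  "fminor X f g s = det (mat s s (\<lambda>(a, b). X $$ (f a, g b)))"

lemma fminor_inj:
  assumes "fminor X f g s \<noteq> 0"
  shows "inj_on f {..<s}" "inj_on g {..<s}"
proof -
  let ?M = "mat s s (\<lambda>(a, b). X $$ (f a, g b))"
  have M: "?M \<in> carrier_mat s s" by simp
  show "inj_on f {..<s}"
  proof (rule inj_onI, rule ccontr)
    fix a b assume ab: "a \<in> {..<s}" "b \<in> {..<s}" "f a = f b" "a \<noteq> b"
    then have "row ?M a = row ?M b" by (auto simp: row_def)
    then have "det ?M = 0" using det_identical_rows[OF M, of a b] ab by auto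
    then show False using assms by (simp add: fminor_def)
  qed
  show "inj_on g {..<s}"
  proof (rule inj_onI, rule ccontr)
    fix a b assume ab: "a \<in> {..<s}" "b \<in> {..<s}" "g a = g b" "a \<noteq> b"
    then have "col ?M a = col ?M b" by (auto simp: col_def)
    then have "det ?M = 0" using det_identical_columns[OF M, of a b] ab by auto
    then show False using assms by (simp add: fminor_def)
  qed
qed

lemma bij_betw_pick: "finite S \<Longrightarrow> bij_betw (pick S) {..<card S} S"
proof -
  assume fin: "finite S"
  have inj: "inj_on (pick S) {..<card S}"
    by (rule inj_onI) (metis lessThan_iff nat_neq_iff pick_mono_le)
  have sub: "pick S ` {..<card S} \<subseteq> S" using pick_in_set_le by blast
  have "pick S ` {..<card S} = S"
    by (rule card_subset_eq[OF fin sub]) (simp add: card_image[OF inj])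
  then show ?thesis using inj by (simp add: bij_betw_def)
qed

lemma enumeration_permutation:
  assumes inj: "inj_on f {..<s}"
  obtains p where "p permutes {0..<s}" "\<And>a. a < s \<Longrightarrow> f a = pick (f ` {..<s}) (p a)"
proof -
  let ?R = "f ` {..<s}"
  have card: "card ?R = s" using inj by (simp add: card_image)
  have pk: "bij_betw (pick ?R) {..<s} ?R" using bij_betw_pick[of ?R] card by simp
  define p where "p a = (if a < s then inv_into {..<s} (pick ?R) (f a) else a)" for a
  have "bij_betw (inv_into {..<s} (pick ?R) \<circ> f) {..<s} {..<s}"
    by (rule bij_betw_trans[OF _ bij_betw_inv_into[OF pk]]) (use inj in \<open>simp add: bij_betw_def\<close>)
  then have "bij_betw p {..<s} {..<s}"
    by (subst bij_betw_cong[of "{..<s}" p "inv_into {..<s} (pick ?R) \<circ> f"]) (auto simp: p_def)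
  then have "p permutes {..<s}" by (rule bij_imp_permutes) (simp add: p_def)
  moreover have "f a = pick ?R (p a)" if "a < s" for a
    using that f_inv_into_f[of "f a" "pick ?R" "{..<s}"] pk by (simp add: p_def bij_betw_def)
  ultimately show ?thesis using that by (simp add: lessThan_atLeast0)
qed

text \<open>Up to the sign of a permutation, a nonzero determinant of entries chosen by two index functions
  is a minor: the functions are injective, and sorting them permutes rows and columns.\<close>

lemma fminor_in_minors:
  assumes nz: "fminor X f g s \<noteq> 0" and s: "0 < s"
    and f: "\<And>a. a < s \<Longrightarrow> f a < dim_row X" and g: "\<And>a. a < s \<Longrightarrow> g a < dim_col X"
  obtains e R C where "e = 1 \<or> e = -1" "R \<noteq> {}" "R \<subseteq> {..<dim_row X}" "C \<subseteq> {..<dim_col X}" "card R = s" "card C = s"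
    "fminor X f g s = e * det (submatrix X R C)"
proof -
  define R C where RC: "R = f ` {..<s}" "C = g ` {..<s}"
  note inj = fminor_inj[OF nz]
  obtain p where p: "p permutes {0..<s}" "\<And>a. a < s \<Longrightarrow> f a = pick R (p a)"
    using enumeration_permutation[OF inj(1)] unfolding RC by blast
  obtain q where q: "q permutes {0..<s}" "\<And>a. a < s \<Longrightarrow> g a = pick C (q a)"
    using enumeration_permutation[OF inj(2)] unfolding RC by blast
  have card: "card R = s" "card C = s" using inj by (simp_all add: card_image RC)
  have sets: "{i. i < dim_row X \<and> i \<in> R} = R" "{i. i < dim_col X \<and> i \<in> C} = C" using f g by (auto simp: RC)
  let ?S = "submatrix X R C"
  have S: "?S = mat s s (\<lambda>(a, b). X $$ (pick R a, pick C b))"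
    unfolding submatrix_def sets card ..
  have Sc: "?S \<in> carrier_mat s s" by (simp add: S)
  have lt: "p a < s" "q a < s" if "a < s" for a
    using permutes_in_image[OF p(1), of a] permutes_in_image[OF q(1), of a] that by auto
  define T where "T = mat s s (\<lambda>(a, b). ?S $$ (p a, b))"
  have T: "T \<in> carrier_mat s s" by (simp add: T_def)
  have dT: "det T = of_int (sign p) * det ?S" unfolding T_def by (rule det_permute_rows[OF Sc p(1)])
  have "mat s s (\<lambda>(a, b). X $$ (f a, g b)) = transpose_mat (mat s s (\<lambda>(a, b). transpose_mat T $$ (q a, b)))"
    by (rule eq_matI) (use lt p(2) q(2) in \<open>auto simp: T_def S\<close>)
  then have "fminor X f g s = det (mat s s (\<lambda>(a, b). transpose_mat T $$ (q a, b)))"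
    unfolding fminor_def by (simp add: det_transpose[of _ s])
  also have "\<dots> = of_int (sign q) * det (transpose_mat T)"
    by (rule det_permute_rows[OF _ q(1)]) (use T in simp)
  also have "\<dots> = of_int (sign q) * (of_int (sign p) * det ?S)" by (simp add: det_transpose[OF T] dT)
  finally have "fminor X f g s = of_int (sign q * sign p) * det ?S" by (simp add: mult.assoc)
  moreover have "of_int (sign q * sign p) = (1::'a) \<or> of_int (sign q * sign p) = (- 1::'a)"
    by (auto simp: sign_def)
  moreover have "R \<noteq> {}" "R \<subseteq> {..<dim_row X}" "C \<subseteq> {..<dim_col X}"
    using s f g by (auto simp: RC)
  ultimately show ?thesis using card by (intro that[of "of_int (sign q * sign p)" R C])
qed

text \<open>Clearing the border row with the adjugate of the block leaves the Schur complement, multiplied by the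
  minor, in the corner.\<close>

lemma bordered_minor:
  fixes X :: "'a::idom mat"
  assumes nz: "fminor X S T s \<noteq> 0"
    and max: "fminor X (S(s := i)) (T(s := j)) (Suc s) = 0"
  shows "fminor X S T s * X $$ (i, j) = (\<Sum>b<s. (\<Sum>a<s. X $$ (i, T a) *
    adj_mat (mat s s (\<lambda>(a, b). X $$ (S a, T b))) $$ (a, b)) * X $$ (S b, j))"
proof -
  define A where "A = mat s s (\<lambda>(a, b). X $$ (S a, T b))"
  define u where "u = mat s 1 (\<lambda>(a, b). X $$ (S a, j))"
  define w where "w = mat 1 s (\<lambda>(a, b). X $$ (i, T b))"
  define d where "d = mat 1 1 (\<lambda>(a, b). X $$ (i, j))"
  define m where "m = fminor X S T s"
  have cA: "A \<in> carrier_mat s s" and cu: "u \<in> carrier_mat s 1" and cw: "w \<in> carrier_mat 1 s"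
    and cd: "d \<in> carrier_mat 1 1" by (simp_all add: A_def u_def w_def d_def)
  have m: "m = det A" by (simp add: m_def fminor_def A_def)
  have cadj: "adj_mat A \<in> carrier_mat s s" by (rule adj_mat(1)[OF cA])
  have "mat (Suc s) (Suc s) (\<lambda>(a, b). X $$ ((S(s := i)) a, (T(s := j)) b)) = four_block_mat A u w d"
    by (rule eq_matI) (auto simp: A_def u_def w_def d_def less_Suc_eq)
  then have 0: "det (four_block_mat A u w d) = 0" using max by (simp add: fminor_def)
  let ?L = "four_block_mat (1\<^sub>m s) (0\<^sub>m s 1) (- (w * adj_mat A)) (m \<cdot>\<^sub>m 1\<^sub>m 1)"
  let ?r = "- (w * adj_mat A) * u + m \<cdot>\<^sub>m 1\<^sub>m 1 * d"
  have cwa: "w * adj_mat A \<in> carrier_mat 1 s" using cw cadj by simp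
  have cancel: "- (w * adj_mat A) * A + m \<cdot>\<^sub>m 1\<^sub>m 1 * w = 0\<^sub>m 1 s"
  proof -
    have "(w * adj_mat A) * A = w * (adj_mat A * A)" using cw cadj cA by (rule assoc_mult_mat)
    also have "\<dots> = m \<cdot>\<^sub>m w" by (simp only: adj_mat(3)[OF cA] m mult_smult_distrib[OF cw one_carrier_mat] right_mult_one_mat[OF cw])
    finally have "(w * adj_mat A) * A = m \<cdot>\<^sub>m w" .
    moreover have "dim_col (w * adj_mat A) = dim_row A" using cadj cA by auto
    ultimately have "- (w * adj_mat A) * A = - (m \<cdot>\<^sub>m w)" using uminus_mult_left_mat by metis
    moreover have "m \<cdot>\<^sub>m 1\<^sub>m 1 * w = m \<cdot>\<^sub>m w"
      by (simp only: mult_smult_assoc_mat[OF one_carrier_mat cw] left_mult_one_mat[OF cw])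
    ultimately show ?thesis using cw by auto
  qed
  have "?L * four_block_mat A u w d = four_block_mat (1\<^sub>m s * A + 0\<^sub>m s 1 * w) (1\<^sub>m s * u + 0\<^sub>m s 1 * d)
      (- (w * adj_mat A) * A + m \<cdot>\<^sub>m 1\<^sub>m 1 * w) ?r"
    by (rule mult_four_block_mat[of _ s s _ 1 _ 1]) (use cA cu cw cd cwa in auto)
  also have "\<dots> = four_block_mat A u (0\<^sub>m 1 s) ?r" unfolding cancel using cA cu cw cd by simp
  finally have "det ?L * det (four_block_mat A u w d) = det (four_block_mat A u (0\<^sub>m 1 s) ?r)"
    by (subst det_mult[of _ "s + 1", symmetric]) (use cA cd in auto)
  also have "\<dots> = det A * det ?r"
    by (rule det_four_block_mat_lower_left_zero[OF cA cu refl]) (use cwa cu cd in auto)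
  finally have "det ?r = 0" using 0 nz m m_def by simp
  moreover have "?r \<in> carrier_mat 1 1" using cwa cu cd by auto
  ultimately have "?r $$ (0, 0) = 0" using det_single[of ?r] by simp
  moreover have "?r $$ (0, 0) = - ((w * adj_mat A) * u) $$ (0, 0) + m * X $$ (i, j)"
  proof -
    have "dim_col (w * adj_mat A) = dim_row u" using cadj cu by auto
    then have "- (w * adj_mat A) * u = - ((w * adj_mat A) * u)" by (rule uminus_mult_left_mat)
    moreover have "(- M) $$ (0, 0) = - M $$ (0, 0)" if "M \<in> carrier_mat 1 1" for M :: "'a mat"
      using that by simp
    moreover have "(w * adj_mat A) * u \<in> carrier_mat 1 1" using cwa cu by (rule mult_carrier_mat)
    ultimately have "(- (w * adj_mat A) * u) $$ (0, 0) = - ((w * adj_mat A) * u) $$ (0, 0)"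
      by presburger
    then show ?thesis using cwa cu cd by (simp add: d_def)
  qed
  ultimately have "m * X $$ (i, j) = ((w * adj_mat A) * u) $$ (0, 0)" by simp
  also have "\<dots> = (\<Sum>b<s. (\<Sum>a<s. X $$ (i, T a) * adj_mat A $$ (a, b)) * X $$ (S b, j))"
    using cw cadj cu by (auto simp: scalar_prod_def lessThan_atLeast0 w_def u_def intro!: sum.cong)
  finally show ?thesis by (simp add: m_def A_def)
qed

lemma fminor_0: "fminor X f g 0 = 1"
  unfolding fminor_def by (rule det_dim_zero) simp

text \<open>A nonzero minor of maximal size factors its multiple of the matrix through its rows and
  columns, since all bordering minors vanish.\<close>

lemma maximal_minor_factorization:
  fixes X :: "'a::idom mat"
  assumes X: "X \<in> carrier_mat N N'"
  shows "\<exists>s S T adj. (\<forall>a<s. S a < N) \<and> (\<forall>a<s. T a < N') \<and> fminor X S T s \<noteq> 0 \<and>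
    (\<forall>i<N. \<forall>j<N'. fminor X S T s * X $$ (i, j) =
      (\<Sum>b<s. (\<Sum>a<s. X $$ (i, T a) * adj a b) * X $$ (S b, j)))"
proof -
  define P where "P s \<longleftrightarrow> (\<exists>S T. (\<forall>a<s. S a < N) \<and> (\<forall>a<s. T a < N') \<and> fminor X S T s \<noteq> 0)" for s
  have bound: "s \<le> N" if Ps: "P s" for s
  proof -
    obtain S T where ST: "\<forall>a<s. S a < N" "fminor X S T s \<noteq> 0" using Ps unfolding P_def by blast
    have "card {..<s} \<le> card {..<N}"
      by (rule card_inj_on_le[OF fminor_inj(1)[OF ST(2)]]) (use ST(1) in auto)
    then show ?thesis by simp
  qed
  have "P 0" by (simp add: P_def fminor_0)
  then obtain s where s: "P s" "\<And>t. P t \<Longrightarrow> t \<le> s"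
    using GreatestI_nat[of P 0 N] Greatest_le_nat[of P _ N] bound by metis
  obtain S T where ST: "\<forall>a<s. S a < N" "\<forall>a<s. T a < N'" "fminor X S T s \<noteq> 0"
    using s(1) unfolding P_def by blast
  have 0: "fminor X (S(s := i)) (T(s := j)) (Suc s) = 0" if "i < N" "j < N'" for i j
  proof (rule ccontr)
    assume "fminor X (S(s := i)) (T(s := j)) (Suc s) \<noteq> 0"
    then have "P (Suc s)"
      unfolding P_def using ST that by (intro exI[of _ "S(s := i)"] exI[of _ "T(s := j)"]) (auto simp: less_Suc_eq)
    then show False using s(2)[of "Suc s"] by simp
  qed
  define adj where "adj a b = adj_mat (mat s s (\<lambda>(a, b). X $$ (S a, T b))) $$ (a, b)" for a b
  have "\<forall>i<N. \<forall>j<N'. fminor X S T s * X $$ (i, j) =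
      (\<Sum>b<s. (\<Sum>a<s. X $$ (i, T a) * adj a b) * X $$ (S b, j))"
  proof (intro allI impI)
    fix i j assume "i < N" "j < N'"
    from bordered_minor[OF ST(3) 0[OF this]]
    show "fminor X S T s * X $$ (i, j) = (\<Sum>b<s. (\<Sum>a<s. X $$ (i, T a) * adj a b) * X $$ (S b, j))"
      unfolding adj_def .
  qed
  then show ?thesis using ST by blast
qed

lemma fminor_le_rank:
  assumes B: "B \<in> carrier_mat N N'" and nz: "fminor B S T s \<noteq> 0"
    and S: "\<And>a. a < s \<Longrightarrow> S a < N" and T: "\<And>a. a < s \<Longrightarrow> T a < N'"
  shows "s \<le> mat_rank B"
proof (cases "s = 0")
  case False
  obtain e R C where e: "R \<noteq> {}" "R \<subseteq> {..<N}" "C \<subseteq> {..<N'}" "card R = s" "card C = s"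
    "fminor B S T s = e * det (submatrix B R C)"
    using fminor_in_minors[OF nz, of thesis] False S T B by auto
  have "det (submatrix B R C) \<noteq> 0" using e(6) nz by auto
  then have "card {j. j < N' \<and> j \<in> C} \<le> vec_space.rank N B"
    by (rule vec_space.rank_gt_minor[OF B])
  moreover have "{j. j < N' \<and> j \<in> C} = C" using e by auto
  ultimately show ?thesis using e B by (auto simp: mat_rank_def)
qed simp

text \<open>Factor \<open>B\<close> through a maximal minor and border \<open>A - w B\<close> by the factors: then \<open>w\<close> occurs, to the first
  power, in at most as many columns as the rank of \<open>B\<close>.\<close>

lemma degree_pencil_minor:
  fixes B :: "real mat" and a :: "nat \<Rightarrow> nat \<Rightarrow> real"
  assumes B: "B \<in> carrier_mat N N'"
    and S: "\<And>a. a < s \<Longrightarrow> S a < N" and T: "\<And>a. a < s \<Longrightarrow> T a < N'"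
  shows "degree (det (mat s s (\<lambda>(i, j). [:a i j, - B $$ (S i, T j):]))) \<le> mat_rank B"
proof -
  obtain r P Q adj where r: "\<And>b. b < r \<Longrightarrow> P b < N" "\<And>b. b < r \<Longrightarrow> Q b < N'" "fminor B P Q r \<noteq> 0"
    "\<And>i j. i < N \<Longrightarrow> j < N' \<Longrightarrow> fminor B P Q r * B $$ (i, j) =
      (\<Sum>b<r. (\<Sum>a<r. B $$ (i, Q a) * adj a b) * B $$ (P b, j))"
    using maximal_minor_factorization[OF B] by blast
  define m where "m = fminor B P Q r"
  have rank: "r \<le> mat_rank B" by (rule fminor_le_rank[OF B r(3) r(1,2)])
  define U where "U i b = (\<Sum>a<r. B $$ (S i, Q a) * adj a b) / m" for i b
  have fac: "B $$ (S i, T j) = (\<Sum>b<r. U i b * B $$ (P b, T j))" if "i < s" "j < s" for i j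
  proof -
    have "B $$ (S i, T j) = (\<Sum>b<r. (\<Sum>a<r. B $$ (S i, Q a) * adj a b) * B $$ (P b, T j)) / m"
      using r(4)[OF S[OF that(1)] T[OF that(2)]] r(3) by (simp add: m_def field_simps)
    also have "\<dots> = (\<Sum>b<r. (\<Sum>a<r. B $$ (S i, Q a) * adj a b) * B $$ (P b, T j) / m)"
      by (rule sum_divide_distrib)
    finally show ?thesis by (simp add: U_def)
  qed
  define A' where "A' = mat s s (\<lambda>(i, j). [:a i j:])"
  define P' where "P' = mat s r (\<lambda>(i, b). [:0, U i b:])"
  define Q' where "Q' = mat r s (\<lambda>(b, j). [:B $$ (P b, T j):])"
  have c: "A' \<in> carrier_mat s s" "P' \<in> carrier_mat s r" "Q' \<in> carrier_mat r s"
    by (simp_all add: A'_def P'_def Q'_def)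
  let ?F = "four_block_mat A' P' Q' (1\<^sub>m r)" and ?G = "four_block_mat (1\<^sub>m s) (0\<^sub>m s r) (- Q') (1\<^sub>m r)"
  have F: "?F \<in> carrier_mat (s + r) (s + r)" and G: "?G \<in> carrier_mat (s + r) (s + r)" using c by auto
  \<comment> \<open>Eliminating the lower left block identifies the bordered determinant with that of \<open>A - w B\<close>.\<close>
  have "?F * ?G = four_block_mat (A' * 1\<^sub>m s + P' * (- Q')) (A' * 0\<^sub>m s r + P' * 1\<^sub>m r)
      (Q' * 1\<^sub>m s + 1\<^sub>m r * (- Q')) (Q' * 0\<^sub>m s r + 1\<^sub>m r * 1\<^sub>m r)"
    by (rule mult_four_block_mat[of _ s s _ r _ r]) (use c in auto)
  also have "\<dots> = four_block_mat (A' + P' * (- Q')) P' (0\<^sub>m r s) (1\<^sub>m r)"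
    using c by auto
  finally have "det ?F * det ?G = det (four_block_mat (A' + P' * (- Q')) P' (0\<^sub>m r s) (1\<^sub>m r))"
    by (subst det_mult[OF F G, symmetric]) simp
  also have "\<dots> = det (A' + P' * (- Q')) * det (1\<^sub>m r)"
    by (rule det_four_block_mat_lower_left_zero[OF _ c(2) refl]) (use c in auto)
  also have "det ?G = det (1\<^sub>m s) * det (1\<^sub>m r)"
    by (rule det_four_block_mat_upper_right_zero) (use c in auto)
  also have "A' + P' * (- Q') = mat s s (\<lambda>(i, j). [:a i j, - B $$ (S i, T j):])"
  proof (rule eq_matI)
    fix i j assume "i < dim_row (mat s s (\<lambda>(i, j). [:a i j, - B $$ (S i, T j):]))"
      "j < dim_col (mat s s (\<lambda>(i, j). [:a i j, - B $$ (S i, T j):]))"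
    then have ij: "i < s" "j < s" by auto
    have "(P' * (- Q')) $$ (i, j) = (\<Sum>b<r. [:0, U i b:] * (- [:B $$ (P b, T j):]))"
      using ij by (simp add: scalar_prod_def lessThan_atLeast0 P'_def Q'_def del: uminus_mult_right_mat)
    also have "\<dots> = (\<Sum>b<r. [:0, - (U i b * B $$ (P b, T j)):])" by (intro sum.cong) (auto simp: mult_ac)
    also have "\<dots> = [:0, - (\<Sum>b<r. U i b * B $$ (P b, T j)):]"
      by (rule poly_eqI) (simp add: coeff_sum coeff_pCons sum_negf split: nat.split)
    finally show "(A' + P' * (- Q')) $$ (i, j) = mat s s (\<lambda>(i, j). [:a i j, - B $$ (S i, T j):]) $$ (i, j)"
      using ij c by (simp add: A'_def fac)
  qed (use c in auto)
  finally have eq: "det (mat s s (\<lambda>(i, j). [:a i j, - B $$ (S i, T j):])) = det ?F" by simp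
  have "degree (det ?F) \<le> r"
    unfolding det_def'[OF F]
  proof (rule degree_sum_le)
    fix p assume "p \<in> {p. p permutes {0..<s + r}}"
    then have p: "p permutes {0..<s + r}" by simp
    have deg: "degree (?F $$ (i, p i)) \<le> (if p i < s then 0 else 1)" if "i < s + r" for i
    proof -
      have "p i < s + r" using permutes_in_image[OF p, of i] that by simp
      then show ?thesis using that c by (auto simp: A'_def P'_def Q'_def one_mat_def)
    qed
    have "degree (\<Prod>i = 0..<s + r. ?F $$ (i, p i)) \<le> (\<Sum>i = 0..<s + r. degree (?F $$ (i, p i)))"
      using degree_prod_sum_le[of "{0..<s + r}" "\<lambda>i. ?F $$ (i, p i)"] by (simp add: o_def)
    also have "\<dots> \<le> (\<Sum>i = 0..<s + r. if p i < s then 0 else 1)"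
      by (intro sum_mono deg) simp
    also have "\<dots> = (\<Sum>i = 0..<s + r. if i < s then 0 else 1)"
      using sum.permute[OF p, of "\<lambda>i. if i < s then 0 else 1 :: nat"] by (simp add: o_def)
    also have "\<dots> = r"
    proof -
      have "{x. x < s + r \<and> \<not> x < s} = {s..<s + r}" by auto
      then show ?thesis by (simp add: sum.If_cases Int_def)
    qed
    finally have "degree (\<Prod>i = 0..<s + r. ?F $$ (i, p i)) \<le> r" .
    then show "degree (of_int (sign p) * (\<Prod>i = 0..<s + r. ?F $$ (i, p i))) \<le> r"
      by (auto simp: sign_def)
  qed (simp add: finite_permutations)
  then show ?thesis using eq rank by simp
qed

text \<open>Let \<open>x\<close> and \<open>y\<close> be left and right eigenvectors at \<open>v\<close> that are not orthogonal for \<open>B\<close>. Multiplying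
  the factorization through a maximal minor of \<open>A - w B\<close> by \<open>x\<close> and \<open>y\<close> produces one factor \<open>w - v\<close> on the
  side of the minor and two on the other. So the minor vanishes at \<open>v\<close>, even when \<open>A - w B\<close> is singular
  for every \<open>w\<close>.\<close>

lemma pencil_minor_vanishes:
  fixes A B :: "real mat" and x y :: "nat \<Rightarrow> real"
  assumes A: "A \<in> carrier_mat N N'" and B: "B \<in> carrier_mat N N'"
    and right: "\<And>i. i < N \<Longrightarrow> (\<Sum>j<N'. (A $$ (i, j) - v * B $$ (i, j)) * y j) = 0"
    and left: "\<And>j. j < N' \<Longrightarrow> (\<Sum>i<N. x i * (A $$ (i, j) - v * B $$ (i, j))) = 0"
    and xy: "(\<Sum>i<N. \<Sum>j<N'. x i * B $$ (i, j) * y j) \<noteq> 0"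
  obtains s S T M where "0 < s" "\<And>a. a < s \<Longrightarrow> S a < N" "\<And>a. a < s \<Longrightarrow> T a < N'"
    "M = det (mat s s (\<lambda>(i, j). [:A $$ (S i, T j), - B $$ (S i, T j):]))" "M \<noteq> 0" "poly M v = 0"
    "degree M \<le> mat_rank B"
proof -
  define X where "X = mat N N' (\<lambda>(i, j). [:A $$ (i, j), - B $$ (i, j):])"
  have X: "X \<in> carrier_mat N N'" by (simp add: X_def)
  obtain s S T adj where s: "\<And>a. a < s \<Longrightarrow> S a < N" "\<And>a. a < s \<Longrightarrow> T a < N'" "fminor X S T s \<noteq> 0"
    "\<And>i j. i < N \<Longrightarrow> j < N' \<Longrightarrow> fminor X S T s * X $$ (i, j) =
      (\<Sum>b<s. (\<Sum>a<s. X $$ (i, T a) * adj a b) * X $$ (S b, j))"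
    using maximal_minor_factorization[OF X] by blast
  define M where "M = fminor X S T s"
  have M: "M = det (mat s s (\<lambda>(i, j). [:A $$ (S i, T j), - B $$ (S i, T j):]))"
    unfolding M_def fminor_def by (intro arg_cong[where f = det] cong_mat) (auto simp: X_def s)
  define q where "q = [:- v, 1:]"
  define \<beta> where "\<beta> = (\<Sum>i<N. \<Sum>j<N'. x i * B $$ (i, j) * y j)"
  define Y where "Y i = (\<Sum>j<N'. B $$ (i, j) * y j)" for i
  define Z where "Z j = (\<Sum>i<N. x i * B $$ (i, j))" for j
  have Xq: "X $$ (i, j) = [:A $$ (i, j) - v * B $$ (i, j):] - q * [:B $$ (i, j):]" if "i < N" "j < N'" for i j
    using that by (simp add: X_def q_def)
  have const: "(\<Sum>j\<in>J. [:c j:]) = [:\<Sum>j\<in>J. c j:]" for c :: "nat \<Rightarrow> real" and J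
    by (rule poly_eqI) (simp add: coeff_sum coeff_pCons split: nat.split)
  have XY: "(\<Sum>j<N'. X $$ (i, j) * [:y j:]) = - q * [:Y i:]" if i: "i < N" for i
  proof -
    have "(\<Sum>j<N'. X $$ (i, j) * [:y j:]) = (\<Sum>j<N'. [:(A $$ (i, j) - v * B $$ (i, j)) * y j:] - q * [:B $$ (i, j) * y j:])"
      by (intro sum.cong refl) (simp add: Xq[OF i] smult_diff_right algebra_simps)
    also have "\<dots> = - q * [:Y i:]"
      by (simp only: sum_subtractf sum_distrib_left[symmetric] const right[OF i] Y_def) simp
    finally show ?thesis .
  qed
  have ZX: "(\<Sum>i<N. [:x i:] * X $$ (i, j)) = - q * [:Z j:]" if j: "j < N'" for j
  proof -
    have "(\<Sum>i<N. [:x i:] * X $$ (i, j)) = (\<Sum>i<N. [:x i * (A $$ (i, j) - v * B $$ (i, j)):] - q * [:x i * B $$ (i, j):])"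
      by (intro sum.cong refl) (simp add: Xq[OF _ j] smult_diff_right algebra_simps)
    also have "\<dots> = - q * [:Z j:]"
      by (simp only: sum_subtractf sum_distrib_left[of q, symmetric] const left[OF j] Z_def) simp
    finally show ?thesis .
  qed
  have product: "(\<Sum>i<N. f i) * c * (\<Sum>j<N'. g j) = (\<Sum>i<N. \<Sum>j<N'. f i * c * g j)"
    for f g :: "nat \<Rightarrow> real poly" and c
    unfolding sum_distrib_left sum_distrib_right by (rule sum.swap)
  have "M * (\<Sum>i<N. \<Sum>j<N'. [:x i:] * X $$ (i, j) * [:y j:]) =
      (\<Sum>i<N. \<Sum>j<N'. [:x i:] * (M * X $$ (i, j)) * [:y j:])"
    by (simp add: sum_distrib_left mult_ac)
  also have "\<dots> = (\<Sum>i<N. \<Sum>j<N'. \<Sum>b<s. \<Sum>a<s. ([:x i:] * X $$ (i, T a)) * adj a b * (X $$ (S b, j) * [:y j:]))"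
    by (intro sum.cong refl) (simp add: s(4)[folded M_def] sum_distrib_left sum_distrib_right mult_ac)
  also have "\<dots> = (\<Sum>b<s. \<Sum>a<s. \<Sum>i<N. \<Sum>j<N'. ([:x i:] * X $$ (i, T a)) * adj a b * (X $$ (S b, j) * [:y j:]))"
  proof -
    have "(\<Sum>i<N. \<Sum>j<N'. \<Sum>b<s. \<Sum>a<s. h i j b a) = (\<Sum>b<s. \<Sum>a<s. \<Sum>i<N. \<Sum>j<N'. h i j b a)"
      for h :: "nat \<Rightarrow> nat \<Rightarrow> nat \<Rightarrow> nat \<Rightarrow> real poly"
    proof -
      have "(\<Sum>i<N. \<Sum>j<N'. \<Sum>b<s. \<Sum>a<s. h i j b a) = (\<Sum>i<N. \<Sum>b<s. \<Sum>j<N'. \<Sum>a<s. h i j b a)"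
        by (intro sum.cong refl sum.swap)
      also have "\<dots> = (\<Sum>b<s. \<Sum>i<N. \<Sum>j<N'. \<Sum>a<s. h i j b a)" by (rule sum.swap)
      also have "\<dots> = (\<Sum>b<s. \<Sum>i<N. \<Sum>a<s. \<Sum>j<N'. h i j b a)" by (intro sum.cong refl sum.swap)
      also have "\<dots> = (\<Sum>b<s. \<Sum>a<s. \<Sum>i<N. \<Sum>j<N'. h i j b a)" by (intro sum.cong refl sum.swap)
      finally show ?thesis .
    qed
    then show ?thesis .
  qed
  also have "\<dots> = (\<Sum>b<s. \<Sum>a<s. (\<Sum>i<N. [:x i:] * X $$ (i, T a)) * adj a b * (\<Sum>j<N'. X $$ (S b, j) * [:y j:]))"
    by (intro sum.cong refl product[symmetric])
  also have "\<dots> = (\<Sum>b<s. \<Sum>a<s. q * q * ([:Z (T a):] * adj a b * [:Y (S b):]))"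
  proof (intro sum.cong refl)
    fix b a assume "b \<in> {..<s}" "a \<in> {..<s}"
    then have ab: "b < s" "a < s" by auto
    note ZX' = ZX[OF s(2)[OF ab(2)]] and XY' = XY[OF s(1)[OF ab(1)]]
    show "(\<Sum>i<N. [:x i:] * X $$ (i, T a)) * adj a b * (\<Sum>j<N'. X $$ (S b, j) * [:y j:]) =
      q * q * ([:Z (T a):] * adj a b * [:Y (S b):])"
      unfolding ZX' XY' by (simp only: mult_ac minus_mult_minus mult_minus_left mult_minus_right minus_minus)
  qed
  also have "\<dots> = q * (q * (\<Sum>b<s. \<Sum>a<s. [:Z (T a):] * adj a b * [:Y (S b):]))"
    by (simp only: sum_distrib_left mult.assoc)
  finally have 1: "M * (\<Sum>i<N. \<Sum>j<N'. [:x i:] * X $$ (i, j) * [:y j:]) =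
    q * (q * (\<Sum>b<s. \<Sum>a<s. [:Z (T a):] * adj a b * [:Y (S b):]))" .
  have "(\<Sum>i<N. \<Sum>j<N'. [:x i:] * X $$ (i, j) * [:y j:]) = (\<Sum>i<N. [:x i:] * (- q * [:Y i:]))"
    by (intro sum.cong refl) (simp only: XY[symmetric] lessThan_iff sum_distrib_left mult.assoc)
  also have "\<dots> = - q * [:\<beta>:]"
  proof -
    have "(\<Sum>i<N. [:x i:] * (- q * [:Y i:])) = (\<Sum>i<N. - q * [:x i * Y i:])"
      by (intro sum.cong refl) (simp add: mult_ac)
    also have "\<dots> = - q * [:\<Sum>i<N. x i * Y i:]" by (simp only: const flip: sum_distrib_left)
    also have "(\<Sum>i<N. x i * Y i) = \<beta>" by (simp add: Y_def \<beta>_def sum_distrib_left mult_ac)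
    finally show ?thesis .
  qed
  finally have "q * (M * (- [:\<beta>:])) = q * (q * (\<Sum>b<s. \<Sum>a<s. [:Z (T a):] * adj a b * [:Y (S b):]))"
    using 1 by (simp add: mult_ac)
  moreover have "q \<noteq> 0" by (simp add: q_def)
  ultimately have "M * (- [:\<beta>:]) = q * (\<Sum>b<s. \<Sum>a<s. [:Z (T a):] * adj a b * [:Y (S b):])"
    using mult_left_cancel[of q] by blast
  then have "poly (M * (- [:\<beta>:])) v = poly q v * poly (\<Sum>b<s. \<Sum>a<s. [:Z (T a):] * adj a b * [:Y (S b):]) v"
    by (simp only: poly_mult)
  then have v: "poly M v = 0" using xy by (simp add: q_def \<beta>_def)
  have "0 < s"
  proof (rule ccontr)
    assume "\<not> 0 < s"
    then have "M = 1" by (simp add: M_def fminor_0)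
    then show False using v by simp
  qed
  moreover have "degree M \<le> mat_rank B"
    unfolding M by (rule degree_pencil_minor[OF B s(1,2)])
  ultimately show ?thesis using that[OF _ s(1,2) M _ v] s(3) by (simp add: M_def)
qed

section \<open>Polynomials in the discount rate for small discount rates\<close>

lemma poly_poly_eq_sum:
  "poly (poly P [:l:]) w = (\<Sum>s\<le>degree P. l ^ s * poly (coeff P s) w)" for P :: "real poly poly"
  unfolding poly_altdef[of P] by (simp add: poly_sum mult.commute)

lemma coeff_poly_const:
  "coeff (poly P [:l:]) d = poly (map_poly (\<lambda>c. coeff c d) P) l" for P :: "real poly poly"
proof -
  have "coeff (poly P [:l:]) d = (\<Sum>s\<le>degree P. coeff (coeff P s) d * l ^ s)"
    by (simp add: poly_altdef[of P] coeff_sum poly_const_pow mult.commute)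
  also have "\<dots> = (\<Sum>s\<le>degree P. coeff (map_poly (\<lambda>c. coeff c d) P) s * l ^ s)"
    by (simp add: coeff_map_poly)
  also have "\<dots> = poly (map_poly (\<lambda>c. coeff c d) P) l"
  proof -
    have "degree (map_poly (\<lambda>c. coeff c d) P) \<le> degree P" by (rule map_poly_degree_leq)
    then show ?thesis unfolding poly_altdef[of "map_poly (\<lambda>c. coeff c d) P"]
      by (intro sum.mono_neutral_right) (auto simp: coeff_eq_0)
  qed
  finally show ?thesis .
qed

lemma eventually_poly_nonzero_at_right:
  fixes p :: "real poly"
  assumes "p \<noteq> 0"
  shows "\<forall>\<^sub>F l in at_right 0. poly p l \<noteq> 0"
proof -
  have "finite {l. poly p l = 0}" using assms by (rule poly_roots_finite)
  then have "finite ({l. poly p l = 0} - {0})" by simp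
  then have "open (- ({l. poly p l = 0} - {0}))" by (intro open_Compl finite_imp_closed)
  then have "\<forall>\<^sub>F l in nhds 0. l \<in> - ({l. poly p l = 0} - {0})" by (rule eventually_nhds_in_open) simp
  then show ?thesis unfolding at_within_def eventually_inf_principal
    by eventually_elim auto
qed

text \<open>The leading coefficient in \<open>w\<close> of \<open>coeff P s\<close> is a coefficient of a nonzero polynomial in \<open>l\<close>, which has
  no zeros close to 0.\<close>

lemma eventually_degree_coeff_le:
  fixes P :: "real poly poly"
  shows "\<forall>\<^sub>F l in at_right 0. \<forall>s. degree (coeff P s) \<le> degree (poly P [:l:])"
proof -
  have "\<forall>\<^sub>F l in at_right 0. \<forall>s\<in>{..degree P}. degree (coeff P s) \<le> degree (poly P [:l:])"
  proof (rule eventually_ball_finite, simp, rule ballI)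
    fix s
    let ?d = "degree (coeff P s)"
    show "\<forall>\<^sub>F l in at_right 0. ?d \<le> degree (poly P [:l:])"
    proof (cases "coeff P s = 0")
      case False
      then have "coeff (map_poly (\<lambda>c. coeff c ?d) P) s \<noteq> 0" by (simp add: coeff_map_poly)
      then have "map_poly (\<lambda>c. coeff c ?d) P \<noteq> 0" by auto
      from eventually_poly_nonzero_at_right[OF this] show ?thesis
        by eventually_elim (intro le_degree, simp add: coeff_poly_const)
    qed simp
  qed
  then show ?thesis
  proof eventually_elim
    case (elim l)
    show ?case
    proof
      fix s show "degree (coeff P s) \<le> degree (poly P [:l:])"
        using elim by (cases "s \<le> degree P") (auto simp: coeff_eq_0)
    qed
  qed
qed

lemma lowest_coeff_nonzero: "P \<noteq> 0 \<Longrightarrow> lowest_coeff P \<noteq> 0"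
  unfolding lowest_coeff_def by (rule LeastI_ex) (auto simp: poly_eq_iff)

text \<open>Here \<open>P(l, w)\<close> is a power of \<open>l\<close> times a function that tends to \<open>\<phi>(P)(u)\<close>.\<close>

lemma eventually_nonzero_near_nonroot:
  fixes P :: "real poly poly"
  assumes P: "P \<noteq> 0" and u: "poly (lowest_coeff P) u \<noteq> 0"
    and l: "(l \<longlongrightarrow> 0) F" "\<forall>\<^sub>F x in F. l x \<noteq> 0" and w: "(w \<longlongrightarrow> u) F"
  shows "\<forall>\<^sub>F x in F. poly (poly P [:l x:]) (w x) \<noteq> 0"
proof -
  define s0 where "s0 = (LEAST s. coeff P s \<noteq> 0)"
  have s0: "coeff P s0 \<noteq> 0" unfolding s0_def by (rule LeastI_ex) (use P in \<open>auto simp: poly_eq_iff\<close>)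
  have below: "coeff P s = 0" if "s < s0" for s using not_less_Least[OF that[unfolded s0_def]] by simp
  have le: "s0 \<le> degree P" using s0 by (rule le_degree)
  define h where "h x = (\<Sum>s\<in>{s0..degree P}. l x ^ (s - s0) * poly (coeff P s) (w x))" for x
  have eq: "poly (poly P [:l x:]) (w x) = l x ^ s0 * h x" for x
  proof -
    have "poly (poly P [:l x:]) (w x) = (\<Sum>s\<in>{s0..degree P}. l x ^ s * poly (coeff P s) (w x))"
      unfolding poly_poly_eq_sum
      by (rule sum.mono_neutral_right) (auto simp: below not_le)
    also have "\<dots> = l x ^ s0 * h x"
      unfolding h_def sum_distrib_left
      by (intro sum.cong refl) (simp add: mult.assoc[symmetric] flip: power_add)
    finally show ?thesis .
  qed
  have "(h \<longlongrightarrow> (\<Sum>s\<in>{s0..degree P}. 0 ^ (s - s0) * poly (coeff P s) u)) F"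
    unfolding h_def by (intro tendsto_intros l(1) w)
  also have "(\<Sum>s\<in>{s0..degree P}. 0 ^ (s - s0) * poly (coeff P s) u) = (\<Sum>s\<in>{s0}. 0 ^ (s - s0) * poly (coeff P s) u)"
    by (rule sum.mono_neutral_right) (use le in \<open>auto simp: power_0_left\<close>)
  also have "\<dots> = poly (lowest_coeff P) u" by (simp add: lowest_coeff_def s0_def)
  finally have "\<forall>\<^sub>F x in F. h x \<noteq> 0" using u by (rule tendsto_imp_eventually_ne)
  with l(2) show ?thesis by eventually_elim (simp add: eq)
qed

text \<open>Along a continuous function a finite set of cluster points is a single point, as the values
  between two of them would be cluster points as well.\<close>

lemma tendsto_of_finite_cluster_points:
  fixes v :: "real \<Rightarrow> real"
  assumes cont: "continuous_on {0<..1} v"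
    and bnd: "\<And>l. l \<in> {0<..1} \<Longrightarrow> v l \<in> {a..b}"
    and fin: "finite V" and acc: "\<And>u. accumulation_point v (at_right 0) u \<Longrightarrow> u \<in> V"
  shows "\<exists>u. (v \<longlongrightarrow> u) (at_right 0)"
proof -
  have ev01: "\<forall>\<^sub>F l in at_right 0. l \<in> {0<..1::real}"
    by (rule eventually_at_rightI[of 0 1]) auto
  have cluster: "\<exists>u\<in>{a..b}. inf (nhds u) (filtermap v F) \<noteq> bot" if "F \<noteq> bot" "F \<le> at_right 0" for F
  proof -
    have "\<forall>\<^sub>F y in filtermap v F. y \<in> {a..b}"
      unfolding eventually_filtermap using filter_leD[OF that(2) ev01] by eventually_elim (rule bnd)
    then show ?thesis using compact_filter[of "{a..b}"] that(1) by (simp add: filtermap_bot_iff)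
  qed
  have is_acc: "accumulation_point v (at_right 0) u" if "inf (nhds u) (filtermap v F) \<noteq> bot" "F \<le> at_right 0" for u F
    unfolding accumulation_point_def
  proof (intro allI impI)
    fix U assume U: "open U" "u \<in> U"
    show "\<exists>\<^sub>F x in at_right 0. v x \<in> U"
    proof (rule ccontr)
      assume "\<not> (\<exists>\<^sub>F x in at_right 0. v x \<in> U)"
      then have "\<forall>\<^sub>F x in at_right 0. v x \<notin> U" by (simp add: not_frequently)
      then have "\<forall>\<^sub>F y in filtermap v F. y \<notin> U"
        unfolding eventually_filtermap by (rule filter_leD[OF that(2)])
      moreover have "\<forall>\<^sub>F y in nhds u. y \<in> U" using U by (rule eventually_nhds_in_open)
      ultimately have "\<forall>\<^sub>F y in inf (nhds u) (filtermap v F). False"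
        unfolding eventually_inf by blast
      then show False using that(1) by (simp add: trivial_limit_def)
    qed
  qed
  have unique: "u1 = u2" if a1: "accumulation_point v (at_right 0) u1" and a2: "accumulation_point v (at_right 0) u2" for u1 u2
  proof (rule ccontr)
    have *: "accumulation_point v (at_right 0) c"
      if a1: "accumulation_point v (at_right 0) u1" and a2: "accumulation_point v (at_right 0) u2"
        and c: "u1 < c" "c < u2" for u1 u2 c
      unfolding accumulation_point_def
    proof (intro allI impI)
      fix U assume U: "open U" "c \<in> U"
      have "\<exists>\<^sub>F l in at_right 0. v l = c"
        unfolding frequently_def eventually_at_right_field
      proof (rule notI, elim exE conjE)
        fix d :: real assume d: "0 < d" "\<forall>y>0. y < d \<longrightarrow> \<not> v y = c"
        define d' where "d' = min d 1"
        have ev: "\<forall>\<^sub>F l in at_right 0. l \<in> {0<..<d'}"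
          by (rule eventually_at_rightI[of 0 d']) (use d in \<open>auto simp: d'_def\<close>)
        have "\<exists>\<^sub>F l in at_right 0. v l \<in> {..<c}" 
          by (rule a1[unfolded accumulation_point_def, rule_format]) (use c in auto)
        then have "\<exists>l1. l1 \<in> {0<..<d'} \<and> v l1 < c"
          using frequently_ex[OF frequently_eventually_frequently[OF _ ev]] by fastforce
        then obtain l1 where l1: "l1 \<in> {0<..<d'}" "v l1 < c" by blast
        have "\<exists>\<^sub>F l in at_right 0. v l \<in> {c<..}" 
          by (rule a2[unfolded accumulation_point_def, rule_format]) (use c in auto)
        then have "\<exists>l2. l2 \<in> {0<..<d'} \<and> c < v l2"
          using frequently_ex[OF frequently_eventually_frequently[OF _ ev]] by fastforce
        then obtain l2 where l2: "l2 \<in> {0<..<d'}" "c < v l2" by blast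
        have "connected (v ` {0<..<d'})"
          by (intro connected_continuous_image continuous_on_subset[OF cont]) (auto simp: d'_def)
        then have "c \<in> v ` {0<..<d'}"
          by (rule connectedD_interval[of _ "v l1" "v l2"]) (use l1 l2 in auto)
        then show False using d by (auto simp: d'_def)
      qed
      then show "\<exists>\<^sub>F l in at_right 0. v l \<in> U" by (rule frequently_elim1) (use U in simp)
    qed
    assume "u1 \<noteq> u2"
    then have "{min u1 u2<..<max u1 u2} \<subseteq> V"
      using *[OF a1 a2] *[OF a2 a1] acc by (cases "u1 < u2") auto
    then have "finite {min u1 u2<..<max u1 u2}" using fin finite_subset by blast
    then show False using \<open>u1 \<noteq> u2\<close> infinite_Ioo[of "min u1 u2" "max u1 u2"] by auto
  qed
  obtain u where u: "inf (nhds u) (filtermap v (at_right 0)) \<noteq> bot"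
    using cluster[of "at_right 0"] by auto
  note u_acc = is_acc[OF u order_refl]
  have "(v \<longlongrightarrow> u) (at_right 0)"
  proof (rule topological_tendstoI)
    fix U assume U: "open U" "u \<in> U"
    show "\<forall>\<^sub>F x in at_right 0. v x \<in> U"
    proof (rule ccontr)
      assume neg: "\<not> (\<forall>\<^sub>F x in at_right 0. v x \<in> U)"
      define F where "F = inf (at_right 0) (principal {x. v x \<notin> U})"
      have F: "F \<noteq> bot" "F \<le> at_right 0"
        using neg by (auto simp: F_def trivial_limit_def eventually_inf_principal)
      obtain u' where u': "inf (nhds u') (filtermap v F) \<noteq> bot" using cluster[OF F] by blast
      have "u' = u" by (rule unique[OF is_acc[OF u' F(2)] u_acc])
      moreover have "\<forall>\<^sub>F y in filtermap v F. y \<notin> U"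
        by (simp add: F_def eventually_filtermap eventually_inf_principal)
      ultimately have "\<forall>\<^sub>F y in inf (nhds u') (filtermap v F). False"
        using eventually_nhds_in_open[OF U] unfolding eventually_inf by blast
      then show False using u' by (simp add: trivial_limit_def)
    qed
  qed
  then show ?thesis by blast
qed

section \<open>Rational coefficients\<close>

text \<open>A set rather than a type, so that the passage to coefficients can be iterated.\<close>

definition subring_set :: "'a::comm_ring_1 set \<Rightarrow> bool" where
  "subring_set S \<longleftrightarrow> 1 \<in> S \<and> (\<forall>a\<in>S. - a \<in> S) \<and> (\<forall>a\<in>S. \<forall>b\<in>S. a + b \<in> S \<and> a * b \<in> S)"

lemma subring_set_0: "subring_set S \<Longrightarrow> 0 \<in> S"
  unfolding subring_set_def by (metis add.right_inverse)

lemma subring_set_sum: "subring_set S \<Longrightarrow> (\<And>i. i \<in> I \<Longrightarrow> f i \<in> S) \<Longrightarrow> sum f I \<in> S"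
  by (induction I rule: infinite_finite_induct) (auto simp: subring_set_0, auto simp: subring_set_def)

lemma subring_set_prod: "subring_set S \<Longrightarrow> (\<And>i. i \<in> I \<Longrightarrow> f i \<in> S) \<Longrightarrow> prod f I \<in> S"
  by (induction I rule: infinite_finite_induct) (auto simp: subring_set_def)

lemma subring_set_signed: "subring_set S \<Longrightarrow> a \<in> S \<Longrightarrow> of_int (sign p) * a \<in> S"
  by (auto simp: sign_def subring_set_def)

lemma subring_set_det:
  assumes "subring_set S" "\<And>i j. i < dim_row A \<Longrightarrow> j < dim_col A \<Longrightarrow> A $$ (i, j) \<in> S"
  shows "det A \<in> S"
proof (cases "dim_row A = dim_col A")
  case True
  have "(\<Sum>p | p permutes {0..<dim_row A}. of_int (sign p) * (\<Prod>i = 0..<dim_row A. A $$ (i, p i))) \<in> S"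
  proof (intro subring_set_sum subring_set_signed subring_set_prod assms)
    fix p i assume p: "p \<in> {p. p permutes {0..<dim_row A}}" and i: "i \<in> {0..<dim_row A}"
    then show "i < dim_row A" "p i < dim_col A"
      using permutes_in_image[of p "{0..<dim_row A}" i] True by auto
  qed
  then show ?thesis using True by (simp add: det_def)
qed (use assms subring_set_0 in \<open>simp add: det_def\<close>)

lemma subring_set_poly:
  assumes "subring_set S"
  shows "subring_set {p. \<forall>i. coeff p i \<in> S}"
proof -
  have "(\<forall>i. coeff (p * q) i \<in> S)" if "\<forall>i. coeff p i \<in> S" "\<forall>i. coeff q i \<in> S" for p q
    unfolding coeff_mult using that assms
    by (auto intro!: subring_set_sum) (auto simp: subring_set_def)
  moreover have "coeff 1 i \<in> S" for i
    using assms subring_set_0[OF assms] by (cases "i = 0") (auto simp: subring_set_def)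
  ultimately show ?thesis using assms unfolding subring_set_def by auto
qed

lemma subring_set_Rats: "subring_set (\<rat> :: 'a::field_char_0 set)"
  by (simp add: subring_set_def)

lemma subring_set_pCons:
  assumes "subring_set S" "a \<in> S" "\<forall>i. coeff p i \<in> S"
  shows "\<forall>i. coeff (pCons a p) i \<in> S"
  using assms by (auto simp: coeff_pCons split: nat.split)

section \<open>The pencil of the reduced auxiliary matrices\<close>

text \<open>A vector in the kernel has a component of largest modulus, which \<open>(1 - lam) Q\<close> strictly decreases.\<close>

lemma diagonally_dominant_det:
  fixes Q :: "nat \<Rightarrow> nat \<Rightarrow> real"
  assumes lam: "lam \<in> {0<..1}" and nn: "\<And>a b. a < n \<Longrightarrow> b < n \<Longrightarrow> 0 \<le> Q a b"
    and sum1: "\<And>a. a < n \<Longrightarrow> (\<Sum>b<n. Q a b) = 1"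
  shows "det (mat n n (\<lambda>(a, b). (1 - lam) * Q a b - (if b = a then 1 else 0))) \<noteq> 0"
    (is "det ?M \<noteq> 0")
proof
  assume "det ?M = 0"
  then obtain u where u: "u \<in> carrier_vec n" "u \<noteq> 0\<^sub>v n" "?M *\<^sub>v u = 0\<^sub>v n"
    using det_0_iff_vec_prod_zero[of ?M n] by auto
  have row: "(1 - lam) * (\<Sum>b<n. Q a b * u $ b) = u $ a" if a: "a < n" for a
  proof -
    have "(?M *\<^sub>v u) $ a = (\<Sum>b<n. ((1 - lam) * Q a b - (if b = a then 1 else 0)) * u $ b)"
      using a u(1) by (auto simp: scalar_prod_def lessThan_atLeast0 intro!: sum.cong)
    also have "\<dots> = (\<Sum>b<n. (1 - lam) * (Q a b * u $ b) - (if b = a then u $ b else 0))"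
      by (intro sum.cong refl) (auto simp: algebra_simps)
    also have "\<dots> = (1 - lam) * (\<Sum>b<n. Q a b * u $ b) - u $ a"
      using a by (simp add: sum_subtractf sum_distrib_left)
    finally show ?thesis using u(3) a by simp
  qed
  have n: "0 < n"
  proof (rule ccontr)
    assume "\<not> 0 < n"
    then have "u = 0\<^sub>v n" using u(1) by (intro eq_vecI) auto
    then show False using u(2) by simp
  qed
  let ?f = "\<lambda>b. \<bar>u $ b\<bar>"
  have "Max (?f ` {..<n}) \<in> ?f ` {..<n}" using n by (intro Max_in) auto
  then obtain a where a: "a < n" "?f a = Max (?f ` {..<n})" by auto
  have max: "?f b \<le> ?f a" if "b < n" for b unfolding a(2) using that by (intro Max_ge) auto
  have "?f a = (1 - lam) * \<bar>\<Sum>b<n. Q a b * u $ b\<bar>"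
    using row[OF a(1)] lam by (metis abs_mult abs_of_nonneg diff_ge_0_iff_ge greaterThanAtMost_iff)
  also have "\<dots> \<le> (1 - lam) * (\<Sum>b<n. Q a b * ?f a)"
  proof (intro mult_left_mono)
    have "\<bar>\<Sum>b<n. Q a b * u $ b\<bar> \<le> (\<Sum>b<n. \<bar>Q a b * u $ b\<bar>)" by (rule sum_abs)
    also have "\<dots> \<le> (\<Sum>b<n. Q a b * ?f a)"
      by (intro sum_mono) (use nn[OF a(1)] max in \<open>auto simp: abs_mult intro!: mult_left_mono\<close>)
    finally show "\<bar>\<Sum>b<n. Q a b * u $ b\<bar> \<le> (\<Sum>b<n. Q a b * ?f a)" .
  qed (use lam in auto)
  also have "\<dots> = (1 - lam) * ?f a" using sum1[OF a(1)] by (simp flip: sum_distrib_right)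
  finally have "lam * ?f a \<le> 0" by (simp add: algebra_simps)
  then have "?f a = 0" using lam by (simp add: mult_le_0_iff)
  then have "u = 0\<^sub>v n" using u(1) max by (intro eq_vecI) auto
  then show False using u(2) by simp
qed

text \<open>What the kernel provides: strategies of the restricted game that make the opponent indifferent. They sum
  to 1 because \<open>S\<close> is the sum of all cofactors.\<close>

lemma kernel_strategies:
  assumes "shapley_snow_kernel G R C"
  obtains x y where "\<And>i. i < card R \<Longrightarrow> 0 \<le> x i" "(\<Sum>i<card R. x i) = 1"
    "\<And>j. j < card C \<Longrightarrow> 0 \<le> y j" "(\<Sum>j<card C. y j) = 1"
    "\<And>j. j < card C \<Longrightarrow> (\<Sum>i<card R. x i * G $$ (pick R i, pick C j)) = game_val G"
    "\<And>i. i < card R \<Longrightarrow> (\<Sum>j<card C. G $$ (pick R i, pick C j) * y j) = game_val G"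
proof -
  let ?G = "submatrix G R C"
  let ?co = "cofactor_mat ?G"
  let ?S = "entry_sum ?co"
  have sub: "R \<subseteq> {..<dim_row G}" "C \<subseteq> {..<dim_col G}" and card: "card R = card C"
    using assms by (auto simp: shapley_snow_kernel_def)
  define K where "K x y \<longleftrightarrow> ?S \<noteq> 0 \<and>
      restrict_vec x R = (1 / ?S) \<cdot>\<^sub>v (?co *\<^sub>v ones_vec (card R)) \<and>
      restrict_vec y C = (1 / ?S) \<cdot>\<^sub>v (transpose_mat ?co *\<^sub>v ones_vec (card R)) \<and>
      game_val G = game_val ?G \<and> game_val ?G = det ?G / ?S \<and>
      transpose_mat ?G *\<^sub>v restrict_vec x R = game_val G \<cdot>\<^sub>v ones_vec (card R) \<and>
      ?G *\<^sub>v restrict_vec y C = game_val G \<cdot>\<^sub>v ones_vec (card R)" for x y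
  have "\<exists>x y. basic_solution G x y \<and> K x y"
    using assms unfolding shapley_snow_kernel_def Let_def K_def by (elim conjE)
  then obtain x0 y0 where basic: "basic_solution G x0 y0" and kernel: "K x0 y0" by blast
  have opt: "x0 \<in> mixed_strategies (dim_row G)" "y0 \<in> mixed_strategies (dim_col G)"
    using basic unfolding basic_solution_def optimal_row_def optimal_col_def by auto
  from kernel have S: "?S \<noteq> 0"
    and x: "restrict_vec x0 R = (1 / ?S) \<cdot>\<^sub>v (?co *\<^sub>v ones_vec (card R))"
    and y: "restrict_vec y0 C = (1 / ?S) \<cdot>\<^sub>v (transpose_mat ?co *\<^sub>v ones_vec (card R))"
    and left: "transpose_mat ?G *\<^sub>v restrict_vec x0 R = game_val G \<cdot>\<^sub>v ones_vec (card R)"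
    and right: "?G *\<^sub>v restrict_vec y0 C = game_val G \<cdot>\<^sub>v ones_vec (card R)"
    unfolding K_def by blast+
  have sets: "{i. i < dim_row G \<and> i \<in> R} = R" "{i. i < dim_col G \<and> i \<in> C} = C" using sub by auto
  have dim: "dim_row ?G = card R" "dim_col ?G = card C" by (simp_all add: dim_submatrix sets)
  have idx: "?G $$ (i, j) = G $$ (pick R i, pick C j)" if "i < card R" "j < card C" for i j
    using that by (simp add: submatrix_index sets)
  have dco: "dim_row ?co = card R" "dim_col ?co = card C" by (simp_all add: cofactor_mat_def dim)
  define x' where "x' i = restrict_vec x0 R $ i" for i
  define y' where "y' i = restrict_vec y0 C $ i" for i
  have fin: "finite R" "finite C" using sub finite_subset by auto
  have pick: "pick R i \<in> R" if "i < card R" for i using that pick_in_set_le by blast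
  have pickC: "pick C i \<in> C" if "i < card C" for i using that pick_in_set_le by blast
  show ?thesis
  proof (rule that[of x' y'])
    fix i assume i: "i < card R"
    show "0 \<le> x' i" using i opt(1) pick[OF i] sub(1)
      by (auto simp: x'_def restrict_vec_def mixed_strategies_def)
    have "(?G *\<^sub>v restrict_vec y0 C) $ i = (\<Sum>j<card C. G $$ (pick R i, pick C j) * y' j)"
      using i by (auto simp: scalar_prod_def lessThan_atLeast0 dim idx y'_def restrict_vec_def intro!: sum.cong)
    then show "(\<Sum>j<card C. G $$ (pick R i, pick C j) * y' j) = game_val G"
      using i by (simp add: right ones_vec_def)
  next
    fix j assume j: "j < card C"
    show "0 \<le> y' j" using j opt(2) pickC[OF j] sub(2)
      by (auto simp: y'_def restrict_vec_def mixed_strategies_def)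
    have "(transpose_mat ?G *\<^sub>v restrict_vec x0 R) $ j = (\<Sum>i<card R. x' i * G $$ (pick R i, pick C j))"
      using j by (auto simp: scalar_prod_def lessThan_atLeast0 dim idx x'_def restrict_vec_def mult.commute intro!: sum.cong)
    then show "(\<Sum>i<card R. x' i * G $$ (pick R i, pick C j)) = game_val G"
      using j card by (simp add: left ones_vec_def)
  next
    have "(\<Sum>i<card R. x' i) = (\<Sum>i<card R. (1 / ?S) * (\<Sum>j<card C. ?co $$ (i, j)))"
      by (intro sum.cong refl)
        (auto simp: x'_def x dco ones_vec_def scalar_prod_def lessThan_atLeast0 card)
    also have "\<dots> = 1 / ?S * (\<Sum>i<card R. \<Sum>j<card C. ?co $$ (i, j))" by (rule sum_distrib_left[symmetric])
    also have "\<dots> = 1" using S by (simp add: entry_sum_def dco)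
    finally show "(\<Sum>i<card R. x' i) = 1" .
    have "(\<Sum>j<card C. y' j) = (\<Sum>j<card C. (1 / ?S) * (\<Sum>i<card R. ?co $$ (i, j)))"
      by (intro sum.cong refl)
        (auto simp: y'_def y dco ones_vec_def scalar_prod_def lessThan_atLeast0 card)
    also have "\<dots> = 1 / ?S * (\<Sum>j<card C. \<Sum>i<card R. ?co $$ (i, j))" by (rule sum_distrib_left[symmetric])
    also have "(\<Sum>j<card C. \<Sum>i<card R. ?co $$ (i, j)) = (\<Sum>i<card R. \<Sum>j<card C. ?co $$ (i, j))"
      by (rule sum.swap)
    also have "1 / ?S * \<dots> = 1" using S by (simp add: entry_sum_def dco)
    finally show "(\<Sum>j<card C. y' j) = 1" .
  qed
qed

lemma digit_less:
  assumes "I < prod_list (map d [1..<Suc n])" "k \<in> {1..n}"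
  shows "digits (map d [1..<Suc n]) I ! (k - 1) < d k"
proof -
  have "[1..<Suc n] ! (k - 1) = k" using assms(2) nth_upt[of 1 "k - 1" "Suc n"] by auto
  then show ?thesis using digits_less[OF assms(1), of "k - 1"] assms(2) by (simp del: upt_Suc) linarith
qed

text \<open>The reduced data array with its entries, together with equalizing strategies \<open>x\<close> and \<open>y\<close>: against
  them, each row of the array annihilates \<open>(1, v)\<close>.\<close>

locale equalized_array =
  fixes n :: nat and lam :: real and v :: "nat \<Rightarrow> real" and r s :: "nat \<Rightarrow> nat"
    and D q :: "nat \<Rightarrow> nat \<Rightarrow> nat \<Rightarrow> nat \<Rightarrow> real" and x y :: "nat \<Rightarrow> nat \<Rightarrow> real"
  assumes lam: "lam \<in> {0<..1}"
    and x: "\<And>k i. k \<in> {1..n} \<Longrightarrow> i < r k \<Longrightarrow> 0 \<le> x k i" "\<And>k. k \<in> {1..n} \<Longrightarrow> (\<Sum>i<r k. x k i) = 1"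
    and y: "\<And>k j. k \<in> {1..n} \<Longrightarrow> j < s k \<Longrightarrow> 0 \<le> y k j" "\<And>k. k \<in> {1..n} \<Longrightarrow> (\<Sum>j<s k. y k j) = 1"
    and D: "\<And>k m i j. k \<in> {1..n} \<Longrightarrow> m \<in> {1..n} \<Longrightarrow> i < r k \<Longrightarrow> j < s k \<Longrightarrow>
      D k m i j = (1 - lam) * q k m i j - (if m = k then 1 else 0)"
    and q: "\<And>k m i j. k \<in> {1..n} \<Longrightarrow> i < r k \<Longrightarrow> j < s k \<Longrightarrow> 0 \<le> q k m i j"
      "\<And>k i j. k \<in> {1..n} \<Longrightarrow> i < r k \<Longrightarrow> j < s k \<Longrightarrow> (\<Sum>m = 1..n. q k m i j) = 1"
    and right: "\<And>k i. k \<in> {1..n} \<Longrightarrow> i < r k \<Longrightarrow> (\<Sum>m\<le>n. (\<Sum>j<s k. D k m i j * y k j) * (if m = 0 then 1 else v m)) = 0"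
    and left: "\<And>k j. k \<in> {1..n} \<Longrightarrow> j < s k \<Longrightarrow> (\<Sum>m\<le>n. (\<Sum>i<r k. D k m i j * x k i) * (if m = 0 then 1 else v m)) = 0"
begin

abbreviation "rs \<equiv> map r [1..<Suc n]"
abbreviation "ss \<equiv> map s [1..<Suc n]"

definition minor_entry :: "nat \<Rightarrow> nat \<Rightarrow> nat \<Rightarrow> real" where
  "minor_entry l I J = signed_minor n (\<lambda>k m. D k m (digits rs I ! (k - 1)) (digits ss J ! (k - 1))) l"

definition x_tensor :: "nat \<Rightarrow> real" where
  "x_tensor I = (\<Prod>k = 1..n. x k (digits rs I ! (k - 1)))"

definition y_tensor :: "nat \<Rightarrow> real" where
  "y_tensor J = (\<Prod>k = 1..n. y k (digits ss J ! (k - 1)))"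

lemma minor_entry_y:
  "(\<Sum>J<prod_list ss. minor_entry l I J * y_tensor J) =
    signed_minor n (\<lambda>k m. \<Sum>j<s k. D k m (digits rs I ! (k - 1)) j * y k j) l"
  unfolding minor_entry_def y_tensor_def signed_minor_scale
  by (rule sum_signed_minor[where h = "\<lambda>k m j. D k m (digits rs I ! (k - 1)) j * y k j"])

lemma minor_entry_x:
  "(\<Sum>I<prod_list rs. minor_entry l I J * x_tensor I) =
    signed_minor n (\<lambda>k m. \<Sum>i<r k. D k m i (digits ss J ! (k - 1)) * x k i) l"
  unfolding minor_entry_def x_tensor_def signed_minor_scale
  by (rule sum_signed_minor[where h = "\<lambda>k m i. D k m i (digits ss J ! (k - 1)) * x k i"])

text \<open>The coefficients \<open>1\<close> at \<open>k\<close> and \<open>- v k\<close> at 0 are orthogonal to the solution \<open>(1, v)\<close>.\<close>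

lemma minor_kernel:
  assumes k: "k \<in> {1..n}"
    and rows: "\<And>k. k \<in> {1..n} \<Longrightarrow> (\<Sum>m\<le>n. c k m * (if m = 0 then 1 else v m)) = 0"
  shows "signed_minor n c k - v k * signed_minor n c 0 = 0"
proof -
  define e where "e m = (if m = k then 1 else if m = 0 then - v k else 0)" for m
  have exp: "(\<Sum>m\<le>n. e m * f m) = f k - v k * f 0" for f :: "nat \<Rightarrow> real"
  proof -
    have "(\<Sum>m\<le>n. e m * f m) = (\<Sum>m\<in>{0, k}. e m * f m)"
      by (rule sum.mono_neutral_right) (use k in \<open>auto simp: e_def\<close>)
    then show ?thesis using k by (simp add: e_def)
  qed
  have "(\<Sum>m\<le>n. e m * signed_minor n c m) = 0"
    by (rule signed_minor_kernel[where z = "\<lambda>m. if m = 0 then 1 else v m"])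
      (use rows k in \<open>auto simp: exp\<close>)
  then show ?thesis unfolding exp .
qed

lemma right_kernel:
  assumes k: "k \<in> {1..n}" and I: "I < prod_list rs"
  shows "(\<Sum>J<prod_list ss. (minor_entry k I J - v k * minor_entry 0 I J) * y_tensor J) = 0"
proof -
  let ?c = "\<lambda>k m. \<Sum>j<s k. D k m (digits rs I ! (k - 1)) j * y k j"
  have "(\<Sum>J<prod_list ss. (minor_entry k I J - v k * minor_entry 0 I J) * y_tensor J) =
      (\<Sum>J<prod_list ss. minor_entry k I J * y_tensor J) - v k * (\<Sum>J<prod_list ss. minor_entry 0 I J * y_tensor J)"
    by (simp add: left_diff_distrib sum_subtractf sum_distrib_left mult.assoc)
  also have "\<dots> = signed_minor n ?c k - v k * signed_minor n ?c 0" unfolding minor_entry_y ..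
  also have "\<dots> = 0" by (rule minor_kernel[OF k]) (rule right, simp, rule digit_less[OF I])
  finally show ?thesis .
qed

lemma left_kernel:
  assumes k: "k \<in> {1..n}" and J: "J < prod_list ss"
  shows "(\<Sum>I<prod_list rs. x_tensor I * (minor_entry k I J - v k * minor_entry 0 I J)) = 0"
proof -
  let ?c = "\<lambda>k m. \<Sum>i<r k. D k m i (digits ss J ! (k - 1)) * x k i"
  have "(\<Sum>I<prod_list rs. x_tensor I * (minor_entry k I J - v k * minor_entry 0 I J)) =
      (\<Sum>I<prod_list rs. minor_entry k I J * x_tensor I) - v k * (\<Sum>I<prod_list rs. minor_entry 0 I J * x_tensor I)"
    by (simp add: right_diff_distrib sum_subtractf sum_distrib_left mult_ac)
  also have "\<dots> = signed_minor n ?c k - v k * signed_minor n ?c 0" unfolding minor_entry_x ..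
  also have "\<dots> = 0" by (rule minor_kernel[OF k]) (rule left, simp, rule digit_less[OF J])
  finally show ?thesis .
qed

text \<open>The bilinear form reduces to the determinant of \<open>(1 - lam) Q - 1\<close>, where \<open>Q\<close> is the transition
  matrix of the Markov chain under the stationary strategies \<open>x\<close> and \<open>y\<close>.\<close>

lemma bilinear_nonzero:
  "(\<Sum>I<prod_list rs. \<Sum>J<prod_list ss. x_tensor I * minor_entry 0 I J * y_tensor J) \<noteq> 0"
proof -
  define Q where "Q a b = (\<Sum>i<r (Suc a). \<Sum>j<s (Suc a). x (Suc a) i * y (Suc a) j * q (Suc a) (Suc b) i j)" for a b
  have prod1: "(\<Sum>i<r k. \<Sum>j<s k. x k i * y k j * c) = c" if "k \<in> {1..n}" for k c
  proof -
    have "(\<Sum>i<r k. \<Sum>j<s k. x k i * y k j * c) = (\<Sum>i<r k. x k i) * (\<Sum>j<s k. y k j) * c"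
      by (simp add: sum_product flip: sum_distrib_right)
    then show ?thesis using x(2)[OF that] y(2)[OF that] by simp
  qed
  have "(\<Sum>I<prod_list rs. \<Sum>J<prod_list ss. x_tensor I * minor_entry 0 I J * y_tensor J) =
      (\<Sum>I<prod_list rs. (\<Sum>J<prod_list ss. minor_entry 0 I J * y_tensor J) * x_tensor I)"
    by (simp add: sum_distrib_left sum_distrib_right mult_ac)
  also have "\<dots> = (\<Sum>I<prod_list rs. signed_minor n (\<lambda>k m. (\<Sum>j<s k. D k m (digits rs I ! (k - 1)) j * y k j) * x k (digits rs I ! (k - 1))) 0)"
    unfolding minor_entry_y x_tensor_def signed_minor_scale ..
  also have "\<dots> = signed_minor n (\<lambda>k m. \<Sum>i<r k. (\<Sum>j<s k. D k m i j * y k j) * x k i) 0"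
    by (rule sum_signed_minor[where h = "\<lambda>k m i. (\<Sum>j<s k. D k m i j * y k j) * x k i"])
  also have "\<dots> = det (mat n n (\<lambda>(a, b). \<Sum>i<r (Suc a). (\<Sum>j<s (Suc a). D (Suc a) (Suc b) i j * y (Suc a) j) * x (Suc a) i))"
    by (rule signed_minor_0)
  also have "mat n n (\<lambda>(a, b). \<Sum>i<r (Suc a). (\<Sum>j<s (Suc a). D (Suc a) (Suc b) i j * y (Suc a) j) * x (Suc a) i) =
      mat n n (\<lambda>(a, b). (1 - lam) * Q a b - (if b = a then 1 else 0))"
  proof (intro cong_mat refl, unfold case_prod_conv)
    fix a b assume ab: "a < n" "b < n"
    let ?x = "x (Suc a)" and ?y = "y (Suc a)" and ?d = "if b = a then 1 else 0 :: real"
    have k: "Suc a \<in> {1..n}" "Suc b \<in> {1..n}" using ab by auto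
    have "(\<Sum>i<r (Suc a). (\<Sum>j<s (Suc a). D (Suc a) (Suc b) i j * ?y j) * ?x i) =
        (\<Sum>i<r (Suc a). \<Sum>j<s (Suc a). (1 - lam) * (?x i * ?y j * q (Suc a) (Suc b) i j) - ?x i * ?y j * ?d)"
      unfolding sum_distrib_right by (intro sum.cong refl) (auto simp: D[OF k] algebra_simps)
    also have "\<dots> = (1 - lam) * Q a b - (\<Sum>i<r (Suc a). \<Sum>j<s (Suc a). ?x i * ?y j * ?d)"
      by (simp only: sum_subtractf Q_def sum_distrib_left)
    also have "\<dots> = (1 - lam) * Q a b - ?d" by (simp only: prod1[OF k(1)])
    finally show "(\<Sum>i<r (Suc a). (\<Sum>j<s (Suc a). D (Suc a) (Suc b) i j * ?y j) * ?x i) = (1 - lam) * Q a b - ?d" .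
  qed
  finally have eq: "(\<Sum>I<prod_list rs. \<Sum>J<prod_list ss. x_tensor I * minor_entry 0 I J * y_tensor J) =
    det (mat n n (\<lambda>(a, b). (1 - lam) * Q a b - (if b = a then 1 else 0)))" .
  show ?thesis unfolding eq
  proof (rule diagonally_dominant_det[OF lam])
    fix a b assume "a < n" "b < n"
    then have "Suc a \<in> {1..n}" by auto
    then show "0 \<le> Q a b" unfolding Q_def
      by (intro sum_nonneg mult_nonneg_nonneg x(1) y(1) q(1)) auto
  next
    fix a assume a: "a < n"
    then have k: "Suc a \<in> {1..n}" by auto
    have shift: "(\<Sum>b<n. f (Suc b)) = (\<Sum>m = 1..n. f m)" for f :: "nat \<Rightarrow> real"
      by (rule sum.reindex_bij_witness[where i = "\<lambda>m. m - 1" and j = Suc]) auto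
    have "(\<Sum>b<n. Q a b) = (\<Sum>i<r (Suc a). \<Sum>j<s (Suc a). x (Suc a) i * y (Suc a) j * (\<Sum>b<n. q (Suc a) (Suc b) i j))"
      unfolding Q_def sum_distrib_left
      by (subst sum.swap, rule sum.cong[OF refl], rule sum.swap)
    also have "\<dots> = (\<Sum>i<r (Suc a). \<Sum>j<s (Suc a). x (Suc a) i * y (Suc a) j * 1)"
    proof (intro sum.cong refl)
      fix i j assume "i \<in> {..<r (Suc a)}" "j \<in> {..<s (Suc a)}"
      then have "(\<Sum>b<n. q (Suc a) (Suc b) i j) = 1"
        using shift[of "\<lambda>m. q (Suc a) m i j"] q(2)[OF k] by simp
      then show "x (Suc a) i * y (Suc a) j * (\<Sum>b<n. q (Suc a) (Suc b) i j) = x (Suc a) i * y (Suc a) j * 1" by simp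
    qed
    also have "\<dots> = 1" by (rule prod1[OF k])
    finally show "(\<Sum>b<n. Q a b) = 1" .
  qed
qed

end

section \<open>Roots of the minors at the discounted values\<close>

lemma data_array_carrier: "data_array \<Gamma> c t k m \<in> carrier_mat (acts1 \<Gamma> k) (acts2 \<Gamma> k)"
  by (simp add: data_array_def)

lemma reduced_array_carrier:
  assumes "R k \<subseteq> {..<acts1 \<Gamma> k}" "C k \<subseteq> {..<acts2 \<Gamma> k}"
  shows "reduced_array (data_array \<Gamma> c t) R C k m \<in> carrier_mat (card (R k)) (card (C k))"
    and "i < card (R k) \<Longrightarrow> j < card (C k) \<Longrightarrow> reduced_array (data_array \<Gamma> c t) R C k m $$ (i, j) =
      data_array \<Gamma> c t k m $$ (pick (R k) i, pick (C k) j)"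
proof -
  have sets: "{i. i < dim_row (data_array \<Gamma> c t k m) \<and> i \<in> R k} = R k"
    "{i. i < dim_col (data_array \<Gamma> c t k m) \<and> i \<in> C k} = C k"
    using assms carrier_matD[OF data_array_carrier[of \<Gamma> c t k m]] by auto
  show "reduced_array (data_array \<Gamma> c t) R C k m \<in> carrier_mat (card (R k)) (card (C k))"
    by (rule carrier_matI) (simp_all add: reduced_array_def dim_submatrix sets)
  show "i < card (R k) \<Longrightarrow> j < card (C k) \<Longrightarrow> reduced_array (data_array \<Gamma> c t) R C k m $$ (i, j) =
      data_array \<Gamma> c t k m $$ (pick (R k) i, pick (C k) j)"
    unfolding reduced_array_def by (rule submatrix_index) (simp_all add: sets)
qed

lemma data_array_row_sum:
  assumes k: "k \<in> {1..n_states \<Gamma>}" and ij: "i < acts1 \<Gamma> k" "j < acts2 \<Gamma> k"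
  shows "(\<Sum>m\<le>n_states \<Gamma>. data_array \<Gamma> id lam k m $$ (i, j) * (if m = 0 then 1 else z m)) =
    local_game \<Gamma> lam z k $$ (i, j) - z k"
proof -
  let ?n = "n_states \<Gamma>"
  have "{..?n} = insert 0 {1..?n}" by auto
  then have "(\<Sum>m\<le>?n. data_array \<Gamma> id lam k m $$ (i, j) * (if m = 0 then 1 else z m)) =
      lam * payoff \<Gamma> k i j + (\<Sum>m = 1..?n. data_array \<Gamma> id lam k m $$ (i, j) * z m)"
    using ij by (simp add: data_array_def)
  also have "(\<Sum>m = 1..?n. data_array \<Gamma> id lam k m $$ (i, j) * z m) =
      (\<Sum>m = 1..?n. (1 - lam) * (pmf (trans \<Gamma> k i j) m * z m) - (if m = k then z m else 0))"
    using ij by (intro sum.cong refl) (auto simp: data_array_def algebra_simps)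
  also have "\<dots> = (1 - lam) * (\<Sum>m = 1..?n. pmf (trans \<Gamma> k i j) m * z m) - z k"
    using k by (simp add: sum_subtractf sum_distrib_left)
  finally show ?thesis by (simp only: local_game_index[OF ij] add_diff_eq)
qed

text \<open>The vector \<open>(1, v)\<close> solves the linear system of the reduced array played by the kernel strategies,
  because these equalize the payoffs of the local games within the kernel.\<close>

lemma reduced_pencil_minor:
  fixes R C :: "nat \<Rightarrow> nat set"
  assumes game: "stochastic_game \<Gamma>" and lam: "lam \<in> {0<..1}" and k: "k \<in> {1..n_states \<Gamma>}"
    and kernels: "\<And>l. l \<in> {1..n_states \<Gamma>} \<Longrightarrow>
      shapley_snow_kernel (local_game \<Gamma> lam (discounted_value \<Gamma> lam) l) (R l) (C l)"
  defines "A \<equiv> aux_mat (n_states \<Gamma>) (reduced_array (data_array \<Gamma> id lam) R C)"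
    and "rs \<equiv> map (\<lambda>k. card (R k)) [1..<Suc (n_states \<Gamma>)]"
    and "ss \<equiv> map (\<lambda>k. card (C k)) [1..<Suc (n_states \<Gamma>)]"
  obtains s S T M where "0 < s" "\<And>a. a < s \<Longrightarrow> S a < prod_list rs" "\<And>a. a < s \<Longrightarrow> T a < prod_list ss"
    "M = det (mat s s (\<lambda>(i, j). [:A k $$ (S i, T j), - A 0 $$ (S i, T j):]))" "M \<noteq> 0"
    "poly M (discounted_value \<Gamma> lam k) = 0" "degree M \<le> reduced_rank \<Gamma> lam R C"
proof -
  let ?n = "n_states \<Gamma>" and ?v = "discounted_value \<Gamma> lam"
  let ?G = "local_game \<Gamma> lam ?v"
  have n: "1 \<le> ?n" using game by (simp add: stochastic_game_def)
  have sub: "R l \<subseteq> {..<acts1 \<Gamma> l}" "C l \<subseteq> {..<acts2 \<Gamma> l}" if "l \<in> {1..?n}" for l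
    using kernels[OF that] by (simp_all add: shapley_snow_kernel_def)
  have pick: "pick (R l) i < acts1 \<Gamma> l" if "l \<in> {1..?n}" "i < card (R l)" for l i
    using sub[OF that(1)] pick_in_set_le[OF that(2)] by blast
  have pickC: "pick (C l) j < acts2 \<Gamma> l" if "l \<in> {1..?n}" "j < card (C l)" for l j
    using sub[OF that(1)] pick_in_set_le[OF that(2)] by blast
  define eq where "eq l x y \<longleftrightarrow> (\<forall>i<card (R l). 0 \<le> x i) \<and> (\<Sum>i<card (R l). x i) = 1 \<and>
    (\<forall>j<card (C l). 0 \<le> y j) \<and> (\<Sum>j<card (C l). y j) = 1 \<and>
    (\<forall>j<card (C l). (\<Sum>i<card (R l). x i * ?G l $$ (pick (R l) i, pick (C l) j)) = ?v l) \<and>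
    (\<forall>i<card (R l). (\<Sum>j<card (C l). ?G l $$ (pick (R l) i, pick (C l) j) * y j) = ?v l)"
    for l and x y :: "nat \<Rightarrow> real"
  have "\<exists>xy. eq l (fst xy) (snd xy)" if l: "l \<in> {1..?n}" for l
  proof (rule kernel_strategies[OF kernels[OF l]], unfold discounted_value_fixed_point[OF game lam l])
    fix x y :: "nat \<Rightarrow> real"
    assume "\<And>i. i < card (R l) \<Longrightarrow> 0 \<le> x i" "(\<Sum>i<card (R l). x i) = 1"
      "\<And>j. j < card (C l) \<Longrightarrow> 0 \<le> y j" "(\<Sum>j<card (C l). y j) = 1"
      "\<And>j. j < card (C l) \<Longrightarrow> (\<Sum>i<card (R l). x i * ?G l $$ (pick (R l) i, pick (C l) j)) = ?v l"
      "\<And>i. i < card (R l) \<Longrightarrow> (\<Sum>j<card (C l). ?G l $$ (pick (R l) i, pick (C l) j) * y j) = ?v l"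
    then have "eq l (fst (x, y)) (snd (x, y))" unfolding eq_def by simp
    then show ?thesis by blast
  qed
  then obtain xy where xy: "\<And>l. l \<in> {1..?n} \<Longrightarrow> eq l (fst (xy l)) (snd (xy l))" by metis
  define x where "x l = fst (xy l)" for l
  define y where "y l = snd (xy l)" for l
  have E: "eq l (x l) (y l)" if "l \<in> {1..?n}" for l unfolding x_def y_def by (rule xy[OF that])
  define D where "D l m i j = data_array \<Gamma> id lam l m $$ (pick (R l) i, pick (C l) j)" for l m i j
  define q where "q l m i j = pmf (trans \<Gamma> l (pick (R l) i) (pick (C l) j)) m" for l m i j
  interpret equalized_array ?n lam ?v "\<lambda>k. card (R k)" "\<lambda>k. card (C k)" D q x y
  proof
    show "lam \<in> {0<..1}" by (rule lam)
    fix l assume l: "l \<in> {1..?n}"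
    show "(\<Sum>i<card (R l). x l i) = 1" "(\<Sum>j<card (C l). y l j) = 1" using E[OF l] unfolding eq_def by blast+
    show "0 \<le> x l i" if "i < card (R l)" for i using E[OF l] that unfolding eq_def by blast
    show "0 \<le> y l j" if "j < card (C l)" for j using E[OF l] that unfolding eq_def by blast
    show "D l m i j = (1 - lam) * q l m i j - (if m = l then 1 else 0)"
      if "m \<in> {1..?n}" "i < card (R l)" "j < card (C l)" for m i j
      using that pick[OF l that(2)] pickC[OF l that(3)] by (auto simp: D_def q_def data_array_def)
    show "0 \<le> q l m i j" for m i j by (simp add: q_def)
    show "(\<Sum>m = 1..?n. q l m i j) = 1" if "i < card (R l)" "j < card (C l)" for i j
      unfolding q_def by (rule transition_sum[OF game l pick[OF l that(1)] pickC[OF l that(2)]])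
    have row: "(\<Sum>m\<le>?n. D l m i j * (if m = 0 then 1 else ?v m)) = ?G l $$ (pick (R l) i, pick (C l) j) - ?v l"
      if "i < card (R l)" "j < card (C l)" for i j
      unfolding D_def by (rule data_array_row_sum[OF l pick[OF l that(1)] pickC[OF l that(2)]])
    show "(\<Sum>m\<le>?n. (\<Sum>j<card (C l). D l m i j * y l j) * (if m = 0 then 1 else ?v m)) = 0"
      if i: "i < card (R l)" for i
    proof -
      have "(\<Sum>m\<le>?n. (\<Sum>j<card (C l). D l m i j * y l j) * (if m = 0 then 1 else ?v m)) =
          (\<Sum>m\<le>?n. \<Sum>j<card (C l). (D l m i j * (if m = 0 then 1 else ?v m)) * y l j)"
        unfolding sum_distrib_right by (intro sum.cong refl) (simp only: mult_ac)
      also have "\<dots> = (\<Sum>j<card (C l). (\<Sum>m\<le>?n. D l m i j * (if m = 0 then 1 else ?v m)) * y l j)"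
        unfolding sum_distrib_right by (rule sum.swap)
      also have "\<dots> = (\<Sum>j<card (C l). ?G l $$ (pick (R l) i, pick (C l) j) * y l j - ?v l * y l j)"
        by (intro sum.cong refl) (simp only: row[OF i] lessThan_iff left_diff_distrib)
      also have "\<dots> = ?v l - ?v l * 1"
        using E[OF l] i unfolding sum_subtractf sum_distrib_left[symmetric] eq_def by simp
      finally show ?thesis by simp
    qed
    show "(\<Sum>m\<le>?n. (\<Sum>i<card (R l). D l m i j * x l i) * (if m = 0 then 1 else ?v m)) = 0"
      if j: "j < card (C l)" for j
    proof -
      have "(\<Sum>m\<le>?n. (\<Sum>i<card (R l). D l m i j * x l i) * (if m = 0 then 1 else ?v m)) =
          (\<Sum>m\<le>?n. \<Sum>i<card (R l). (D l m i j * (if m = 0 then 1 else ?v m)) * x l i)"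
        unfolding sum_distrib_right by (intro sum.cong refl) (simp only: mult_ac)
      also have "\<dots> = (\<Sum>i<card (R l). (\<Sum>m\<le>?n. D l m i j * (if m = 0 then 1 else ?v m)) * x l i)"
        unfolding sum_distrib_right by (rule sum.swap)
      also have "\<dots> = (\<Sum>i<card (R l). x l i * ?G l $$ (pick (R l) i, pick (C l) j) - ?v l * x l i)"
        by (intro sum.cong refl, simp only: row[OF _ j] lessThan_iff, simp add: algebra_simps)
      also have "\<dots> = ?v l - ?v l * 1"
        using E[OF l] j unfolding sum_subtractf sum_distrib_left[symmetric] eq_def by simp
      finally show ?thesis by simp
    qed
  qed
  have carr: "reduced_array (data_array \<Gamma> id lam) R C l m \<in> carrier_mat (card (R l)) (card (C l))"
    if "l \<in> {1..?n}" "m \<le> ?n" for l m by (rule reduced_array_carrier(1)[where R = R and C = C, OF sub[OF that(1)]])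
  have A: "A m \<in> carrier_mat (prod_list rs) (prod_list ss)" if "m \<le> ?n" for m
    unfolding A_def rs_def ss_def by (rule aux_mat_carrier[OF n carr that])
  have A_entry: "A m $$ (I, J) = minor_entry m I J"
    if m: "m \<le> ?n" and I: "I < prod_list rs" and J: "J < prod_list ss" for m I J
  proof -
    let ?rs = "map (\<lambda>k. card (R k)) [1..<Suc ?n]" and ?ss = "map (\<lambda>k. card (C k)) [1..<Suc ?n]"
    have "A m $$ (I, J) = signed_minor ?n (\<lambda>l m'. reduced_array (data_array \<Gamma> id lam) R C l m' $$
        (digits ?rs I ! (l - 1), digits ?ss J ! (l - 1))) m"
      unfolding A_def
      by (rule aux_mat_index[where r = "\<lambda>k. card (R k)" and s = "\<lambda>k. card (C k)",
            OF n carr m I[unfolded rs_def] J[unfolded ss_def]])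
    also have "\<dots> = minor_entry m I J"
      unfolding minor_entry_def
    proof (rule signed_minor_cong[OF _ m])
      fix l m' assume l: "l \<in> {1..?n}"
      show "reduced_array (data_array \<Gamma> id lam) R C l m' $$
          (digits ?rs I ! (l - 1), digits ?ss J ! (l - 1)) =
        D l m' (digits ?rs I ! (l - 1)) (digits ?ss J ! (l - 1))"
        unfolding D_def
        by (rule reduced_array_carrier(2)[where R = R and C = C, OF sub[OF l] digit_less[OF I[unfolded rs_def] l] digit_less[OF J[unfolded ss_def] l]])
    qed
    finally show ?thesis .
  qed
  have k': "k \<le> ?n" "0 \<le> ?n" using k by auto
  show ?thesis
  proof (rule pencil_minor_vanishes[OF A[OF k'(1)] A[OF k'(2)], where x = x_tensor and y = y_tensor and v = "?v k"])
    fix I assume I: "I < prod_list rs"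
    show "(\<Sum>J<prod_list ss. (A k $$ (I, J) - ?v k * A 0 $$ (I, J)) * y_tensor J) = 0"
      by (subst right_kernel[OF k I[unfolded rs_def], folded ss_def, symmetric], rule sum.cong[OF refl])
        (simp only: A_entry[OF k'(1) I] A_entry[OF k'(2) I] lessThan_iff)
  next
    fix J assume J: "J < prod_list ss"
    show "(\<Sum>I<prod_list rs. x_tensor I * (A k $$ (I, J) - ?v k * A 0 $$ (I, J))) = 0"
      by (subst left_kernel[OF k J[unfolded ss_def], folded rs_def, symmetric], rule sum.cong[OF refl])
        (simp only: A_entry[OF k'(1) _ J] A_entry[OF k'(2) _ J] lessThan_iff)
  next
    show "(\<Sum>I<prod_list rs. \<Sum>J<prod_list ss. x_tensor I * A 0 $$ (I, J) * y_tensor J) \<noteq> 0"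
    proof -
      have "(\<Sum>I<prod_list rs. \<Sum>J<prod_list ss. x_tensor I * A 0 $$ (I, J) * y_tensor J) =
          (\<Sum>I<prod_list rs. \<Sum>J<prod_list ss. x_tensor I * minor_entry 0 I J * y_tensor J)"
        by (intro sum.cong refl) (simp only: A_entry[OF k'(2)] lessThan_iff)
      then show ?thesis using bilinear_nonzero[folded rs_def ss_def] by simp
    qed
  next
    fix s S T M
    assume "0 < s" "\<And>a. a < s \<Longrightarrow> S a < prod_list rs" "\<And>a. a < s \<Longrightarrow> T a < prod_list ss"
      "M = det (mat s s (\<lambda>(i, j). [:A k $$ (S i, T j), - A 0 $$ (S i, T j):]))" "M \<noteq> 0"
      "poly M (?v k) = 0" "degree M \<le> mat_rank (A 0)"
    then show thesis by (intro that[of s S T M]) (simp_all add: reduced_rank_def A_def)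
  qed
qed

lemma (in comm_ring_hom) signed_minor_hom:
  "hom (signed_minor n c l) = signed_minor n (\<lambda>k m. hom (c k m)) l"
  unfolding signed_minor_def by (simp add: hom_distribs)

lemma comm_ring_hom_poly: "comm_ring_hom (\<lambda>P. poly P a)"
  by unfold_locales auto

lemma comm_ring_hom_const_poly: "comm_ring_hom (\<lambda>c. [:c:])"
  by unfold_locales (auto simp: one_pCons)

definition pencil_poly :: "stoch_game \<Rightarrow> nat \<Rightarrow> real poly poly mat" where
  "pencil_poly \<Gamma> k = aux_poly \<Gamma> k - [:[:0, 1:]:] \<cdot>\<^sub>m aux_poly \<Gamma> 0"

abbreviation "row_radices \<Gamma> \<equiv> map (acts1 \<Gamma>) [1..<Suc (n_states \<Gamma>)]"
abbreviation "col_radices \<Gamma> \<equiv> map (acts2 \<Gamma>) [1..<Suc (n_states \<Gamma>)]"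

lemma aux_poly_carrier:
  assumes "stochastic_game \<Gamma>" "m \<le> n_states \<Gamma>"
  shows "aux_poly \<Gamma> m \<in> carrier_mat (prod_list (row_radices \<Gamma>)) (prod_list (col_radices \<Gamma>))"
  unfolding aux_poly_def
  by (rule aux_mat_carrier[OF _ data_array_carrier]) (use assms in \<open>auto simp: stochastic_game_def\<close>)

lemma aux_poly_index:
  assumes "stochastic_game \<Gamma>" "m \<le> n_states \<Gamma>"
    "I < prod_list (row_radices \<Gamma>)" "J < prod_list (col_radices \<Gamma>)"
  shows "aux_poly \<Gamma> m $$ (I, J) = signed_minor (n_states \<Gamma>) (\<lambda>k m. data_array \<Gamma> (\<lambda>a. [:[:a:]:]) [:0, 1:] k m $$
    (digits (row_radices \<Gamma>) I ! (k - 1), digits (col_radices \<Gamma>) J ! (k - 1))) m"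
  unfolding aux_poly_def
  by (rule aux_mat_index[OF _ data_array_carrier]) (use assms in \<open>auto simp: stochastic_game_def\<close>)

lemma pencil_poly_carrier:
  assumes "stochastic_game \<Gamma>" "k \<le> n_states \<Gamma>"
  shows "pencil_poly \<Gamma> k \<in> carrier_mat (prod_list (row_radices \<Gamma>)) (prod_list (col_radices \<Gamma>))"
  unfolding pencil_poly_def
  by (rule minus_carrier_mat, rule smult_carrier_mat, rule aux_poly_carrier[OF assms(1)]) simp

lemma pencil_poly_index:
  assumes "stochastic_game \<Gamma>" "k \<le> n_states \<Gamma>"
    "I < prod_list (row_radices \<Gamma>)" "J < prod_list (col_radices \<Gamma>)"
  shows "pencil_poly \<Gamma> k $$ (I, J) = aux_poly \<Gamma> k $$ (I, J) - [:[:0, 1:]:] * aux_poly \<Gamma> 0 $$ (I, J)"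
  using aux_poly_carrier[OF assms(1,2)] aux_poly_carrier[OF assms(1), of 0] assms(3,4)
  unfolding pencil_poly_def by (simp del: upt_Suc)

lemma data_array_eval:
  assumes "i < acts1 \<Gamma> k" "j < acts2 \<Gamma> k"
  shows "poly (data_array \<Gamma> (\<lambda>a. [:[:a:]:]) [:0, 1:] k m $$ (i, j)) [:lam:] = [:data_array \<Gamma> id lam k m $$ (i, j):]"
  using assms by (auto simp: data_array_def one_pCons algebra_simps)

text \<open>The reduced auxiliary matrices at \<open>lam\<close> are obtained from the bivariate ones by choosing indices and
  evaluating, so a minor of the reduced pencil is up to sign the value at \<open>lam\<close> of a minor of the full
  one.\<close>

lemma minor_with_root:
  assumes game: "stochastic_game \<Gamma>" and lam: "lam \<in> {0<..1}" and k: "k \<in> {1..n_states \<Gamma>}"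
    and kernels: "\<And>l. l \<in> {1..n_states \<Gamma>} \<Longrightarrow>
      shapley_snow_kernel (local_game \<Gamma> lam (discounted_value \<Gamma> lam) l) (R l) (C l)"
  obtains P where "P \<in> minors (pencil_poly \<Gamma> k)" "P \<noteq> 0"
    "poly (poly P [:lam:]) (discounted_value \<Gamma> lam k) = 0"
    "degree (poly P [:lam:]) \<le> reduced_rank \<Gamma> lam R C"
proof -
  let ?n = "n_states \<Gamma>"
  let ?N = "[1..<Suc ?n]"
  let ?A = "aux_mat ?n (reduced_array (data_array \<Gamma> id lam) R C)"
  let ?rs = "map (\<lambda>k. card (R k)) ?N" and ?ss = "map (\<lambda>k. card (C k)) ?N"
  let ?as = "map (acts1 \<Gamma>) ?N" and ?bs = "map (acts2 \<Gamma>) ?N"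
  have n: "1 \<le> ?n" using game by (simp add: stochastic_game_def)
  have k': "k \<le> ?n" using k by simp
  obtain s S T M where s: "0 < s" "\<And>a. a < s \<Longrightarrow> S a < prod_list ?rs" "\<And>a. a < s \<Longrightarrow> T a < prod_list ?ss"
    and M: "M = det (mat s s (\<lambda>(i, j). [:?A k $$ (S i, T j), - ?A 0 $$ (S i, T j):]))" "M \<noteq> 0"
    "poly M (discounted_value \<Gamma> lam k) = 0" "degree M \<le> reduced_rank \<Gamma> lam R C"
    using reduced_pencil_minor[OF game lam k kernels, of thesis] by blast
  have sub: "R l \<subseteq> {..<acts1 \<Gamma> l}" "C l \<subseteq> {..<acts2 \<Gamma> l}" if "l \<in> {1..?n}" for l
    using kernels[OF that] by (simp_all add: shapley_snow_kernel_def)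
  have nth: "?N ! a = Suc a" if "a < ?n" for a using that nth_upt[of 1 a "Suc ?n"] by simp
  \<comment> \<open>The increasing enumerations of the kernel sets act on each digit of an index.\<close>
  have lift: "\<exists>f. \<forall>I<prod_list (map (\<lambda>k. card (Q k)) ?N). f I < prod_list (map c ?N) \<and>
      (\<forall>l\<in>{1..?n}. digits (map c ?N) (f I) ! (l - 1) = pick (Q l) (digits (map (\<lambda>k. card (Q k)) ?N) I ! (l - 1)))"
    if Q: "\<And>l. l \<in> {1..?n} \<Longrightarrow> Q l \<subseteq> {..<c l}" for Q :: "nat \<Rightarrow> nat set" and c
  proof -
    have "\<exists>I'<prod_list (map c ?N). \<forall>l\<in>{1..?n}. digits (map c ?N) I' ! (l - 1) =
        pick (Q l) (digits (map (\<lambda>k. card (Q k)) ?N) I ! (l - 1))"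
      if I: "I < prod_list (map (\<lambda>k. card (Q k)) ?N)" for I
    proof -
      let ?a = "\<lambda>a. pick (Q (Suc a)) (digits (map (\<lambda>k. card (Q k)) ?N) I ! a)"
      have "?a a < map c ?N ! a" if "a < length (map c ?N)" for a
      proof -
        have a: "Suc a \<in> {1..?n}" "a < ?n" using that by (simp_all del: upt_Suc)
        have "digits (map (\<lambda>k. card (Q k)) ?N) I ! a < card (Q (Suc a))" using digit_less[OF I a(1)] by simp
        from pick_in_set_le[OF this] have "?a a < c (Suc a)" using Q[OF a(1)] by blast
        then show ?thesis using nth[OF a(2)] that by (simp del: upt_Suc)
      qed
      then obtain I' where I': "I' < prod_list (map c ?N)" "\<And>a. a < length (map c ?N) \<Longrightarrow> digits (map c ?N) I' ! a = ?a a"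
        using digits_surj[of "map c ?N" ?a] by blast
      have "digits (map c ?N) I' ! (l - 1) = pick (Q l) (digits (map (\<lambda>k. card (Q k)) ?N) I ! (l - 1))"
        if "l \<in> {1..?n}" for l
      proof -
        have "l - 1 < length (map c ?N)" "Suc (l - 1) = l" using that by (simp_all del: upt_Suc) arith
        then show ?thesis using I'(2)[of "l - 1"] by simp
      qed
      then show ?thesis using I'(1) by blast
    qed
    then show ?thesis by metis
  qed
  obtain f where f: "\<And>I. I < prod_list ?rs \<Longrightarrow> f I < prod_list ?as"
    "\<And>I l. I < prod_list ?rs \<Longrightarrow> l \<in> {1..?n} \<Longrightarrow> digits ?as (f I) ! (l - 1) = pick (R l) (digits ?rs I ! (l - 1))"
    using lift[of R "acts1 \<Gamma>"] sub(1) by blast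
  obtain g where g: "\<And>I. I < prod_list ?ss \<Longrightarrow> g I < prod_list ?bs"
    "\<And>I l. I < prod_list ?ss \<Longrightarrow> l \<in> {1..?n} \<Longrightarrow> digits ?bs (g I) ! (l - 1) = pick (C l) (digits ?ss I ! (l - 1))"
    using lift[of C "acts2 \<Gamma>"] sub(2) by blast
  interpret ev: comm_ring_hom "\<lambda>P. poly P [:lam:]" by (rule comm_ring_hom_poly)
  interpret co: comm_ring_hom "\<lambda>c::real. [:c:]" by (rule comm_ring_hom_const_poly)
  have carr: "reduced_array (data_array \<Gamma> id lam) R C l m \<in> carrier_mat (card (R l)) (card (C l))"
    if "l \<in> {1..?n}" "m \<le> ?n" for l m by (rule reduced_array_carrier(1)[where R = R and C = C, OF sub[OF that(1)]])
  have eval: "poly (aux_poly \<Gamma> m $$ (f I, g J)) [:lam:] = [:?A m $$ (I, J):]"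
    if m: "m \<le> ?n" and I: "I < prod_list ?rs" and J: "J < prod_list ?ss" for m I J
  proof -
    have ax: "?A m $$ (I, J) = signed_minor ?n (\<lambda>l m'. reduced_array (data_array \<Gamma> id lam) R C l m' $$
        (digits ?rs I ! (l - 1), digits ?ss J ! (l - 1))) m"
      by (rule aux_mat_index[where r = "\<lambda>k. card (R k)" and s = "\<lambda>k. card (C k)", OF n carr m I J])
    show ?thesis
      unfolding ax aux_poly_index[OF game m f(1)[OF I] g(1)[OF J]] ev.signed_minor_hom co.signed_minor_hom
    proof (rule signed_minor_cong[OF _ m])
      fix l m' assume l: "l \<in> {1..?n}"
      let ?i = "digits ?rs I ! (l - 1)" and ?j = "digits ?ss J ! (l - 1)"
      have ij: "?i < card (R l)" "?j < card (C l)" using digit_less[OF I l] digit_less[OF J l] .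
      have pk: "pick (R l) ?i < acts1 \<Gamma> l" "pick (C l) ?j < acts2 \<Gamma> l"
        using pick_in_set_le[OF ij(1)] pick_in_set_le[OF ij(2)] sub[OF l] by blast+
      show "poly (data_array \<Gamma> (\<lambda>a. [:[:a:]:]) [:0, 1:] l m' $$ (digits ?as (f I) ! (l - 1), digits ?bs (g J) ! (l - 1))) [:lam:] =
          [:reduced_array (data_array \<Gamma> id lam) R C l m' $$ (?i, ?j):]"
        unfolding f(2)[OF I l] g(2)[OF J l] reduced_array_carrier(2)[where R = R and C = C, OF sub[OF l] ij]
        by (rule data_array_eval[OF pk])
    qed
  qed
  define X where "X = pencil_poly \<Gamma> k"
  have X: "X \<in> carrier_mat (prod_list ?as) (prod_list ?bs)"
    unfolding X_def by (rule pencil_poly_carrier[OF game k'])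
  define P where "P = fminor X (\<lambda>a. f (S a)) (\<lambda>a. g (T a)) s"
  have "poly P [:lam:] = det (map_mat (\<lambda>P. poly P [:lam:]) (mat s s (\<lambda>(a, b). X $$ (f (S a), g (T b)))))"
    unfolding P_def fminor_def by (rule ev.hom_det[symmetric])
  also have "map_mat (\<lambda>P. poly P [:lam:]) (mat s s (\<lambda>(a, b). X $$ (f (S a), g (T b)))) =
      mat s s (\<lambda>(i, j). [:?A k $$ (S i, T j), - ?A 0 $$ (S i, T j):])"
    by (rule eq_matI)
      (auto simp: X_def pencil_poly_index[OF game k' f(1)[OF s(2)] g(1)[OF s(3)]] eval[OF k' s(2) s(3)] eval[OF le0 s(2) s(3)])
  finally have PM: "poly P [:lam:] = M" using M(1) by simp
  then have P0: "P \<noteq> 0" using M(2) by auto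
  obtain e R' C' where e: "e = 1 \<or> e = -1" and R': "R' \<noteq> {}" "R' \<subseteq> {..<dim_row X}" "C' \<subseteq> {..<dim_col X}"
    "card R' = s" "card C' = s" and P: "P = e * det (submatrix X R' C')"
    using fminor_in_minors[OF P0[unfolded P_def] s(1), of thesis] X f(1)[OF s(2)] g(1)[OF s(3)] unfolding P_def by auto
  define P' where "P' = det (submatrix X R' C')"
  have "P' \<in> minors X" using R' unfolding P'_def minors_def mem_Collect_eq
    by (intro exI[of _ R'] exI[of _ C']) simp
  moreover have PP': "P' = P \<or> P' = - P" using e P unfolding P'_def by auto
  moreover from PP' have "poly P' [:lam:] = M \<or> poly P' [:lam:] = - M" using PM by auto
  ultimately show ?thesis using P0 M by (intro that[of P']) (auto simp: X_def)
qed

lemma finite_minors: "finite (minors A)"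
proof -
  have "minors A \<subseteq> (\<lambda>(R, C). det (submatrix A R C)) ` (Pow {..<dim_row A} \<times> Pow {..<dim_col A})"
    unfolding minors_def by auto
  then show ?thesis by (rule finite_subset) simp
qed

section \<open>Cluster points of the discounted values\<close>

lemma E_set_eq: "E_set \<Gamma> r k = {P \<in> minors (pencil_poly \<Gamma> k). P \<noteq> 0 \<and> (\<forall>s. degree (coeff P s) \<le> r)}"
  by (simp add: E_set_def pencil_poly_def)

lemma finite_V_set: "finite (V_set \<Gamma> r k)"
proof -
  have "V_set \<Gamma> r k \<subseteq> (\<Union>P\<in>E_set \<Gamma> r k. {w. poly (lowest_coeff P) w = 0})" by (auto simp: V_set_def)
  moreover have "finite (\<Union>P\<in>E_set \<Gamma> r k. {w. poly (lowest_coeff P) w = 0})"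
    by (intro finite_UN_I) (auto simp: E_set_eq finite_minors intro!: poly_roots_finite lowest_coeff_nonzero)
  ultimately show ?thesis by (rule finite_subset)
qed

text \<open>The finitely many minors \<open>P\<close> with \<open>\<phi>(P)(u) \<noteq> 0\<close> do not vanish along \<open>F\<close> eventually, so those that do
  have \<open>u\<close> among the roots of \<open>\<phi>(P)\<close>. The bound \<open>\<rho>\<close> on the degree may vary along \<open>F\<close>, as the kernels do.\<close>

lemma eventually_limit_in_V_set:
  assumes F: "F \<le> at_right 0" and u: "u \<in> {Min (stage_payoffs \<Gamma>)..Max (stage_payoffs \<Gamma>)}"
    and v: "(v \<longlongrightarrow> u) F"
    and root: "\<forall>\<^sub>F lam in F. \<exists>P\<in>E_set \<Gamma> (\<rho> lam) k. poly (poly P [:lam:]) (v lam) = 0"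
  shows "\<forall>\<^sub>F lam in F. u \<in> V_set \<Gamma> (\<rho> lam) k"
proof -
  let ?G = "{P \<in> minors (pencil_poly \<Gamma> k). P \<noteq> 0 \<and> poly (lowest_coeff P) u \<noteq> 0}"
  have l: "((\<lambda>lam. lam) \<longlongrightarrow> (0::real)) F" using F by (rule tendsto_mono) (rule tendsto_ident_at)
  have l0: "\<forall>\<^sub>F lam in F. lam \<noteq> 0"
    using F by (rule filter_leD) (simp add: eventually_at_filter)
  have "\<forall>\<^sub>F lam in F. \<forall>P\<in>?G. poly (poly P [:lam:]) (v lam) \<noteq> 0"
    by (rule eventually_ball_finite) (auto simp: finite_minors intro!: eventually_nonzero_near_nonroot l l0 v)
  with root show ?thesis
  proof eventually_elim
    case (elim lam)
    then obtain P where P: "P \<in> E_set \<Gamma> (\<rho> lam) k" "poly (poly P [:lam:]) (v lam) = 0" by blast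
    then have "poly (lowest_coeff P) u = 0" using elim(2) by (auto simp: E_set_eq)
    then show ?case using P(1) u by (auto simp: V_set_def)
  qed
qed

lemma E_set_rational:
  assumes game: "stochastic_game \<Gamma>" and k: "k \<le> n_states \<Gamma>" and rat: "rational_data \<Gamma>"
    and P: "P \<in> E_set \<Gamma> r k"
  shows "coeff (coeff P s) i \<in> \<rat>"
proof -
  let ?n = "n_states \<Gamma>"
  let ?as = "map (acts1 \<Gamma>) [1..<Suc ?n]" and ?bs = "map (acts2 \<Gamma>) [1..<Suc ?n]"
  define Q1 where "Q1 = {p :: real poly. \<forall>i. coeff p i \<in> \<rat>}"
  define Q2 where "Q2 = {P :: real poly poly. \<forall>i. coeff P i \<in> Q1}"
  have Q1: "subring_set Q1" unfolding Q1_def by (rule subring_set_poly[OF subring_set_Rats])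
  have Q2: "subring_set Q2" unfolding Q2_def by (rule subring_set_poly[OF Q1])
  have ring: "a + b \<in> Q2" "a * b \<in> Q2" "- a \<in> Q2" "1 \<in> Q2" if "a \<in> Q2" "b \<in> Q2" for a b
    using Q2 that by (auto simp: subring_set_def)
  have one: "1 \<in> Q2" using Q2 by (simp add: subring_set_def)
  have diff: "a - b \<in> Q2" if "a \<in> Q2" "b \<in> Q2" for a b
    using ring(1)[OF that(1) ring(3)[OF that(2) that(2)]] by simp
  have const: "[:[:a:]:] \<in> Q2" if "a \<in> \<rat>" for a
    using that by (auto simp: Q2_def Q1_def coeff_pCons split: nat.split)
  have t: "[:0, 1:] \<in> Q2" by (auto simp: Q2_def Q1_def coeff_pCons split: nat.split)
  have w: "[:[:0, 1:]:] \<in> Q2" by (auto simp: Q2_def Q1_def coeff_pCons split: nat.split)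
  have data: "data_array \<Gamma> (\<lambda>a. [:[:a:]:]) [:0, 1:] l m $$ (i, j) \<in> Q2"
    if "l \<in> {1..?n}" "m \<le> ?n" "i < acts1 \<Gamma> l" "j < acts2 \<Gamma> l" for l m i j
  proof -
    have "payoff \<Gamma> l i j \<in> \<rat>" "\<And>m. m \<in> {1..?n} \<Longrightarrow> pmf (trans \<Gamma> l i j) m \<in> \<rat>"
      using rat that unfolding rational_data_def by blast+
    then show ?thesis using that
      by (auto simp: data_array_def intro!: ring(2) diff t one const simp del: mult_pCons_left mult_pCons_right)
  qed
  have minor: "signed_minor ?n c l \<in> Q2"
    if "\<And>k m. k \<in> {1..?n} \<Longrightarrow> m \<le> ?n \<Longrightarrow> c k m \<in> Q2" "l \<le> ?n" for c l
  proof -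
    have "(- 1) ^ l \<in> Q2" using one ring(3)[OF one one] by (cases "even l") auto
    moreover have "(\<Sum>p | p permutes {1..?n}. of_int (sign p) *
       (\<Prod>k = 1..?n. c k (if p k \<le> l then p k - 1 else p k))) \<in> Q2"
    proof (intro subring_set_sum subring_set_signed subring_set_prod Q2 that)
      fix p k assume "p \<in> {p. p permutes {1..?n}}" "k \<in> {1..?n}"
      then have "p k \<in> {1..?n}" using permutes_in_image[of p "{1..?n}" k] by blast
      then show "(if p k \<le> l then p k - 1 else p k) \<le> ?n" by auto
    qed
    ultimately show ?thesis unfolding signed_minor_def by (rule ring(2))
  qed
  have aux: "aux_poly \<Gamma> m $$ (I, J) \<in> Q2" if "m \<le> ?n" "I < prod_list ?as" "J < prod_list ?bs" for m I J
    unfolding aux_poly_index[OF game that]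
    by (intro minor data digit_less that) auto
  have pencil: "pencil_poly \<Gamma> k $$ (I, J) \<in> Q2" if "I < prod_list ?as" "J < prod_list ?bs" for I J
    unfolding pencil_poly_index[OF game k that] by (intro diff ring(2) w aux k that) auto
  let ?X = "pencil_poly \<Gamma> k"
  have X: "dim_row ?X = prod_list ?as" "dim_col ?X = prod_list ?bs"
    using pencil_poly_carrier[OF game k] by blast+
  obtain R C where RC: "R \<subseteq> {..<dim_row ?X}" "C \<subseteq> {..<dim_col ?X}" "P = det (submatrix ?X R C)"
    using P unfolding E_set_eq minors_def by blast
  have "P \<in> Q2"
    unfolding RC(3)
  proof (rule subring_set_det[OF Q2])
    fix i j assume "i < dim_row (submatrix ?X R C)" "j < dim_col (submatrix ?X R C)"
    then have ij: "i < card {i. i < dim_row ?X \<and> i \<in> R}" "j < card {j. j < dim_col ?X \<and> j \<in> C}"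
      by (simp_all add: dim_submatrix)
    show "submatrix ?X R C $$ (i, j) \<in> Q2"
      unfolding submatrix_index[OF ij] using pick_le[OF ij(1)] pick_le[OF ij(2)] X by (intro pencil) auto
  qed
  then show ?thesis by (simp add: Q2_def Q1_def)
qed

theorem mainTheorem2:
  fixes \<Gamma> :: stoch_game and k :: nat and R C :: "real \<Rightarrow> nat \<Rightarrow> nat set"
  assumes game: "stochastic_game \<Gamma>"
    and state: "k \<in> {1..n_states \<Gamma>}"
    and kernels: "\<And>lam l. lam \<in> {0<..1} \<Longrightarrow> l \<in> {1..n_states \<Gamma>} \<Longrightarrow>
      shapley_snow_kernel (local_game \<Gamma> lam (discounted_value \<Gamma> lam) l) (R lam l) (C lam l)"
  shows
    "(\<forall>lam\<in>{0<..1}. finite (V_set \<Gamma> (reduced_rank \<Gamma> lam (R lam) (C lam)) k)) \<and>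
     (\<forall>w. accumulation_point (\<lambda>lam. discounted_value \<Gamma> lam k) (at_right 0) w \<longrightarrow>
        (\<forall>\<^sub>F lam in at_right 0. w \<in> V_set \<Gamma> (reduced_rank \<Gamma> lam (R lam) (C lam)) k)) \<and>
     (\<exists>v0. ((\<lambda>lam. discounted_value \<Gamma> lam k) \<longlongrightarrow> v0) (at_right 0) \<and>
        (\<forall>\<^sub>F lam in at_right 0. v0 \<in> V_set \<Gamma> (reduced_rank \<Gamma> lam (R lam) (C lam)) k) \<and>
        (rational_data \<Gamma> \<longrightarrow>
           algebraic v0 \<and>
           (\<forall>\<^sub>F lam in at_right 0. algebraic_degree v0 \<le> reduced_rank \<Gamma> lam (R lam) (C lam))))"
proof -
  define v where "v lam = discounted_value \<Gamma> lam k" for lam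
  define \<rho> where "\<rho> lam = reduced_rank \<Gamma> lam (R lam) (C lam)" for lam
  let ?min = "Min (stage_payoffs \<Gamma>)" and ?max = "Max (stage_payoffs \<Gamma>)"
  let ?\<M> = "minors (pencil_poly \<Gamma> k)"
  have k': "k \<le> n_states \<Gamma>" using state by simp
  have ev01: "\<forall>\<^sub>F lam in at_right 0. lam \<in> {0<..1::real}"
    by (rule eventually_at_rightI[of 0 1]) auto
  have bounds: "v lam \<in> {?min..?max}" if "lam \<in> {0<..1}" for lam
    unfolding v_def by (rule discounted_value_bounds[OF game that state])
  \<comment> \<open>The degree bound of \<open>minor_with_root\<close> concerns one discount rate, that of \<open>E_set\<close> all of them.\<close>
  have "\<forall>\<^sub>F lam in at_right 0. \<forall>P\<in>?\<M>. \<forall>s. degree (coeff P s) \<le> degree (poly P [:lam:])"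
    by (rule eventually_ball_finite[OF finite_minors]) (intro ballI eventually_degree_coeff_le)
  with ev01 have root: "\<forall>\<^sub>F lam in at_right 0. \<exists>P\<in>E_set \<Gamma> (\<rho> lam) k. poly (poly P [:lam:]) (v lam) = 0"
  proof eventually_elim
    case (elim lam)
    obtain P where P: "P \<in> ?\<M>" "P \<noteq> 0" "poly (poly P [:lam:]) (discounted_value \<Gamma> lam k) = 0"
      "degree (poly P [:lam:]) \<le> reduced_rank \<Gamma> lam (R lam) (C lam)"
      using minor_with_root[OF game elim(1) state kernels[OF elim(1)], of thesis] by blast
    have "P \<in> E_set \<Gamma> (\<rho> lam) k"
      unfolding E_set_eq \<rho>_def using P elim(2) by (auto intro: order_trans)
    then show ?case using P(3) unfolding v_def by blast
  qed
  \<comment> \<open>A bound on all degrees gives one finite set that contains every cluster point.\<close>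
  obtain r0 where r0: "\<And>P s. P \<in> ?\<M> \<Longrightarrow> degree (coeff P s) \<le> r0"
  proof -
    let ?D = "\<Union>P\<in>?\<M>. (\<lambda>s. degree (coeff P s)) ` {..degree P}"
    have "finite ?D" using finite_minors by blast
    then obtain r0 where "\<forall>d\<in>?D. d \<le> r0" using finite_nat_set_iff_bounded_le by blast
    then have "degree (coeff P s) \<le> r0" if "P \<in> ?\<M>" for P s
      using that by (cases "s \<le> degree P") (auto simp: coeff_eq_0)
    then show ?thesis using that by blast
  qed
  have E0: "E_set \<Gamma> r k \<subseteq> E_set \<Gamma> r0 k" for r using r0 by (auto simp: E_set_eq)
  have root0: "\<forall>\<^sub>F lam in at_right 0. \<exists>P\<in>E_set \<Gamma> r0 k. poly (poly P [:lam:]) (v lam) = 0"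
    using root by eventually_elim (use E0 in blast)
  have acc0: "u \<in> V_set \<Gamma> r0 k" if u: "accumulation_point v (at_right 0) u" for u
  proof -
    \<comment> \<open>Restricting to discount rates with values near \<open>u\<close> makes the cluster point a limit.\<close>
    define F where "F = inf (at_right 0) (filtercomap v (nhds u))"
    have F: "F \<le> at_right 0" by (simp add: F_def)
    have vF: "(v \<longlongrightarrow> u) F" unfolding F_def by (rule filterlim_mono[OF filterlim_filtercomap]) auto
    have bot: "F \<noteq> bot"
    proof
      assume "F = bot"
      then have "\<forall>\<^sub>F lam in F. False" by simp
      then obtain Q U where Q: "\<forall>\<^sub>F lam in at_right 0. Q lam" and U: "open U" "u \<in> U" "\<And>lam. Q lam \<Longrightarrow> v lam \<in> U \<Longrightarrow> False"
        unfolding F_def eventually_inf eventually_filtercomap eventually_nhds by blast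
      have "\<exists>\<^sub>F lam in at_right 0. v lam \<in> U" using u U(1,2) unfolding accumulation_point_def by blast
      moreover have "\<forall>\<^sub>F lam in at_right 0. v lam \<notin> U" using Q by eventually_elim (use U(3) in blast)
      ultimately show False by (simp add: frequently_def)
    qed
    have "\<forall>\<^sub>F lam in F. v lam \<in> {?min..?max}"
      using filter_leD[OF F ev01] by eventually_elim (rule bounds)
    then have "u \<in> {?min..?max}" by (rule Lim_in_closed_set[OF closed_atLeastAtMost _ bot vF])
    from eventually_limit_in_V_set[OF F this vF filter_leD[OF F root0]]
    show ?thesis using bot by (simp add: eventually_const)
  qed
  have cont: "continuous_on {0<..1} v"
    unfolding v_def[abs_def] by (rule continuous_on_discounted_value[OF game state])
  obtain v0 where v0: "(v \<longlongrightarrow> v0) (at_right 0)"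
    using tendsto_of_finite_cluster_points[OF cont bounds finite_V_set acc0] by blast
  have "\<forall>\<^sub>F lam in at_right 0. v lam \<in> {?min..?max}"
    using ev01 by eventually_elim (rule bounds)
  then have "v0 \<in> {?min..?max}" by (rule Lim_in_closed_set[OF closed_atLeastAtMost _ _ v0]) simp
  from eventually_limit_in_V_set[OF order_refl this v0 root]
  have V: "\<forall>\<^sub>F lam in at_right 0. v0 \<in> V_set \<Gamma> (\<rho> lam) k" .
  have acc_unique: "w = v0" if w: "accumulation_point v (at_right 0) w" for w
  proof (rule ccontr)
    assume "w \<noteq> v0"
    then obtain U U' where U: "open U" "open U'" "w \<in> U" "v0 \<in> U'" "U \<inter> U' = {}"
      using hausdorff[OF \<open>w \<noteq> v0\<close>] by blast
    have "\<exists>\<^sub>F lam in at_right 0. v lam \<in> U" using w U unfolding accumulation_point_def by blast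
    moreover have "\<forall>\<^sub>F lam in at_right 0. v lam \<notin> U"
      using topological_tendstoD[OF v0 U(2,4)] by eventually_elim (use U(5) in blast)
    ultimately show False by (simp add: frequently_def)
  qed
  have alg: "algebraic v0 \<and> algebraic_degree v0 \<le> r" if rat: "rational_data \<Gamma>" and r: "v0 \<in> V_set \<Gamma> r k" for r
  proof -
    obtain P where P: "P \<in> E_set \<Gamma> r k" "poly (lowest_coeff P) v0 = 0" using r by (auto simp: V_set_def)
    have nz: "lowest_coeff P \<noteq> 0" using P(1) by (intro lowest_coeff_nonzero) (auto simp: E_set_eq)
    have rats: "\<forall>i. coeff (lowest_coeff P) i \<in> \<rat>"
      unfolding lowest_coeff_def using E_set_rational[OF game k' rat P(1)] by blast
    have "algebraic_degree v0 \<le> degree (lowest_coeff P)"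
      unfolding algebraic_degree_def by (rule Least_le) (use nz rats P(2) in blast)
    also have "\<dots> \<le> r" using P(1) unfolding lowest_coeff_def by (auto simp: E_set_eq)
    finally show ?thesis using nz rats P(2) by (auto simp: algebraic_altdef)
  qed
  have "algebraic v0 \<and> (\<forall>\<^sub>F lam in at_right 0. algebraic_degree v0 \<le> \<rho> lam)" if rat: "rational_data \<Gamma>"
  proof
    show "algebraic v0" using eventually_happens[OF V] alg[OF rat] by auto
    show "\<forall>\<^sub>F lam in at_right 0. algebraic_degree v0 \<le> \<rho> lam"
      using V by eventually_elim (use alg[OF rat] in blast)
  qed
  moreover have "\<forall>w. accumulation_point v (at_right 0) w \<longrightarrow> (\<forall>\<^sub>F lam in at_right 0. w \<in> V_set \<Gamma> (\<rho> lam) k)"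
    using acc_unique V by blast
  ultimately show ?thesis
    using v0 V finite_V_set unfolding v_def[abs_def] \<rho>_def[abs_def] by (intro conjI exI[of _ v0]) blast+
qed

end
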